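(* Let $F$ be a sufficiently saturated model of a dimensional theory expanding the theory of fields, with dimension $\delta$. Let $A\subseteq F$ be a small set of parameters and let $X\subseteq F$ be a subset type-definable over $A$ satisfying \[0<\delta(X+X)=\delta(XX)=\delta(X)<\infty .\] Let $p$ be a generic type on $X$ over $A$. Then $\frac{p-p}{p-p}$ is a definable subfield of $F$, and $\delta\left(\frac{p-p}{p-p}\right)=\delta(X)$.
   Context: Dimension. Let $T$ be a complete first-order theory and $M\models T$. "Definable" means definable with parameters; $\operatorname{Def}(M)$ is the collection of sets definable in $M$ (subsets of finite Cartesian powers of $M$) with parameters from $M$. A (continuous, real-valued) dimension is a function $\delta:\operatorname{Def}(M)\to\mathbb{R}_{\ge 0}\cup\{+\infty\}$ such that for all definable $X,Y$: (1) $\delta(X\cup Y)=\max\{\delta(X),\delta(Y)\}$; (2) $\delta(X\times Y)=\delta(X)+\delta(Y)$ for $X,Y$ nonempty; (3) $\delta(X)=0$ if $X$ is finite; (4) $\delta(X\cap Y)\le\min\{\delta(X),\delta(Y)\}$; (5) for every definable surjection $f:X\to Y$ between nonempty sets, $\delta(Y)+\inf_{y\in Y}\delta(f^{-1}(y))\le\delta(X)\le\delta(Y)+\sup_{y\in Y}\delta(f^{-1}(y))$; and (continuity) for every formula $\phi(\bar x,\bar y)$ and reals $s<t$ there is a $\emptyset$-definable set $D$ with $\{a:\delta(\phi(\bar x,a))\le s\}\subseteq D\subseteq\{b:\delta(\phi(\bar x,b))<t\}$. $T$ is a dimensional theory if some model has such a $\delta$; by continuity $\delta(\phi(\bar x,a))$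 depends only on $\operatorname{tp}(a/\emptyset)$, so $\delta$ transfers uniquely to all models of $T$ and is called the dimension of $T$. Partial types. A partial type is a consistent collection of formulas, possibly with parameters; a type-definable set over $A$ is the set of realizations of a partial type over $A$, and types are identified with their sets of realizations in the saturated model. For a partial type $\Gamma$, $\delta(\Gamma)=\inf\{\delta(\phi):\Gamma\models\phi\}$. A generic type on a set $X$ type-definable over $A$ (over $A$) is a complete type $p$ over $A$ extending the partial type defining $X$ with $\delta(p)=\delta(X)$. Set operations. For subsets $X,Y$ of a field, $X\pm Y=\{x\pm y\}$, $XY=\{xy\}$, with $x\in X,y\in Y$, and $\frac{X}{Y}=\{x/y:x\in X,\ y\in Y\setminus\{0\}\}$. *)

theory Defs
  imports
    "HOL-Library.Extended_Nonnegative_Real"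
    "HOL-Library.Set_Algebras"
begin

unbundle cardinal_syntax

section \<open>First-order structures and formulas with parameters\<close>

text \<open>
  The universe of a structure is its whole carrier type \<^typ>\<open>'a\<close>. A symbol applied to argument
  lists of different lengths counts as different symbols; a language that assigns one arity to
  each symbol is covered by giving the unused arities a trivial interpretation.
\<close>

record ('a, 'f, 'r) struc =
  funs :: "'f \<Rightarrow> 'a list \<Rightarrow> 'a"
  rels :: "'r \<Rightarrow> 'a list \<Rightarrow> bool"

text \<open>
  Elements of the structure may occur in formulas as parameters, through the constructor
  \<open>Par\<close>. The set functions \<open>tm_params\<close> and \<open>params\<close> collect them, so the formulas
  of the language itself are those with \<open>params \<phi> = {}\<close>.
\<close>

datatype (tm_funs: 'f, tm_params: 'a) tm =
    Var nat
  | Par 'a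
  | Fun 'f "('f, 'a) tm list"

datatype (fm_funs: 'f, fm_rels: 'r, params: 'a) fm =
    Eq "('f, 'a) tm" "('f, 'a) tm"
  | Rel 'r "('f, 'a) tm list"
  | Neg "('f, 'r, 'a) fm"
  | Conj "('f, 'r, 'a) fm" "('f, 'r, 'a) fm"
  | Ex nat "('f, 'r, 'a) fm"

primrec fv_tm :: "('f, 'a) tm \<Rightarrow> nat set" where
  "fv_tm (Var i) = {i}"
| "fv_tm (Par a) = {}"
| "fv_tm (Fun f ts) = \<Union> (set (map fv_tm ts))"

primrec fv :: "('f, 'r, 'a) fm \<Rightarrow> nat set" where
  "fv (Eq t u) = fv_tm t \<union> fv_tm u"
| "fv (Rel r ts) = \<Union> (set (map fv_tm ts))"
| "fv (Neg \<phi>) = fv \<phi>"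
| "fv (Conj \<phi> \<psi>) = fv \<phi> \<union> fv \<psi>"
| "fv (Ex i \<phi>) = fv \<phi> - {i}"

primrec tm_val :: "('a, 'f, 'r) struc \<Rightarrow> (nat \<Rightarrow> 'a) \<Rightarrow> ('f, 'a) tm \<Rightarrow> 'a" where
  "tm_val M v (Var i) = v i"
| "tm_val M v (Par a) = a"
| "tm_val M v (Fun f ts) = funs M f (map (tm_val M v) ts)"

primrec sat :: "('a, 'f, 'r) struc \<Rightarrow> (nat \<Rightarrow> 'a) \<Rightarrow> ('f, 'r, 'a) fm \<Rightarrow> bool" where
  "sat M v (Eq t u) \<longleftrightarrow> tm_val M v t = tm_val M v u"
| "sat M v (Rel r ts) \<longleftrightarrow> rels M r (map (tm_val M v) ts)"
| "sat M v (Neg \<phi>) \<longleftrightarrow> \<not> sat M v \<phi>"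
| "sat M v (Conj \<phi> \<psi>) \<longleftrightarrow> sat M v \<phi> \<and> sat M v \<psi>"
| "sat M v (Ex i \<phi>) \<longleftrightarrow> (\<exists>a. sat M (v(i := a)) \<phi>)"

definition formulas :: "nat \<Rightarrow> 'a set \<Rightarrow> ('f, 'r, 'a) fm set" where
  "formulas n A = {\<phi>. fv \<phi> \<subseteq> {..<n} \<and> params \<phi> \<subseteq> A}"

text \<open>
  Tuples are lists. A tuple \<open>xs\<close> assigns \<open>xs ! i\<close> to variable \<open>i\<close>; the value at
  \<open>i \<ge> length xs\<close> is irrelevant, because \<open>holds M \<phi> xs\<close> is only used for
  \<open>\<phi> \<in> formulas (length xs) A\<close>.
\<close>

definition holds :: "('a, 'f, 'r) struc \<Rightarrow> ('f, 'r, 'a) fm \<Rightarrow> 'a list \<Rightarrow> bool" where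
  "holds M \<phi> xs \<longleftrightarrow> sat M (\<lambda>i. if i < length xs then xs ! i else undefined) \<phi>"

definition solutions :: "('a, 'f, 'r) struc \<Rightarrow> nat \<Rightarrow> ('f, 'r, 'a) fm \<Rightarrow> 'a list set" where
  "solutions M n \<phi> = {xs. length xs = n \<and> holds M \<phi> xs}"

text \<open>
  For \<open>\<phi> \<in> formulas (n + length as) {}\<close>, read as \<open>\<phi>(x, y)\<close>, this is the set
  defined by \<open>\<phi>(x, as)\<close>.
\<close>

definition instance_set :: "('a, 'f, 'r) struc \<Rightarrow> nat \<Rightarrow> ('f, 'r, 'a) fm \<Rightarrow> 'a list \<Rightarrow> 'a list set" where
  "instance_set M n \<phi> as = {xs. length xs = n \<and> holds M \<phi> (xs @ as)}"

definition definable :: "('a, 'f, 'r) struc \<Rightarrow> 'a set \<Rightarrow> nat \<Rightarrow> 'a list set \<Rightarrow> bool" where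
  "definable M A n S \<longleftrightarrow> (\<exists>\<phi> \<in> formulas n A. S = solutions M n \<phi>)"

section \<open>Types and saturation\<close>

text \<open>Consistency with the elementary diagram of \<open>M\<close> is finite satisfiability in \<open>M\<close>.\<close>

definition partial_type ::
  "('a, 'f, 'r) struc \<Rightarrow> 'a set \<Rightarrow> nat \<Rightarrow> ('f, 'r, 'a) fm set \<Rightarrow> bool" where
  "partial_type M A n \<Gamma> \<longleftrightarrow>
     \<Gamma> \<subseteq> formulas n A \<and>
     (\<forall>\<Delta> \<subseteq> \<Gamma>. finite \<Delta> \<longrightarrow> (\<exists>xs. length xs = n \<and> (\<forall>\<phi> \<in> \<Delta>. holds M \<phi> xs)))"

definition complete_type ::
  "('a, 'f, 'r) struc \<Rightarrow> 'a set \<Rightarrow> nat \<Rightarrow> ('f, 'r, 'a) fm set \<Rightarrow> bool" where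
  "complete_type M A n p \<longleftrightarrow>
     partial_type M A n p \<and> (\<forall>\<phi> \<in> formulas n A. \<phi> \<in> p \<or> Neg \<phi> \<in> p)"

definition realizations ::
  "('a, 'f, 'r) struc \<Rightarrow> nat \<Rightarrow> ('f, 'r, 'a) fm set \<Rightarrow> 'a list set" where
  "realizations M n \<Gamma> = {xs. length xs = n \<and> (\<forall>\<phi> \<in> \<Gamma>. holds M \<phi> xs)}"

text \<open>
  \<open>\<kappa>\<close>-saturation for a cardinal \<open>\<kappa>\<close> larger than the (infinite) number of formulas of
  the language. A set is small if its cardinality is less than \<open>\<kappa>\<close>.
\<close>

definition sufficiently_saturated :: "'k rel \<Rightarrow> ('a, 'f, 'r) struc \<Rightarrow> bool" where
  "sufficiently_saturated \<kappa> M \<longleftrightarrow>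
     Card_order \<kappa> \<and>
     |{\<phi> :: ('f, 'r, 'a) fm. params \<phi> = {}}| <o \<kappa> \<and>
     (\<forall>n B (\<Gamma> :: ('f, 'r, 'a) fm set).
        |B| <o \<kappa> \<longrightarrow> partial_type M B n \<Gamma> \<longrightarrow> realizations M n \<Gamma> \<noteq> {})"

section \<open>Dimension\<close>

text \<open>
  The dimensional theory is the complete theory of \<open>M\<close>: by continuity a dimension on one
  model of a complete theory transfers uniquely to all models, so it is given on \<open>M\<close> itself.
  Only the values of \<open>\<delta>\<close> on definable sets are constrained. Cartesian products are formed
  by concatenating tuples, and a map is definable if its graph is. In the continuity clause
  \<open>s < 0\<close> is left out, since then the empty set always qualifies.
\<close>

definition cart :: "'a list set \<Rightarrow> 'a list set \<Rightarrow> 'a list set" where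
  "cart X Y = {xs @ ys | xs ys. xs \<in> X \<and> ys \<in> Y}"

definition definable_surjection ::
  "('a, 'f, 'r) struc \<Rightarrow> nat \<Rightarrow> nat \<Rightarrow> ('a list \<Rightarrow> 'a list) \<Rightarrow> 'a list set \<Rightarrow> 'a list set \<Rightarrow> bool" where
  "definable_surjection M m n f X Y \<longleftrightarrow>
     definable M UNIV m X \<and> definable M UNIV n Y \<and> f ` X = Y \<and>
     definable M UNIV (m + n) {xs @ f xs | xs. xs \<in> X}"

definition is_dimension :: "('a, 'f, 'r) struc \<Rightarrow> ('a list set \<Rightarrow> ennreal) \<Rightarrow> bool" where
  "is_dimension M \<delta> \<longleftrightarrow>
     (\<forall>n X Y. definable M UNIV n X \<longrightarrow> definable M UNIV n Y \<longrightarrow>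
        \<delta> (X \<union> Y) = max (\<delta> X) (\<delta> Y)) \<and>
     (\<forall>m n X Y. definable M UNIV m X \<longrightarrow> definable M UNIV n Y \<longrightarrow> X \<noteq> {} \<longrightarrow> Y \<noteq> {} \<longrightarrow>
        \<delta> (cart X Y) = \<delta> X + \<delta> Y) \<and>
     (\<forall>n X. definable M UNIV n X \<longrightarrow> finite X \<longrightarrow> \<delta> X = 0) \<and>
     (\<forall>n X Y. definable M UNIV n X \<longrightarrow> definable M UNIV n Y \<longrightarrow>
        \<delta> (X \<inter> Y) \<le> min (\<delta> X) (\<delta> Y)) \<and>
     (\<forall>m n f X Y. definable_surjection M m n f X Y \<longrightarrow> X \<noteq> {} \<longrightarrow> Y \<noteq> {} \<longrightarrow>
        \<delta> Y + (INF y\<in>Y. \<delta> {x \<in> X. f x = y}) \<le> \<delta> X \<and>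
        \<delta> X \<le> \<delta> Y + (SUP y\<in>Y. \<delta> {x \<in> X. f x = y})) \<and>
     (\<forall>m n (\<phi> :: ('f, 'r, 'a) fm) (s :: real) (t :: real).
        \<phi> \<in> formulas (n + m) {} \<longrightarrow> 0 \<le> s \<longrightarrow> s < t \<longrightarrow>
        (\<exists>D. definable M {} m D \<and>
          {as. length as = m \<and> \<delta> (instance_set M n \<phi> as) \<le> ennreal s} \<subseteq> D \<and>
          D \<subseteq> {as. length as = m \<and> \<delta> (instance_set M n \<phi> as) < ennreal t}))"

text \<open>
  \<open>\<delta>(\<Gamma>) = inf {\<delta>(\<phi>) : \<Gamma> \<Turnstile> \<phi>}\<close>, as a function of the set
  \<open>S = realizations M n \<Gamma>\<close>; in a saturated model, for \<open>\<Gamma>\<close> over a small set,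
  \<open>\<Gamma> \<Turnstile> \<phi>\<close> means \<open>S \<subseteq> solutions M n \<phi>\<close>.
\<close>

definition type_dim ::
  "('a, 'f, 'r) struc \<Rightarrow> ('a list set \<Rightarrow> ennreal) \<Rightarrow> nat \<Rightarrow> 'a list set \<Rightarrow> ennreal" where
  "type_dim M \<delta> n S =
     (INF \<phi> \<in> {\<phi> \<in> formulas n UNIV. S \<subseteq> solutions M n \<phi>}. \<delta> (solutions M n \<phi>))"

definition generic_type ::
  "('a, 'f, 'r) struc \<Rightarrow> ('a list set \<Rightarrow> ennreal) \<Rightarrow> 'a set \<Rightarrow> nat \<Rightarrow>
   ('f, 'r, 'a) fm set \<Rightarrow> ('f, 'r, 'a) fm set \<Rightarrow> bool" where
  "generic_type M \<delta> A n \<Gamma> p \<longleftrightarrow>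
     complete_type M A n p \<and> \<Gamma> \<subseteq> p \<and>
     type_dim M \<delta> n (realizations M n p) = type_dim M \<delta> n (realizations M n \<Gamma>)"

section \<open>Fields\<close>

text \<open>The language contains symbols for the ring operations of the type class \<open>field\<close>.\<close>

definition expands_field :: "('a::field, 'f, 'r) struc \<Rightarrow> bool" where
  "expands_field F \<longleftrightarrow>
     (\<exists>f0 f1 fadd fneg fmul.
        funs F f0 [] = 0 \<and> funs F f1 [] = 1 \<and>
        (\<forall>x y. funs F fadd [x, y] = x + y) \<and>
        (\<forall>x. funs F fneg [x] = - x) \<and>
        (\<forall>x y. funs F fmul [x, y] = x * y))"

definition points :: "('a, 'f, 'r) struc \<Rightarrow> ('f, 'r, 'a) fm set \<Rightarrow> 'a set" where
  "points M \<Gamma> = {x. [x] \<in> realizations M 1 \<Gamma>}"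

definition tuples1 :: "'a set \<Rightarrow> 'a list set" where
  "tuples1 X = (\<lambda>x. [x]) ` X"

text \<open>
  Sum and product sets are \<open>X + Y\<close> and \<open>X * Y\<close> from \<open>Set_Algebras\<close>; the minus sign
  on sets is the set-theoretic difference.
\<close>

definition diff_set :: "'a::field set \<Rightarrow> 'a set \<Rightarrow> 'a set" where
  "diff_set X Y = {x - y | x y. x \<in> X \<and> y \<in> Y}"

definition quot_set :: "'a::field set \<Rightarrow> 'a set \<Rightarrow> 'a set" where
  "quot_set X Y = {x / y | x y. x \<in> X \<and> y \<in> Y - {0}}"

definition is_subfield :: "'a::field set \<Rightarrow> bool" where
  "is_subfield K \<longleftrightarrow>
     0 \<in> K \<and> 1 \<in> K \<and>
     (\<forall>x \<in> K. \<forall>y \<in> K. x + y \<in> K \<and> x * y \<in> K) \<and>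
     (\<forall>x \<in> K. - x \<in> K) \<and>
     (\<forall>x \<in> K. x \<noteq> 0 \<longrightarrow> inverse x \<in> K)"

end

theory Submission
  imports Defs
begin

text \<open>
  The dimension of a tuple over a small set of parameters is additive, hence a submodular rank
  function, and saturation provides realizations of full dimension over larger sets. Let \<open>P\<close> be
  the set of realizations of \<open>p\<close>, of dimension \<open>d\<close>, and let \<open>K\<close> be the set of all \<open>\<xi>\<close> such that
  \<open>x + \<xi> y\<close> has dimension at most \<open>d\<close> over \<open>\<xi>\<close> for independent \<open>x, y \<in> P\<close>. Submodularity
  (Ruzsa and Pluennecke inequalities for generic points) makes \<open>K\<close> a subfield. The product
  hypothesis gives for each \<open>a \<in> P\<close> a \<open>d\<close>-dimensional set of \<open>x \<in> P\<close> with \<open>x / a \<in> K\<close>; the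
  sum hypothesis then forces all of \<open>P\<close> into one class \<open>a K\<close>, so that
  \<open>(P - P) / (P - P) \<subseteq> K\<close>. Conversely, if \<open>\<xi>\<close> is not in the quotient set, then
  \<open>(x, y) \<mapsto> x + \<xi> y\<close> is injective on \<open>P \<times> P\<close> and takes values of dimension \<open>2 d\<close>. This
  dichotomy presents both \<open>K\<close> and its complement as type-definable sets, so \<open>K\<close> is definable.
\<close>

section \<open>Definable sets\<close>

text \<open>The argument counts with points because \<open>P\<close> is only type-definable, so the
  fibre axiom does not apply to it directly. That axiom bounds a dimension by extreme fibre
  dimensions. Continuity allows trimming a definable set around a given tuple until no fibre is much
  larger, or much smaller, than the one through that tuple, and this turns the two inequalities into
  an exact chain rule. The type \<open>p\<close> is complete over \<open>A\<close> but may have many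
  extensions over \<open>A\<close> and \<xi>, so independent pairs over \<xi> need not share a type;
  hence membership in \<open>K\<close> quantifies over all of them, and its independence of the base
  has to be proved. Finiteness of \<open>d\<close> lets it be cancelled in every count, while
  \<open>0 < d\<close> turns a fibre of rank \<open>d\<close> into a second point with the same
  value.\<close>

lemma tm_val_cong:
  "(\<And>i. i \<in> fv_tm t \<Longrightarrow> v i = w i) \<Longrightarrow> tm_val M v t = tm_val M w t"
proof (induction t)
  case (Fun f ts)
  have "map (tm_val M v) ts = map (tm_val M w) ts" by (intro map_cong) (use Fun in auto)
  then show ?case by (simp only: tm_val.simps)
qed auto

lemma sat_cong:
  "(\<And>i. i \<in> fv \<phi> \<Longrightarrow> v i = w i) \<Longrightarrow> sat M v \<phi> = sat M w \<phi>"
proof (induction \<phi> arbitrary: v w)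
  case (Eq t u)
  have "tm_val M v t = tm_val M w t" "tm_val M v u = tm_val M w u"
    using Eq by (auto intro!: tm_val_cong)
  then show ?case by simp
next
  case (Rel r ts)
  have "map (tm_val M v) ts = map (tm_val M w) ts"
    using Rel by (intro map_cong) (auto intro!: tm_val_cong)
  then show ?case by (simp only: sat.simps)
next
  case (Neg \<phi>)
  have "sat M v \<phi> = sat M w \<phi>" by (rule Neg.IH) (use Neg.prems in auto)
  then show ?case by simp
next
  case (Conj \<phi> \<psi>)
  have "sat M v \<phi> = sat M w \<phi>" by (rule Conj.IH(1)) (use Conj.prems in auto)
  moreover have "sat M v \<psi> = sat M w \<psi>" by (rule Conj.IH(2)) (use Conj.prems in auto)
  ultimately show ?case by simp
next
  case (Ex i \<phi>)
  have "sat M (v(i := a)) \<phi> = sat M (w(i := a)) \<phi>" for a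
    by (rule Ex.IH) (use Ex.prems in auto)
  then show ?case by simp
qed

lemma holds_eq_sat:
  assumes "\<phi> \<in> formulas n B" "length xs = n" "\<And>i. i < n \<Longrightarrow> v i = xs ! i"
  shows "holds M \<phi> xs \<longleftrightarrow> sat M v \<phi>"
  unfolding holds_def using assms by (intro sat_cong) (auto simp: formulas_def)

lemma definableI:
  assumes "\<phi> \<in> formulas n B" "\<And>xs. xs \<in> S \<Longrightarrow> length xs = n"
    "\<And>xs. length xs = n \<Longrightarrow> xs \<in> S \<longleftrightarrow> holds M \<phi> xs"
  shows "definable M B n S"
  unfolding definable_def solutions_def using assms by blast

lemma definableE:
  assumes "definable M B n S"
  obtains \<phi> where "\<phi> \<in> formulas n B" "S = solutions M n \<phi>"
  using assms unfolding definable_def by blast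

lemma definable_length: "definable M B n S \<Longrightarrow> xs \<in> S \<Longrightarrow> length xs = n"
  unfolding definable_def solutions_def by auto

lemma definable_mono: "definable M B n S \<Longrightarrow> B \<subseteq> C \<Longrightarrow> definable M C n S"
  unfolding definable_def formulas_def by blast

lemma finite_tm_params: "finite (tm_params t)"
  by (induction t) auto

lemma finite_params: "finite (params \<phi>)"
  by (induction \<phi>) (auto simp: finite_tm_params)

text \<open>A formula mentions finitely many parameters, which can therefore be listed and exchanged
  for variables.\<close>

lemma definable_finite_params:
  assumes "definable M B n S"
  obtains C where "C \<subseteq> B" "finite C" "definable M C n S"
proof -
  obtain \<phi> where \<phi>: "\<phi> \<in> formulas n B" "S = solutions M n \<phi>" using assms by (rule definableE)
  show ?thesis
  proof (rule that[of "params \<phi>"])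
    show "definable M (params \<phi>) n S"
      using \<phi> unfolding definable_def formulas_def by blast
  qed (use \<phi> in \<open>auto simp: formulas_def finite_params\<close>)
qed

section \<open>Boolean combinations of definable sets\<close>

lemma definable_Diff:
  assumes "definable M B n S"
  shows "definable M B n ({xs. length xs = n} - S)"
proof -
  obtain \<phi> where \<phi>: "\<phi> \<in> formulas n B" "S = solutions M n \<phi>" using assms by (rule definableE)
  show ?thesis
    by (rule definableI[of "Neg \<phi>"])
      (use \<phi> in \<open>auto simp: formulas_def solutions_def holds_def\<close>)
qed

lemma definable_Int:
  assumes "definable M B n S" "definable M B n T"
  shows "definable M B n (S \<inter> T)"
proof -
  obtain \<phi> \<psi> where "\<phi> \<in> formulas n B" "S = solutions M n \<phi>" "\<psi> \<in> formulas n B" "T = solutions M n \<psi>"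
    using assms by (auto elim!: definableE)
  then show ?thesis
    by (intro definableI[of "Conj \<phi> \<psi>"]) (auto simp: formulas_def solutions_def holds_def)
qed

lemma definable_Un:
  assumes "definable M B n S" "definable M B n T"
  shows "definable M B n (S \<union> T)"
proof -
  have "S \<union> T = {xs. length xs = n} - (({xs. length xs = n} - S) \<inter> ({xs. length xs = n} - T))"
    using assms by (auto dest: definable_length)
  then show ?thesis using assms by (simp only:) (intro definable_Diff definable_Int)
qed

lemma definable_empty: "definable M B n {}"
  by (rule definableI[of "Ex 0 (Neg (Eq (Var 0) (Var 0)))"]) (auto simp: formulas_def holds_def)

lemma definable_full: "definable M B n {xs. length xs = n}"
  using definable_Diff[OF definable_empty] by simp

lemma definable_Inter:
  assumes "finite \<S>" "\<And>S. S \<in> \<S> \<Longrightarrow> definable M B n S"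
  shows "definable M B n ({xs. length xs = n} \<inter> \<Inter> \<S>)"
  using assms
proof (induction rule: finite_induct)
  case empty
  then show ?case by (simp add: definable_full)
next
  case (insert S \<S>)
  have "{xs. length xs = n} \<inter> \<Inter> (insert S \<S>) = S \<inter> ({xs. length xs = n} \<inter> \<Inter> \<S>)" by blast
  moreover have "definable M B n (S \<inter> ({xs. length xs = n} \<inter> \<Inter> \<S>))"
    by (rule definable_Int) (use insert in auto)
  ultimately show ?case by simp
qed

lemma definable_Union:
  assumes "finite \<S>" "\<And>S. S \<in> \<S> \<Longrightarrow> definable M B n S"
  shows "definable M B n (\<Union> \<S>)"
  using assms by (induction rule: finite_induct) (auto intro: definable_empty definable_Un)

lemma definable_Eq:
  assumes "fv_tm t \<subseteq> {..<n}" "tm_params t \<subseteq> B" "fv_tm u \<subseteq> {..<n}" "tm_params u \<subseteq> B"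
  shows "definable M B n {xs. length xs = n \<and>
    tm_val M (\<lambda>i. if i < n then xs ! i else undefined) t =
    tm_val M (\<lambda>i. if i < n then xs ! i else undefined) u}"
  by (rule definableI[of "Eq t u"]) (use assms in \<open>auto simp: formulas_def holds_def\<close>)

lemma definable_singleton_param: "a \<in> B \<Longrightarrow> definable M B 1 {[a]}"
  by (rule definableI[of "Eq (Var 0) (Par a)"])
    (auto simp: formulas_def holds_def length_Suc_conv)

lemma definable_equalities:
  fixes k :: nat
  assumes "\<And>j. j < k \<Longrightarrow> f j < n \<and> g j < n"
  shows "definable M B n {xs. length xs = n \<and> (\<forall>j<k. xs ! f j = xs ! g j)}"
proof -
  have "definable M B n {xs. length xs = n \<and> xs ! f j = xs ! g j}" if "j < k" for j
    by (rule definableI[of "Eq (Var (f j)) (Var (g j))"])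
      (use assms[OF that] in \<open>auto simp: formulas_def holds_def\<close>)
  then have "definable M B n ({xs. length xs = n} \<inter>
      \<Inter> ((\<lambda>j. {xs. length xs = n \<and> xs ! f j = xs ! g j}) ` {..<k}))"
    by (intro definable_Inter) auto
  also have "{xs. length xs = n} \<inter> \<Inter> ((\<lambda>j. {xs. length xs = n \<and> xs ! f j = xs ! g j}) ` {..<k}) =
      {xs. length xs = n \<and> (\<forall>j<k. xs ! f j = xs ! g j)}" by auto
  finally show ?thesis .
qed

section \<open>Existential quantification as projection\<close>

lemma definable_Ex:
  assumes "definable M B (Suc n) S"
  shows "definable M B n {xs. \<exists>a. xs @ [a] \<in> S}"
proof -
  obtain \<phi> where \<phi>: "\<phi> \<in> formulas (Suc n) B" "S = solutions M (Suc n) \<phi>"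
    using assms by (rule definableE)
  show ?thesis
  proof (rule definableI[of "Ex n \<phi>"])
    show "Ex n \<phi> \<in> formulas n B" using \<phi>(1) by (auto simp: formulas_def lessThan_Suc)
    show "length xs = n" if "xs \<in> {xs. \<exists>a. xs @ [a] \<in> S}" for xs
      using that \<phi>(2) by (auto simp: solutions_def)
    show "xs \<in> {xs. \<exists>a. xs @ [a] \<in> S} \<longleftrightarrow> holds M (Ex n \<phi>) xs" if xs: "length xs = n" for xs
    proof -
      \<comment> \<open>Variable \<open>n\<close> is the first one that \<open>xs\<close> leaves
        unassigned, so updating it amounts to appending \<open>a\<close>.\<close>
      have "holds M \<phi> (xs @ [a]) \<longleftrightarrow>
          sat M ((\<lambda>i. if i < length xs then xs ! i else undefined)(n := a)) \<phi>" for a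
        by (rule holds_eq_sat[OF \<phi>(1)]) (use xs in \<open>auto simp: nth_append\<close>)
      then show ?thesis using xs \<phi>(2) by (simp add: solutions_def holds_def[of _ "Ex n \<phi>"])
    qed
  qed
qed

lemma definable_proj:
  assumes "definable M B (n + m) S"
  shows "definable M B n {xs. \<exists>ys. length ys = m \<and> xs @ ys \<in> S}"
  using assms
proof (induction m arbitrary: S)
  case 0
  then show ?case by simp
next
  case (Suc m)
  have "definable M B n {xs. \<exists>ys. length ys = m \<and> xs @ ys \<in> {xs. \<exists>a. xs @ [a] \<in> S}}"
    by (rule Suc.IH, rule definable_Ex) (use Suc.prems in simp)
  also have "{xs. \<exists>ys. length ys = m \<and> xs @ ys \<in> {xs. \<exists>a. xs @ [a] \<in> S}} =
      {xs. \<exists>ys. length ys = Suc m \<and> xs @ ys \<in> S}"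
  proof (intro set_eqI iffI)
    fix xs assume "xs \<in> {xs. \<exists>ys. length ys = m \<and> xs @ ys \<in> {xs. \<exists>a. xs @ [a] \<in> S}}"
    then obtain ys a where "length ys = m" "xs @ (ys @ [a]) \<in> S" by auto
    then show "xs \<in> {xs. \<exists>ys. length ys = Suc m \<and> xs @ ys \<in> S}"
      by (intro CollectI exI[of _ "ys @ [a]"]) simp
  next
    fix xs assume "xs \<in> {xs. \<exists>ys. length ys = Suc m \<and> xs @ ys \<in> S}"
    then obtain ys where ys: "length ys = Suc m" "xs @ ys \<in> S" by blast
    then have "ys = butlast ys @ [last ys]" by (intro append_butlast_last_id[symmetric]) auto
    then have "(xs @ butlast ys) @ [last ys] \<in> S" using ys(2) by simp
    then show "xs \<in> {xs. \<exists>ys. length ys = m \<and> xs @ ys \<in> {xs. \<exists>a. xs @ [a] \<in> S}}"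
      using ys(1) by (intro CollectI exI[of _ "butlast ys"]) auto
  qed
  finally show ?case .
qed

text \<open>
  Renaming all variables, bound ones included, by an injection avoids capture, so parameters can
  be turned into variables outside its range.
\<close>

primrec rename_tm :: "(nat \<Rightarrow> nat) \<Rightarrow> ('a \<Rightarrow> ('f, 'a) tm) \<Rightarrow> ('f, 'a) tm \<Rightarrow> ('f, 'a) tm" where
  "rename_tm \<rho> g (Var i) = Var (\<rho> i)"
| "rename_tm \<rho> g (Par a) = g a"
| "rename_tm \<rho> g (Fun f ts) = Fun f (map (rename_tm \<rho> g) ts)"

primrec rename :: "(nat \<Rightarrow> nat) \<Rightarrow> ('a \<Rightarrow> ('f, 'a) tm) \<Rightarrow> ('f, 'r, 'a) fm \<Rightarrow> ('f, 'r, 'a) fm" where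
  "rename \<rho> g (Eq t u) = Eq (rename_tm \<rho> g t) (rename_tm \<rho> g u)"
| "rename \<rho> g (Rel r ts) = Rel r (map (rename_tm \<rho> g) ts)"
| "rename \<rho> g (Neg \<phi>) = Neg (rename \<rho> g \<phi>)"
| "rename \<rho> g (Conj \<phi> \<psi>) = Conj (rename \<rho> g \<phi>) (rename \<rho> g \<psi>)"
| "rename \<rho> g (Ex i \<phi>) = Ex (\<rho> i) (rename \<rho> g \<phi>)"

lemma tm_val_rename:
  assumes "\<And>a. tm_val M v (g a) = a"
  shows "tm_val M v (rename_tm \<rho> g t) = tm_val M (\<lambda>i. v (\<rho> i)) t"
proof (induction t)
  case (Fun f ts)
  have "map (tm_val M v \<circ> rename_tm \<rho> g) ts = map (tm_val M (\<lambda>i. v (\<rho> i))) ts"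
    by (intro map_cong) (use Fun in auto)
  then show ?case by (simp only: rename_tm.simps tm_val.simps map_map)
qed (auto simp: assms)

lemma sat_rename:
  assumes "inj \<rho>" "\<And>a. fv_tm (g a) \<inter> range \<rho> = {}" "\<And>a. tm_val M v (g a) = a"
  shows "sat M v (rename \<rho> g \<phi>) \<longleftrightarrow> sat M (\<lambda>i. v (\<rho> i)) \<phi>"
  using assms(3)
proof (induction \<phi> arbitrary: v)
  case (Eq t u)
  then show ?case by (simp add: tm_val_rename)
next
  case (Rel r ts)
  have "map (tm_val M v \<circ> rename_tm \<rho> g) ts = map (tm_val M (\<lambda>i. v (\<rho> i))) ts"
    by (intro map_cong) (use Rel in \<open>auto simp: tm_val_rename\<close>)
  then show ?case by (simp only: rename.simps sat.simps map_map)
next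
  case (Neg \<phi>)
  show ?case using Neg.IH[OF Neg.prems] by simp
next
  case (Conj \<phi> \<psi>)
  show ?case using Conj.IH(1)[OF Conj.prems] Conj.IH(2)[OF Conj.prems] by simp
next
  case (Ex i \<phi>)
  have "sat M (v(\<rho> i := b)) (rename \<rho> g \<phi>) = sat M ((\<lambda>i. v (\<rho> i))(i := b)) \<phi>" for b
  proof -
    have "tm_val M (v(\<rho> i := b)) (g a) = a" for a
    proof -
      have "\<rho> i \<notin> fv_tm (g a)" using assms(2)[of a] by blast
      then have "tm_val M (v(\<rho> i := b)) (g a) = tm_val M v (g a)" by (intro tm_val_cong) auto
      then show ?thesis using Ex.prems by simp
    qed
    then have "sat M (v(\<rho> i := b)) (rename \<rho> g \<phi>) = sat M (\<lambda>j. (v(\<rho> i := b)) (\<rho> j)) \<phi>"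
      by (rule Ex.IH)
    also have "(\<lambda>j. (v(\<rho> i := b)) (\<rho> j)) = (\<lambda>i. v (\<rho> i))(i := b)"
      using assms(1) by (auto simp: fun_eq_iff inj_eq)
    finally show ?thesis .
  qed
  then show ?case by simp
qed

lemma fv_rename_tm: "fv_tm (rename_tm \<rho> g t) \<subseteq> \<rho> ` fv_tm t \<union> (\<Union>a\<in>tm_params t. fv_tm (g a))"
proof (induction t)
  case (Fun f ts)
  show ?case
  proof
    fix i assume "i \<in> fv_tm (rename_tm \<rho> g (Fun f ts))"
    then obtain t where t: "t \<in> set ts" "i \<in> fv_tm (rename_tm \<rho> g t)" by auto
    then have "i \<in> \<rho> ` fv_tm t \<union> (\<Union>a\<in>tm_params t. fv_tm (g a))" using Fun by blast
    then show "i \<in> \<rho> ` fv_tm (Fun f ts) \<union> (\<Union>a\<in>tm_params (Fun f ts). fv_tm (g a))"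
      using t(1) by auto
  qed
qed auto

lemma fv_rename:
  assumes "inj \<rho>"
  shows "fv (rename \<rho> g \<phi>) \<subseteq> \<rho> ` fv \<phi> \<union> (\<Union>a\<in>params \<phi>. fv_tm (g a))"
proof (induction \<phi>)
  case (Eq t u)
  then show ?case using fv_rename_tm[of \<rho> g t] fv_rename_tm[of \<rho> g u] by auto
next
  case (Rel r ts)
  show ?case
  proof
    fix i assume "i \<in> fv (rename \<rho> g (Rel r ts))"
    then obtain t where t: "t \<in> set ts" "i \<in> fv_tm (rename_tm \<rho> g t)" by auto
    then have "i \<in> \<rho> ` fv_tm t \<union> (\<Union>a\<in>tm_params t. fv_tm (g a))" using fv_rename_tm[of \<rho> g t] by blast
    then show "i \<in> \<rho> ` fv (Rel r ts) \<union> (\<Union>a\<in>params (Rel r ts). fv_tm (g a))"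
      using t(1) by auto
  qed
next
  case (Ex i \<phi>)
  have "\<rho> ` (fv \<phi> - {i}) = \<rho> ` fv \<phi> - {\<rho> i}" using image_set_diff[OF assms, of "fv \<phi>" "{i}"] by simp
  then show ?case using Ex by auto
qed auto

lemma params_rename_tm: "tm_params (rename_tm \<rho> g t) \<subseteq> (\<Union>a\<in>tm_params t. tm_params (g a))"
proof (induction t)
  case (Fun f ts)
  show ?case
  proof
    fix b assume "b \<in> tm_params (rename_tm \<rho> g (Fun f ts))"
    then obtain t where t: "t \<in> set ts" "b \<in> tm_params (rename_tm \<rho> g t)" by auto
    then have "b \<in> (\<Union>a\<in>tm_params t. tm_params (g a))" using Fun by blast
    then show "b \<in> (\<Union>a\<in>tm_params (Fun f ts). tm_params (g a))" using t(1) by auto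
  qed
qed auto

lemma params_rename: "params (rename \<rho> g \<phi>) \<subseteq> (\<Union>a\<in>params \<phi>. tm_params (g a))"
proof (induction \<phi>)
  case (Eq t u)
  then show ?case using params_rename_tm[of \<rho> g t] params_rename_tm[of \<rho> g u] by auto
next
  case (Rel r ts)
  show ?case
  proof
    fix b assume "b \<in> params (rename \<rho> g (Rel r ts))"
    then obtain t where t: "t \<in> set ts" "b \<in> tm_params (rename_tm \<rho> g t)" by auto
    then have "b \<in> (\<Union>a\<in>tm_params t. tm_params (g a))" using params_rename_tm[of \<rho> g t] by blast
    then show "b \<in> (\<Union>a\<in>params (Rel r ts). tm_params (g a))" using t(1) by auto
  qed
qed auto

section \<open>Changes of coordinates\<close>

lemma definable_shift:
  assumes "definable M B n S"
  shows "definable M B (m + n) {xs. length xs = m + n \<and> drop m xs \<in> S}"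
proof -
  obtain \<phi> where \<phi>: "\<phi> \<in> formulas n B" "S = solutions M n \<phi>" using assms by (rule definableE)
  have inj: "inj ((+) m)" by (simp add: inj_def)
  let ?\<psi> = "rename ((+) m) Par \<phi>"
  have "?\<psi> \<in> formulas (m + n) B"
  proof -
    have "fv ?\<psi> \<subseteq> (+) m ` {..<n}"
      using \<phi>(1) fv_rename[OF inj, of Par \<phi>] by (auto simp: formulas_def)
    moreover have "params ?\<psi> \<subseteq> B"
      using \<phi>(1) params_rename[of "(+) m" Par \<phi>] by (auto simp: formulas_def)
    ultimately show ?thesis by (auto simp: formulas_def)
  qed
  moreover have "drop m xs \<in> S \<longleftrightarrow> holds M ?\<psi> xs" if "length xs = m + n" for xs
  proof -
    have "holds M ?\<psi> xs \<longleftrightarrow> sat M (\<lambda>j. (\<lambda>i. if i < length xs then xs ! i else undefined) (m + j)) \<phi>"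
      unfolding holds_def by (rule sat_rename[OF inj]) auto
    also have "\<dots> \<longleftrightarrow> holds M \<phi> (drop m xs)"
      by (rule holds_eq_sat[OF \<phi>(1), symmetric]) (use that in auto)
    finally show ?thesis using that \<phi>(2) by (simp add: solutions_def)
  qed
  ultimately show ?thesis by (intro definableI[of ?\<psi>]) auto
qed

text \<open>Substitution along \<sigma> may identify variables, which an injective renaming cannot
  express. Instead the selected coordinates are copied into a fresh block by equations, and that
  block is projected away.\<close>

lemma definable_vimage_coords:
  assumes "definable M B (length \<sigma>) S" "set \<sigma> \<subseteq> {..<n}"
  shows "definable M B n {xs. length xs = n \<and> map ((!) xs) \<sigma> \<in> S}"
proof -
  let ?k = "length \<sigma>"
  let ?G = "{w. length w = n + ?k \<and> drop n w \<in> S} \<inter>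
    {w. length w = n + ?k \<and> (\<forall>j<?k. w ! (n + j) = w ! (\<sigma> ! j))}"
  have \<sigma>: "\<sigma> ! j < n" if "j < ?k" for j using nth_mem[OF that] assms(2) by auto
  have "definable M B (n + ?k) ?G"
    by (intro definable_Int definable_shift definable_equalities assms(1))
      (use \<sigma> in \<open>auto intro: trans_less_add1\<close>)
  then have "definable M B n {xs. \<exists>ys. length ys = ?k \<and> xs @ ys \<in> ?G}" by (rule definable_proj)
  also have "{xs. \<exists>ys. length ys = ?k \<and> xs @ ys \<in> ?G} = {xs. length xs = n \<and> map ((!) xs) \<sigma> \<in> S}"
  proof (intro set_eqI iffI)
    fix xs assume "xs \<in> {xs. \<exists>ys. length ys = ?k \<and> xs @ ys \<in> ?G}"
    then obtain ys where ys: "length ys = ?k" "length xs = n" "ys \<in> S"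
      "\<And>j. j < ?k \<Longrightarrow> (xs @ ys) ! (n + j) = (xs @ ys) ! (\<sigma> ! j)" by auto
    have "ys = map ((!) xs) \<sigma>"
      using ys \<sigma> by (intro nth_equalityI) (auto simp: nth_append)
    then show "xs \<in> {xs. length xs = n \<and> map ((!) xs) \<sigma> \<in> S}" using ys by simp
  next
    fix xs assume xs: "xs \<in> {xs. length xs = n \<and> map ((!) xs) \<sigma> \<in> S}"
    show "xs \<in> {xs. \<exists>ys. length ys = ?k \<and> xs @ ys \<in> ?G}"
      using xs \<sigma> by (auto intro!: exI[of _ "map ((!) xs) \<sigma>"] simp: nth_append)
  qed
  finally show ?thesis .
qed

lemma definable_image_coords:
  assumes "definable M B n S" "set \<sigma> \<subseteq> {..<n}"
  shows "definable M B (length \<sigma>) ((\<lambda>xs. map ((!) xs) \<sigma>) ` S)"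
proof -
  let ?k = "length \<sigma>"
  let ?G = "{w. length w = ?k + n \<and> drop ?k w \<in> S} \<inter>
    {w. length w = ?k + n \<and> (\<forall>j<?k. w ! j = w ! (?k + \<sigma> ! j))}"
  have \<sigma>: "\<sigma> ! j < n" if "j < ?k" for j using nth_mem[OF that] assms(2) by auto
  have "definable M B (?k + n) ?G"
    by (intro definable_Int definable_shift definable_equalities assms(1)) (use \<sigma> in auto)
  then have "definable M B ?k {xs. \<exists>ys. length ys = n \<and> xs @ ys \<in> ?G}" by (rule definable_proj)
  also have "{xs. \<exists>ys. length ys = n \<and> xs @ ys \<in> ?G} = (\<lambda>xs. map ((!) xs) \<sigma>) ` S"
  proof (intro set_eqI iffI)
    fix xs assume "xs \<in> {xs. \<exists>ys. length ys = n \<and> xs @ ys \<in> ?G}"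
    then obtain ys where ys: "length ys = n" "length xs = ?k" "ys \<in> S"
      "\<And>j. j < ?k \<Longrightarrow> (xs @ ys) ! j = (xs @ ys) ! (?k + \<sigma> ! j)" by auto
    then have "xs = map ((!) ys) \<sigma>"
      by (intro nth_equalityI) (auto simp: nth_append)
    then show "xs \<in> (\<lambda>xs. map ((!) xs) \<sigma>) ` S" using ys(3) by blast
  next
    fix xs assume "xs \<in> (\<lambda>xs. map ((!) xs) \<sigma>) ` S"
    then obtain ys where "ys \<in> S" "xs = map ((!) ys) \<sigma>" by blast
    moreover from this have "length ys = n" using assms(1) by (blast dest: definable_length)
    ultimately show "xs \<in> {xs. \<exists>ys. length ys = n \<and> xs @ ys \<in> ?G}"
      by (auto intro!: exI[of _ ys] simp: nth_append)
  qed
  finally show ?thesis .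
qed

lemma definable_take:
  fixes S :: "'a list set"
  assumes "definable M B n S"
  shows "definable M B (n + m) {xs. length xs = n + m \<and> take n xs \<in> S}"
proof -
  have "definable M B (n + m) {xs. length xs = n + m \<and> map ((!) xs) [0..<n] \<in> S}"
    by (rule definable_vimage_coords) (use assms in auto)
  also have "{xs. length xs = n + m \<and> map ((!) xs) [0..<n] \<in> S} =
      {xs. length xs = n + m \<and> take n xs \<in> S}"
  proof -
    have "map ((!) xs) [0..<n] = take n xs" if "length xs = n + m" for xs :: "'a list"
      using that by (intro nth_equalityI) auto
    then show ?thesis by auto
  qed
  finally show ?thesis .
qed

section \<open>Specializing trailing coordinates and freeing parameters\<close>

lemma definable_fiber1:
  assumes "definable M B (Suc n) S"
  shows "definable M (insert c B) n {xs. xs @ [c] \<in> S}"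
proof -
  have "definable M (insert c B) (Suc n) {w. length w = n + 1 \<and> drop n w \<in> {[c]}}"
    using definable_shift[OF definable_singleton_param, of c "insert c B" M n] by simp
  moreover have "definable M (insert c B) (Suc n) S" using assms by (rule definable_mono) auto
  ultimately have "definable M (insert c B) n
      {xs. \<exists>a. xs @ [a] \<in> {w. length w = n + 1 \<and> drop n w \<in> {[c]}} \<inter> S}"
    by (intro definable_Ex definable_Int)
  also have "{xs. \<exists>a. xs @ [a] \<in> {w. length w = n + 1 \<and> drop n w \<in> {[c]}} \<inter> S} = {xs. xs @ [c] \<in> S}"
    using assms by (auto dest: definable_length)
  finally show ?thesis .
qed

lemma definable_fiber:
  assumes "definable M B (n + length cs) S"
  shows "definable M (B \<union> set cs) n {xs. xs @ cs \<in> S}"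
  using assms
proof (induction cs arbitrary: n B S)
  case (Cons c cs)
  have "definable M (B \<union> set cs) (Suc n) {xs. xs @ cs \<in> S}"
    by (rule Cons.IH) (use Cons.prems in simp)
  then have "definable M (insert c (B \<union> set cs)) n {xs. xs @ [c] \<in> {xs. xs @ cs \<in> S}}"
    by (rule definable_fiber1)
  then show ?case by simp
qed simp

text \<open>Converse to taking a fibre: the parameters \<open>cs\<close> become trailing variables.
  For empty \<open>B\<close> this gives the parameter-free form that the continuity axiom
  requires.\<close>

lemma definable_abstract:
  fixes M :: "('a, 'f, 'r) struc"
  assumes "definable M (B \<union> set cs) n R"
  obtains S where "definable M B (n + length cs) S" "R = {xs. xs @ cs \<in> S}"
proof -
  obtain \<phi> where \<phi>: "\<phi> \<in> formulas n (B \<union> set cs)" "R = solutions M n \<phi>"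
    using assms by (rule definableE)
  define k where "k = length cs"
  \<comment> \<open>The block from \<open>n\<close> to \<open>n + k - 1\<close> is reserved for
    \<open>cs\<close>, so every variable from \<open>n\<close> on, which can only occur bound, moves
    past it.\<close>
  define \<rho> where "\<rho> i = (if i < n then i else i + k)" for i
  \<comment> \<open>An entry may be repeated in \<open>cs\<close>; any one of its positions will
    do.\<close>
  define pos where "pos a = (SOME j. j < k \<and> cs ! j = a)" for a
  define g :: "'a \<Rightarrow> ('f, 'a) tm" where "g a = (if a \<in> set cs then Var (n + pos a) else Par a)" for a
  have pos: "pos a < k \<and> cs ! pos a = a" if "a \<in> set cs" for a
  proof -
    have "\<exists>j. j < k \<and> cs ! j = a" using that by (auto simp: k_def in_set_conv_nth)
    then show ?thesis unfolding pos_def by (rule someI_ex)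
  qed
  have inj: "inj \<rho>" by (auto simp: inj_def \<rho>_def)
  have g_range: "fv_tm (g a) \<inter> range \<rho> = {}" for a
    using pos[of a] by (auto simp: g_def \<rho>_def)
  let ?\<psi> = "rename \<rho> g \<phi>"
  have \<psi>: "?\<psi> \<in> formulas (n + k) B"
  proof -
    have "\<rho> ` fv \<phi> \<subseteq> {..<n + k}" using \<phi>(1) by (force simp: formulas_def \<rho>_def)
    moreover have "fv_tm (g a) \<subseteq> {..<n + k}" for a using pos[of a] by (auto simp: g_def)
    then have "(\<Union>a\<in>params \<phi>. fv_tm (g a)) \<subseteq> {..<n + k}" by (rule UN_least)
    ultimately have "fv ?\<psi> \<subseteq> {..<n + k}"
      by (intro order_trans[OF fv_rename[OF inj]] Un_least)
    moreover have "tm_params (g a) \<subseteq> B" if "a \<in> params \<phi>" for a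
      using \<phi>(1) that by (auto simp: g_def formulas_def)
    then have "(\<Union>a\<in>params \<phi>. tm_params (g a)) \<subseteq> B" by (rule UN_least)
    then have "params ?\<psi> \<subseteq> B" by (rule order_trans[OF params_rename])
    ultimately show ?thesis by (simp add: formulas_def)
  qed
  have "xs \<in> R \<longleftrightarrow> xs @ cs \<in> solutions M (n + k) ?\<psi>" for xs
  proof (cases "length xs = n")
    case True
    let ?v = "\<lambda>i. if i < length (xs @ cs) then (xs @ cs) ! i else undefined"
    have "holds M ?\<psi> (xs @ cs) \<longleftrightarrow> sat M (\<lambda>j. ?v (\<rho> j)) \<phi>"
      unfolding holds_def
    proof (rule sat_rename[OF inj g_range])
      show "tm_val M ?v (g a) = a" for a
        using pos[of a] True by (auto simp: g_def k_def nth_append)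
    qed
    also have "\<dots> \<longleftrightarrow> holds M \<phi> xs"
      by (rule holds_eq_sat[OF \<phi>(1), symmetric]) (use True in \<open>auto simp: \<rho>_def nth_append\<close>)
    finally show ?thesis using True \<phi>(2) by (simp add: solutions_def k_def)
  next
    case False
    then show ?thesis using \<phi>(2) by (simp add: solutions_def k_def)
  qed
  then have "R = {xs. xs @ cs \<in> solutions M (n + k) ?\<psi>}" by blast
  moreover have "definable M B (n + length cs) (solutions M (n + k) ?\<psi>)"
    using \<psi> unfolding definable_def k_def by blast
  ultimately show ?thesis using that by blast
qed

lemma definable_singleton: "set cs \<subseteq> B \<Longrightarrow> definable M B (length cs) {cs}"
proof (induction cs)
  case Nil
  have "{[]} = {xs. length xs = 0}" by auto
  then show ?case using definable_full[of M B 0] by simp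
next
  case (Cons c cs)
  have "definable M B (1 + length cs) ({xs. length xs = 1 + length cs \<and> take 1 xs \<in> {[c]}} \<inter>
      {xs. length xs = 1 + length cs \<and> drop 1 xs \<in> {cs}})"
    using Cons by (intro definable_Int definable_take definable_shift definable_singleton_param) auto
  also have "{xs. length xs = 1 + length cs \<and> take 1 xs \<in> {[c]}} \<inter>
      {xs. length xs = 1 + length cs \<and> drop 1 xs \<in> {cs}} = {c # cs}"
  proof (intro set_eqI iffI)
    fix xs assume "xs \<in> {xs. length xs = 1 + length cs \<and> take 1 xs \<in> {[c]}} \<inter>
      {xs. length xs = 1 + length cs \<and> drop 1 xs \<in> {cs}}"
    then have "take 1 xs @ drop 1 xs = [c] @ cs" by simp
    then show "xs \<in> {c # cs}" by simp
  qed auto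
  finally show ?case by simp
qed

lemma definable_surjection_coords:
  assumes "definable M UNIV n S" "set \<sigma> \<subseteq> {..<n}"
  shows "definable_surjection M n (length \<sigma>) (\<lambda>xs. map ((!) xs) \<sigma>) S ((\<lambda>xs. map ((!) xs) \<sigma>) ` S)"
proof -
  let ?k = "length \<sigma>"
  have \<sigma>: "\<sigma> ! j < n" if "j < ?k" for j using nth_mem[OF that] assms(2) by auto
  let ?G = "{w. length w = n + ?k \<and> take n w \<in> S} \<inter>
    {w. length w = n + ?k \<and> (\<forall>j<?k. w ! (n + j) = w ! (\<sigma> ! j))}"
  have "definable M UNIV (n + ?k) ?G"
    by (intro definable_Int definable_take definable_equalities assms(1)) (use \<sigma> in \<open>auto intro: trans_less_add1\<close>)
  also have "?G = {xs @ map ((!) xs) \<sigma> | xs. xs \<in> S}"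
  proof (intro set_eqI iffI)
    fix w assume w: "w \<in> ?G"
    have "drop n w = map ((!) (take n w)) \<sigma>"
      by (rule nth_equalityI) (use w \<sigma> in auto)
    then have "w = take n w @ map ((!) (take n w)) \<sigma>" by (metis append_take_drop_id)
    then show "w \<in> {xs @ map ((!) xs) \<sigma> | xs. xs \<in> S}" using w by blast
  next
    fix w assume "w \<in> {xs @ map ((!) xs) \<sigma> | xs. xs \<in> S}"
    then obtain xs where "w = xs @ map ((!) xs) \<sigma>" "xs \<in> S" by blast
    moreover from this have "length xs = n" using assms(1) by (blast dest: definable_length)
    ultimately show "w \<in> ?G" using \<sigma> by (auto simp: nth_append)
  qed
  finally show ?thesis
    unfolding definable_surjection_def using assms definable_image_coords by blast
qed

section \<open>Dimension over a set of parameters\<close>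

lemma image_coords_snd:
  assumes S: "definable M B (n + m) S"
  shows "(\<lambda>xs. map ((!) xs) [n..<n + m]) ` S = {ys. \<exists>xs. length xs = n \<and> xs @ ys \<in> S}"
proof -
  have "(\<lambda>xs. map ((!) xs) [n..<n + m]) ` S = drop n ` S"
    by (rule image_cong) (auto intro!: nth_equalityI simp: definable_length[OF S])
  also have "\<dots> = {ys. \<exists>xs. length xs = n \<and> xs @ ys \<in> S}"
  proof (intro set_eqI iffI)
    fix ys assume "ys \<in> drop n ` S"
    then obtain zs where zs: "zs \<in> S" "ys = drop n zs" by blast
    then have "take n zs @ ys \<in> S" "length (take n zs) = n" using definable_length[OF S zs(1)] by auto
    then show "ys \<in> {ys. \<exists>xs. length xs = n \<and> xs @ ys \<in> S}" by blast
  next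
    fix ys assume "ys \<in> {ys. \<exists>xs. length xs = n \<and> xs @ ys \<in> S}"
    then obtain xs where "length xs = n" "xs @ ys \<in> S" by blast
    then show "ys \<in> drop n ` S" by (intro image_eqI[of _ _ "xs @ ys"]) auto
  qed
  finally show ?thesis .
qed

lemma definable_proj_snd:
  assumes "definable M B (n + m) S"
  shows "definable M B m {ys. \<exists>xs. length xs = n \<and> xs @ ys \<in> S}"
proof -
  have "definable M B (length [n..<n + m]) ((\<lambda>xs. map ((!) xs) [n..<n + m]) ` S)"
    by (rule definable_image_coords[OF assms]) auto
  then show ?thesis unfolding image_coords_snd[OF assms] by simp
qed

section \<open>Consequences of the axioms of a dimension\<close>

locale dimension =
  fixes M :: "('a, 'f, 'r) struc" and \<delta> :: "'a list set \<Rightarrow> ennreal"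
  assumes dim: "is_dimension M \<delta>"
begin

lemma dim_Un: "definable M UNIV n X \<Longrightarrow> definable M UNIV n Y \<Longrightarrow> \<delta> (X \<union> Y) = max (\<delta> X) (\<delta> Y)"
  by (rule dim[unfolded is_dimension_def, THEN conjunct1, rule_format])

lemma dim_cart: "definable M UNIV m X \<Longrightarrow> definable M UNIV n Y \<Longrightarrow> X \<noteq> {} \<Longrightarrow> Y \<noteq> {} \<Longrightarrow>
    \<delta> (cart X Y) = \<delta> X + \<delta> Y"
  by (rule dim[unfolded is_dimension_def, THEN conjunct2, THEN conjunct1, rule_format])

lemma dim_finite: "definable M UNIV n X \<Longrightarrow> finite X \<Longrightarrow> \<delta> X = 0"
  by (rule dim[unfolded is_dimension_def, THEN conjunct2, THEN conjunct2, THEN conjunct1, rule_format])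

lemma dim_surj:
  assumes "definable_surjection M m n f X Y" "X \<noteq> {}" "Y \<noteq> {}"
  shows "\<delta> Y + (INF y\<in>Y. \<delta> {x \<in> X. f x = y}) \<le> \<delta> X"
    "\<delta> X \<le> \<delta> Y + (SUP y\<in>Y. \<delta> {x \<in> X. f x = y})"
proof -
  note surj = dim[unfolded is_dimension_def, THEN conjunct2, THEN conjunct2, THEN conjunct2,
      THEN conjunct2, THEN conjunct1, rule_format, OF assms]
  show "\<delta> Y + (INF y\<in>Y. \<delta> {x \<in> X. f x = y}) \<le> \<delta> X" using surj by (rule conjunct1)
  show "\<delta> X \<le> \<delta> Y + (SUP y\<in>Y. \<delta> {x \<in> X. f x = y})" using surj by (rule conjunct2)
qed

lemma dim_continuous:
  fixes s t :: real
  assumes "\<phi> \<in> formulas (n + m) {}" "0 \<le> s" "s < t"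
  shows "\<exists>D. definable M {} m D \<and>
    {as. length as = m \<and> \<delta> (instance_set M n \<phi> as) \<le> ennreal s} \<subseteq> D \<and>
    D \<subseteq> {as. length as = m \<and> \<delta> (instance_set M n \<phi> as) < ennreal t}"
  by (rule dim[unfolded is_dimension_def, THEN conjunct2, THEN conjunct2, THEN conjunct2,
      THEN conjunct2, THEN conjunct2, rule_format, OF assms])

lemma dim_mono:
  assumes "definable M UNIV n X" "definable M UNIV n Y" "X \<subseteq> Y"
  shows "\<delta> X \<le> \<delta> Y"
  using dim_Un[OF assms(1,2)] assms(3) by (simp add: Un_absorb1 max_def split: if_splits)

lemma dim_empty: "\<delta> {} = 0"
  by (rule dim_finite[OF definable_empty]) simp

text \<open>Sets of dimension below \<open>u\<close> form an ideal, where \<open>0 < u\<close>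
  accounts for the empty union. The saturation arguments below avoid such ideals, finitely many
  members at a time.\<close>

lemma dim_Union_less:
  assumes "finite \<R>" "0 < u" "\<And>R. R \<in> \<R> \<Longrightarrow> definable M UNIV n R \<and> \<delta> R < u"
  shows "\<delta> (\<Union>\<R>) < u"
  using assms(1,3)
proof (induction rule: finite_induct)
  case (insert R \<R>)
  have "definable M UNIV n (\<Union>\<R>)" using insert by (intro definable_Union) auto
  then have "\<delta> (R \<union> \<Union>\<R>) = max (\<delta> R) (\<delta> (\<Union>\<R>))" using insert by (intro dim_Un) auto
  then show ?case using insert by simp
qed (simp add: dim_empty assms(2))

lemma dim_coords_le:
  assumes "definable M UNIV n S" "set \<sigma> \<subseteq> {..<n}"
  shows "\<delta> ((\<lambda>xs. map ((!) xs) \<sigma>) ` S) \<le> \<delta> S"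
proof (cases "S = {}")
  case False
  then have "\<delta> ((\<lambda>xs. map ((!) xs) \<sigma>) ` S) +
      (INF y\<in>(\<lambda>xs. map ((!) xs) \<sigma>) ` S. \<delta> {x \<in> S. map ((!) x) \<sigma> = y}) \<le> \<delta> S"
    by (intro dim_surj(1)[OF definable_surjection_coords[OF assms]]) auto
  then show ?thesis by (rule order_trans[rotated]) simp
qed (simp add: dim_empty)

text \<open>Forgetting the first block is a definable surjection whose fibre at \<open>y\<close> is
  the product of the section with \<open>{y}\<close>. A singleton has dimension zero, so the product
  axiom replaces the fibre by the section.\<close>

lemma dim_fibers:
  assumes S: "definable M UNIV (n + m) S" and "S \<noteq> {}"
  defines "Y \<equiv> {ys. \<exists>xs. length xs = n \<and> xs @ ys \<in> S}"
  shows "\<delta> Y + (INF y\<in>Y. \<delta> {xs. xs @ y \<in> S}) \<le> \<delta> S"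
    "\<delta> S \<le> \<delta> Y + (SUP y\<in>Y. \<delta> {xs. xs @ y \<in> S})"
proof -
  let ?f = "\<lambda>xs. map ((!) xs) [n..<n + m]"
  have f: "?f xs = drop n xs" if "xs \<in> S" for xs
    using definable_length[OF S that] by (intro nth_equalityI) auto
  have Y: "Y = ?f ` S" unfolding Y_def by (rule image_coords_snd[OF S, symmetric])
  have surj: "definable_surjection M (n + m) m ?f S Y"
  proof -
    have "set [n..<n + m] \<subseteq> {..<n + m}" by auto
    from definable_surjection_coords[OF S this] show ?thesis unfolding Y by simp
  qed
  have fib: "\<delta> {x \<in> S. ?f x = y} = \<delta> {xs. xs @ y \<in> S}" if "y \<in> Y" for y
  proof -
    have len: "length y = m" using that definable_length[OF S] unfolding Y_def by force
    have "{x \<in> S. ?f x = y} = cart {xs. xs @ y \<in> S} {y}"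
    proof (intro set_eqI iffI)
      fix z assume z: "z \<in> {x \<in> S. ?f x = y}"
      then have "z = take n z @ y" using f by (metis (mono_tags, lifting) append_take_drop_id mem_Collect_eq)
      then show "z \<in> cart {xs. xs @ y \<in> S} {y}" using z unfolding cart_def by auto
    next
      fix z assume "z \<in> cart {xs. xs @ y \<in> S} {y}"
      then obtain xs where xs: "z = xs @ y" "xs @ y \<in> S" unfolding cart_def by auto
      then have "length xs = n" using definable_length[OF S xs(2)] len by simp
      then show "z \<in> {x \<in> S. ?f x = y}" using xs f by simp
    qed
    moreover have "definable M UNIV n {xs. xs @ y \<in> S}"
      using definable_fiber[of M UNIV n y S] S len by simp
    moreover have "definable M UNIV m {y}" using definable_singleton[of y UNIV M] len by simp
    moreover have "{xs. xs @ y \<in> S} \<noteq> {}" using that unfolding Y_def by blast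
    ultimately have "\<delta> {x \<in> S. ?f x = y} = \<delta> {xs. xs @ y \<in> S} + \<delta> {y}"
      using dim_cart by simp
    also have "\<delta> {y} = 0" using \<open>definable M UNIV m {y}\<close> by (rule dim_finite) simp
    finally show ?thesis by simp
  qed
  have "Y \<noteq> {}" using assms(2) unfolding Y by simp
  note surj' = dim_surj[OF surj \<open>S \<noteq> {}\<close> this]
  have "(INF y\<in>Y. \<delta> {x \<in> S. ?f x = y}) = (INF y\<in>Y. \<delta> {xs. xs @ y \<in> S})"
    "(SUP y\<in>Y. \<delta> {x \<in> S. ?f x = y}) = (SUP y\<in>Y. \<delta> {xs. xs @ y \<in> S})"
    using fib by (auto intro!: INF_cong SUP_cong)
  then show "\<delta> Y + (INF y\<in>Y. \<delta> {xs. xs @ y \<in> S}) \<le> \<delta> S"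
    "\<delta> S \<le> \<delta> Y + (SUP y\<in>Y. \<delta> {xs. xs @ y \<in> S})"
    using surj' by simp_all
qed

text \<open>The axiom speaks of parameter-free formulas, so the parameters of \<open>S\<close> join
  the trailing variables; the separating set obtained there is specialized back at
  \<open>cs\<close>.\<close>

lemma dim_continuous_params:
  fixes s t :: real
  assumes S: "definable M B (n + m) S" and st: "0 \<le> s" "s < t"
  obtains D where "definable M B m D"
    "\<And>ys. length ys = m \<Longrightarrow> \<delta> {xs. xs @ ys \<in> S} \<le> ennreal s \<Longrightarrow> ys \<in> D"
    "\<And>ys. ys \<in> D \<Longrightarrow> \<delta> {xs. xs @ ys \<in> S} < ennreal t"
proof -
  obtain C where C: "C \<subseteq> B" "finite C" "definable M C (n + m) S"
    using S by (rule definable_finite_params)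
  obtain cs where cs: "set cs = C" using finite_list[OF C(2)] by blast
  have "definable M ({} \<union> set cs) (n + m) S" using C(3) cs by simp
  then obtain S0 where S0: "definable M {} (n + m + length cs) S0" "S = {xs. xs @ cs \<in> S0}"
    by (rule definable_abstract)
  obtain \<phi> where \<phi>: "\<phi> \<in> formulas (n + m + length cs) {}" "S0 = solutions M (n + m + length cs) \<phi>"
    using S0(1) by (rule definableE)
  have inst: "instance_set M n \<phi> (ys @ cs) = {xs. xs @ ys \<in> S}" if "length ys = m" for ys
    using that by (auto simp: instance_set_def S0(2) \<phi>(2) solutions_def)
  obtain D where D: "definable M {} (m + length cs) D"
    "{as. length as = m + length cs \<and> \<delta> (instance_set M n \<phi> as) \<le> ennreal s} \<subseteq> D"
    "D \<subseteq> {as. length as = m + length cs \<and> \<delta> (instance_set M n \<phi> as) < ennreal t}"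
    using dim_continuous[of \<phi> n "m + length cs" s t] \<phi>(1) st by (auto simp: add.assoc)
  show ?thesis
  proof (rule that[of "{ys. ys @ cs \<in> D}"])
    have "definable M ({} \<union> set cs) m {ys. ys @ cs \<in> D}" by (rule definable_fiber[OF D(1)])
    then show "definable M B m {ys. ys @ cs \<in> D}" using cs C(1) by (auto intro: definable_mono)
  next
    fix ys assume "length ys = m" "\<delta> {xs. xs @ ys \<in> S} \<le> ennreal s"
    then show "ys \<in> {ys. ys @ cs \<in> D}" using D(2) inst[of ys] by auto
  next
    fix ys assume "ys \<in> {ys. ys @ cs \<in> D}"
    then have "ys @ cs \<in> D" by simp
    then have "length (ys @ cs) = m + length cs" "\<delta> (instance_set M n \<phi> (ys @ cs)) < ennreal t"
      using D(3) by blast+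
    then show "\<delta> {xs. xs @ ys \<in> S} < ennreal t" using inst[of ys] by simp
  qed
qed

text \<open>This is the dimension of the type of \<open>xs\<close> over \<open>B\<close>. Only
  \<open>B\<close>-definable sets compete, in contrast to \<open>type_dim\<close>, which admits all
  parameters.\<close>

definition dm :: "'a set \<Rightarrow> 'a list \<Rightarrow> ennreal" where
  "dm B xs = (INF S\<in>{S. definable M B (length xs) S \<and> xs \<in> S}. \<delta> S)"

lemma dm_le: "definable M B (length xs) S \<Longrightarrow> xs \<in> S \<Longrightarrow> dm B xs \<le> \<delta> S"
  unfolding dm_def by (intro INF_lower) simp

lemma dm_lessE:
  assumes "dm B xs < t"
  obtains S where "definable M B (length xs) S" "xs \<in> S" "\<delta> S < t"
  using assms unfolding dm_def INF_less_iff by blast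

lemma dm_geI:
  "(\<And>S. definable M B (length xs) S \<Longrightarrow> xs \<in> S \<Longrightarrow> t \<le> \<delta> S) \<Longrightarrow> t \<le> dm B xs"
  unfolding dm_def by (intro INF_greatest) blast

lemma dm_antimono: "B \<subseteq> C \<Longrightarrow> dm C xs \<le> dm B xs"
  by (rule dm_geI, rule dm_le) (auto intro: definable_mono)

text \<open>Upper semicontinuity: a bound on one fibre spreads to all fibres of a
  \<open>B\<close>-definable set around the tuple. It serves for upper bounds, for type invariance
  and for the closedness of rank conditions.\<close>

lemma dm_open:
  assumes "dm (B \<union> set ys) xs < t"
  obtains S where "definable M B (length xs + length ys) S" "xs @ ys \<in> S"
    "\<And>xs' ys'. length xs' = length xs \<Longrightarrow> xs' @ ys' \<in> S \<Longrightarrow> \<delta> {zs. zs @ ys' \<in> S} < t"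
proof -
  obtain R where R: "definable M (B \<union> set ys) (length xs) R" "xs \<in> R" "\<delta> R < t"
    using assms by (rule dm_lessE)
  obtain S where S: "definable M B (length xs + length ys) S" "R = {zs. zs @ ys \<in> S}"
    using R(1) by (rule definable_abstract)
  obtain r where r: "0 \<le> r" "\<delta> R = ennreal r" using R(3) by (cases "\<delta> R") auto
  \<comment> \<open>Continuity needs two distinct real thresholds, so a real \<open>u\<close> is
    placed strictly above \<open>r\<close> and not above \<open>t\<close>; \<open>t\<close> itself
    may be infinite.\<close>
  obtain u where u: "r < u" "ennreal u \<le> t"
  proof (cases t)
    case (real t')
    then show ?thesis using R(3) r that[of t'] by (simp add: ennreal_less_iff)
  next
    case top
    then show ?thesis using that[of "r + 1"] by simp
  qed
  obtain D where D: "definable M B (length ys) D"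
    "\<And>ys'. length ys' = length ys \<Longrightarrow> \<delta> {zs. zs @ ys' \<in> S} \<le> ennreal r \<Longrightarrow> ys' \<in> D"
    "\<And>ys'. ys' \<in> D \<Longrightarrow> \<delta> {zs. zs @ ys' \<in> S} < ennreal u"
    using dim_continuous_params[OF S(1) r(1) u(1)] by metis
  let ?S = "S \<inter> {zs. length zs = length xs + length ys \<and> drop (length xs) zs \<in> D}"
  have S': "definable M B (length xs + length ys) ?S"
    by (intro definable_Int S(1) definable_shift D(1))
  show ?thesis
  proof (rule that[OF S'])
    show "xs @ ys \<in> ?S" using R(2) r(2) S(2) D(2)[of ys] by simp
    fix xs' ys' :: "'a list" assume *: "length xs' = length xs" "xs' @ ys' \<in> ?S"
    then have "ys' \<in> D" "length ys' = length ys" by auto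
    have fib: "definable M UNIV (length xs) {zs. zs @ ys' \<in> T}"
      if "definable M B (length xs + length ys) T" for T
      using definable_fiber[of M B "length xs" ys' T] that \<open>length ys' = length ys\<close>
      by (auto intro: definable_mono)
    have "\<delta> {zs. zs @ ys' \<in> ?S} \<le> \<delta> {zs. zs @ ys' \<in> S}"
      by (rule dim_mono[OF fib[OF S'] fib[OF S(1)]]) auto
    also have "\<dots> < ennreal u" using D(3) \<open>ys' \<in> D\<close> by blast
    finally show "\<delta> {zs. zs @ ys' \<in> ?S} < t" using u(2) by simp
  qed
qed

text \<open>Near-optimal definable sets around \<open>ys\<close> and around the fibre through
  \<open>xs\<close> are intersected; the upper fibre inequality then costs half of \<open>e\<close>
  in each summand.\<close>

lemma dm_append_le: "dm B (xs @ ys) \<le> dm B ys + dm (B \<union> set ys) xs"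
proof (rule ennreal_le_epsilon)
  fix e :: real assume fin: "dm B ys + dm (B \<union> set ys) xs < top" and e: "0 < e"
  have "dm B ys < dm B ys + ennreal (e / 2)"
    using fin e by (cases "dm B ys") (auto simp flip: ennreal_plus simp: ennreal_less_iff)
  then obtain R where R: "definable M B (length ys) R" "ys \<in> R" "\<delta> R < dm B ys + ennreal (e / 2)"
    by (rule dm_lessE)
  have "dm (B \<union> set ys) xs < dm (B \<union> set ys) xs + ennreal (e / 2)"
    using fin e by (cases "dm (B \<union> set ys) xs") (auto simp flip: ennreal_plus simp: ennreal_less_iff)
  then obtain S where S: "definable M B (length xs + length ys) S" "xs @ ys \<in> S"
    "\<And>xs' ys'. length xs' = length xs \<Longrightarrow> xs' @ ys' \<in> S \<Longrightarrow>
      \<delta> {zs. zs @ ys' \<in> S} < dm (B \<union> set ys) xs + ennreal (e / 2)"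
    by (rule dm_open) blast
  let ?S = "S \<inter> {zs. length zs = length xs + length ys \<and> drop (length xs) zs \<in> R}"
  let ?Y = "{ys'. \<exists>xs'. length xs' = length xs \<and> xs' @ ys' \<in> ?S}"
  have S': "definable M B (length xs + length ys) ?S" by (intro definable_Int S(1) definable_shift R(1))
  then have "definable M UNIV (length xs + length ys) ?S" by (rule definable_mono) simp
  moreover have mem: "xs @ ys \<in> ?S" using S(2) R(2) by simp
  ultimately have "\<delta> ?S \<le> \<delta> ?Y + (SUP y\<in>?Y. \<delta> {zs. zs @ y \<in> ?S})"
    by (intro dim_fibers(2)) auto
  also have "\<dots> \<le> (dm B ys + ennreal (e / 2)) + (dm (B \<union> set ys) xs + ennreal (e / 2))"
  proof (intro add_mono SUP_least)
    have "?Y \<subseteq> R" by auto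
    then have "\<delta> ?Y \<le> \<delta> R"
      using R(1) definable_proj_snd[OF S'] by (intro dim_mono) (auto intro: definable_mono)
    then show "\<delta> ?Y \<le> dm B ys + ennreal (e / 2)" using R(3) by simp
    fix y assume "y \<in> ?Y"
    then obtain xs' where xs': "length xs' = length xs" "xs' @ y \<in> ?S" by blast
    then have "length y = length ys" by auto
    then have fib: "definable M UNIV (length xs) {zs. zs @ y \<in> T}"
      if "definable M B (length xs + length ys) T" for T
      using definable_fiber[of M B "length xs" y T] that by (auto intro: definable_mono)
    have "\<delta> {zs. zs @ y \<in> ?S} \<le> \<delta> {zs. zs @ y \<in> S}"
      by (rule dim_mono[OF fib[OF S'] fib[OF S(1)]]) auto
    also have "\<dots> < dm (B \<union> set ys) xs + ennreal (e / 2)" using S(3) xs' by blast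
    finally show "\<delta> {zs. zs @ y \<in> ?S} \<le> dm (B \<union> set ys) xs + ennreal (e / 2)" by simp
  qed
  also have "\<dots> = dm B ys + dm (B \<union> set ys) xs + (ennreal (e / 2) + ennreal (e / 2))"
    by (simp add: ac_simps)
  also have "ennreal (e / 2) + ennreal (e / 2) = ennreal e" using e by (simp flip: ennreal_plus)
  finally have "\<delta> ?S \<le> dm B ys + dm (B \<union> set ys) xs + ennreal e" .
  moreover have "dm B (xs @ ys) \<le> \<delta> ?S" using S' mem by (intro dm_le) auto
  ultimately show "dm B (xs @ ys) \<le> dm B ys + dm (B \<union> set ys) xs + ennreal e" by (rule order_trans[rotated])
qed

text \<open>The lower fibre inequality sees only the smallest fibre, which may be far below the one
  through \<open>xs\<close>. For every \<open>v\<close> below the target, continuity supplies a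
  definable set of base points that includes all those with fibre dimension at most
  \<open>v\<close>; removing it leaves \<open>xs @ ys\<close> in place.\<close>

lemma dm_append_ge: "dm B ys + dm (B \<union> set ys) xs \<le> dm B (xs @ ys)"
proof (rule dm_geI)
  fix S assume "definable M B (length (xs @ ys)) S" and mem: "xs @ ys \<in> S"
  then have S: "definable M B (length xs + length ys) S" by simp
  have lower: "dm B ys + (INF y\<in>{ys'. \<exists>xs'. length xs' = length xs \<and> xs' @ ys' \<in> T}. \<delta> {zs. zs @ y \<in> T}) \<le> \<delta> T"
    if T: "definable M B (length xs + length ys) T" "xs @ ys \<in> T" for T
  proof -
    let ?Y = "{ys'. \<exists>xs'. length xs' = length xs \<and> xs' @ ys' \<in> T}"
    have "dm B ys \<le> \<delta> ?Y" by (intro dm_le definable_proj_snd T(1)) (use T(2) in auto)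
    then have "dm B ys + (INF y\<in>?Y. \<delta> {zs. zs @ y \<in> T}) \<le> \<delta> ?Y + (INF y\<in>?Y. \<delta> {zs. zs @ y \<in> T})"
      by (intro add_mono) auto
    also have "\<dots> \<le> \<delta> T"
      by (rule dim_fibers(1)) (use T in \<open>auto intro: definable_mono\<close>)
    finally show ?thesis .
  qed
  have "dm B ys \<le> \<delta> S" using lower[OF S mem] by (rule order_trans[rotated]) simp
  \<comment> \<open>Writing \<open>\<delta> S\<close> as a sum allows \<open>dm B ys\<close> to be
    cancelled when the bounds for all \<open>v\<close> are combined at the end.\<close>
  then obtain r where r: "\<delta> S = dm B ys + r" using diff_add_cancel_ennreal by (metis add.commute)
  have bound: "dm B ys + v \<le> \<delta> S" if v: "v < dm (B \<union> set ys) xs" for v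
  proof -
    \<comment> \<open>The gap between \<open>v\<close> and \<open>v'\<close> is the room that
      continuity requires: fibres of dimension at most \<open>v\<close> are discarded, and the fibre
      at \<open>ys\<close>, of dimension above \<open>v'\<close>, is certainly kept.\<close>
    obtain v' where v': "v < v'" "v' < dm (B \<union> set ys) xs" using dense[OF v] by blast
    obtain s t where s: "0 \<le> s" "v = ennreal s" and t: "v' = ennreal t" "0 \<le> t"
      using v' by (cases v; cases v') auto
    have st: "s < t" using v'(1) s t by (simp add: ennreal_less_iff)
    obtain D where D: "definable M B (length ys) D"
      "\<And>ys'. length ys' = length ys \<Longrightarrow> \<delta> {zs. zs @ ys' \<in> S} \<le> ennreal s \<Longrightarrow> ys' \<in> D"
      "\<And>ys'. ys' \<in> D \<Longrightarrow> \<delta> {zs. zs @ ys' \<in> S} < ennreal t"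
      using dim_continuous_params[OF S s(1) st] by metis
    let ?E = "{zs. length zs = length ys} - D"
    let ?T = "S \<inter> {zs. length zs = length xs + length ys \<and> drop (length xs) zs \<in> ?E}"
    have T: "definable M B (length xs + length ys) ?T"
      by (intro definable_Int S definable_shift definable_Diff D(1))
    have "ys \<notin> D"
    proof
      assume "ys \<in> D"
      then have "\<delta> {zs. zs @ ys \<in> S} < v'" using D(3) t by simp
      moreover have "dm (B \<union> set ys) xs \<le> \<delta> {zs. zs @ ys \<in> S}"
        by (intro dm_le definable_fiber S) (use mem in simp)
      ultimately show False using v'(2) by simp
    qed
    then have mem': "xs @ ys \<in> ?T" using mem by simp
    have "v \<le> (INF y\<in>{ys'. \<exists>xs'. length xs' = length xs \<and> xs' @ ys' \<in> ?T}. \<delta> {zs. zs @ y \<in> ?T})"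
    proof (rule INF_greatest)
      fix y assume "y \<in> {ys'. \<exists>xs'. length xs' = length xs \<and> xs' @ ys' \<in> ?T}"
      then have y: "length y = length ys" "y \<notin> D" by auto
      have "zs @ y \<in> ?T" if "zs @ y \<in> S" for zs
        using definable_length[OF S that] that y by simp
      then have "{zs. zs @ y \<in> ?T} = {zs. zs @ y \<in> S}" by blast
      moreover have "v \<le> \<delta> {zs. zs @ y \<in> S}" using D(2)[OF y(1)] y(2) s(2) by force
      ultimately show "v \<le> \<delta> {zs. zs @ y \<in> ?T}" by simp
    qed
    then have "dm B ys + v \<le> \<delta> ?T" using lower[OF T mem'] by (meson add_left_mono order_trans)
    also have "\<dots> \<le> \<delta> S"
      using S T by (intro dim_mono) (auto intro: definable_mono)
    finally show ?thesis .
  qed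
  show "dm B ys + dm (B \<union> set ys) xs \<le> \<delta> S"
  proof (cases "dm B ys = top")
    case False
    have "dm (B \<union> set ys) xs \<le> r"
    proof (rule dense_le)
      fix v assume "v < dm (B \<union> set ys) xs"
      then have "dm B ys + v \<le> dm B ys + r" using bound r by simp
      then show "v \<le> r" using False by (simp add: ennreal_add_left_cancel_le)
    qed
    then show ?thesis unfolding r by (rule add_left_mono)
  qed (use r in simp)
qed

lemma dm_append: "dm B (xs @ ys) = dm B ys + dm (B \<union> set ys) xs"
  by (intro antisym dm_append_le dm_append_ge)

lemma dm_coords_le:
  assumes "set \<sigma> \<subseteq> {..<length xs}"
  shows "dm B (map ((!) xs) \<sigma>) \<le> dm B xs"
proof (rule dm_geI)
  fix S assume S: "definable M B (length xs) S" "xs \<in> S"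
  have "dm B (map ((!) xs) \<sigma>) \<le> \<delta> ((\<lambda>xs. map ((!) xs) \<sigma>) ` S)"
    by (rule dm_le) (use definable_image_coords[OF S(1) assms] S(2) in auto)
  also have "\<dots> \<le> \<delta> S"
    by (rule dim_coords_le) (use S assms in \<open>auto intro: definable_mono\<close>)
  finally show "dm B (map ((!) xs) \<sigma>) \<le> \<delta> S" .
qed

text \<open>A list with entries from \<open>xs\<close> is a coordinate image of \<open>xs\<close>,
  so order and repetition do not affect the dimension of a tuple.\<close>

lemma dm_subset:
  assumes "set ys \<subseteq> set xs"
  shows "dm B ys \<le> dm B xs"
proof -
  have "\<forall>y\<in>set ys. \<exists>i<length xs. xs ! i = y" using assms by (auto simp: subset_iff in_set_conv_nth)
  then obtain h where h: "\<And>y. y \<in> set ys \<Longrightarrow> h y < length xs \<and> xs ! h y = y" by metis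
  have "map ((!) xs) (map h ys) = ys" using h by (simp add: map_idI)
  moreover have "set (map h ys) \<subseteq> {..<length xs}" using h by auto
  ultimately show ?thesis using dm_coords_le[of "map h ys" xs B] by simp
qed

section \<open>The rank of finite sets and its closure operator\<close>

text \<open>Any enumeration gives the same value by \<open>dm_subset\<close>. An infinite
  \<open>E\<close> has no enumeration and its value is meaningless, whence the finiteness
  assumptions below.\<close>

definition rk :: "'a set \<Rightarrow> 'a set \<Rightarrow> ennreal" where
  "rk B E = dm B (SOME xs. set xs = E)"

lemma rk_set: "rk B (set xs) = dm B xs"
proof -
  have "set (SOME ys. set ys = set xs) = set xs" by (rule someI[of _ xs]) simp
  then show ?thesis unfolding rk_def by (intro antisym dm_subset) auto
qed

lemma rk_mono:
  assumes "E \<subseteq> G" "finite G"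
  shows "rk B E \<le> rk B G"
proof -
  obtain xs ys where "set xs = E" "set ys = G" using assms finite_list finite_subset by metis
  then show ?thesis using assms(1) dm_subset[of xs ys B] by (auto simp flip: rk_set)
qed

lemma rk_antimono: "B \<subseteq> C \<Longrightarrow> rk C E \<le> rk B E"
  unfolding rk_def by (rule dm_antimono)

lemma rk_Un:
  assumes "finite E" "finite G"
  shows "rk B (E \<union> G) = rk B G + rk (B \<union> G) E"
proof -
  obtain xs ys where "set xs = E" "set ys = G" using assms finite_list by metis
  then show ?thesis using dm_append[of B xs ys] by (auto simp flip: rk_set)
qed

lemma rk_empty: "rk B {} = 0"
proof -
  have "dm B [] \<le> \<delta> {[]}" by (rule dm_le) (use definable_singleton[of "[]" B] in auto)
  also have "\<delta> {[]} = 0" by (rule dim_finite[of 0]) (use definable_singleton[of "[]" UNIV] in auto)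
  finally show ?thesis using rk_set[of B "[]"] by simp
qed

text \<open>A substitute for definable closure: it contains every element definable over
  \<open>B\<close> and, by the chain rule, is transitive, so adjoining finitely many of its elements
  to a set or to the base does not change ranks.\<close>

definition cl :: "'a set \<Rightarrow> 'a set" where
  "cl B = {c. rk B {c} = 0}"

lemma cl_definable: "definable M B 1 {[c]} \<Longrightarrow> c \<in> cl B"
proof -
  assume *: "definable M B 1 {[c]}"
  have "dm B [c] \<le> \<delta> {[c]}" by (rule dm_le) (use * in auto)
  also have "\<delta> {[c]} = 0" by (rule dim_finite[of 1]) (use * in \<open>auto intro: definable_mono\<close>)
  finally show "c \<in> cl B" unfolding cl_def using rk_set[of B "[c]"] by simp
qed

lemma cl_base: "c \<in> B \<Longrightarrow> c \<in> cl B"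
  by (intro cl_definable definable_singleton_param)

lemma cl_mono: "B \<subseteq> C \<Longrightarrow> cl B \<subseteq> cl C"
proof
  fix c assume "B \<subseteq> C" "c \<in> cl B"
  then show "c \<in> cl C" using rk_antimono[of B C "{c}"] by (simp add: cl_def)
qed

lemma rk_cl:
  assumes "finite E" "E \<subseteq> cl B"
  shows "rk B E = 0"
  using assms
proof (induction rule: finite_induct)
  case (insert x E)
  have "rk B ({x} \<union> E) = rk B E + rk (B \<union> E) {x}" by (rule rk_Un) (use insert in auto)
  moreover have "rk (B \<union> E) {x} \<le> rk B {x}" by (rule rk_antimono) auto
  ultimately show ?case using insert by (simp add: cl_def)
qed (rule rk_empty)

lemma rk_Un_cl:
  assumes "finite E" "finite G" "E \<subseteq> cl (B \<union> G)"
  shows "rk B (E \<union> G) = rk B G"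
  using rk_Un[OF assms(1,2)] rk_cl[OF assms(1,3)] by simp

lemma rk_le_cl:
  assumes "finite E" "finite G" "E \<subseteq> cl (B \<union> G)"
  shows "rk B E \<le> rk B G"
  using rk_mono[of E "E \<union> G" B] rk_Un_cl[OF assms] assms by simp

lemma rk_base_cl:
  assumes "finite E" "finite G" "E \<subseteq> cl B"
  shows "rk (B \<union> E) G = rk B G"
proof -
  have "rk B (G \<union> E) = rk B E + rk (B \<union> E) G" by (rule rk_Un) (use assms in auto)
  moreover have "rk B (E \<union> G) = rk B G"
    using assms cl_mono[of B "B \<union> G"] by (intro rk_Un_cl) auto
  ultimately show ?thesis using rk_cl[OF assms(1,3)] by (simp add: Un_commute)
qed

lemma cl_trans:
  assumes "finite E" "E \<subseteq> cl B" "c \<in> cl (B \<union> E)"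
  shows "c \<in> cl B"
  using assms rk_base_cl[of E "{c}" B] by (simp add: cl_def)

lemma rk_Un_le: "finite E \<Longrightarrow> finite G \<Longrightarrow> rk B (E \<union> G) \<le> rk B E + rk B G"
  using rk_Un[of E G B] rk_antimono[of B "B \<union> G" E] by (simp add: add.commute add_left_mono)

text \<open>The chain rule splits \<open>w\<close> off from both \<open>E\<close> and
  \<open>G\<close>, and over \<open>B\<close> and \<open>w\<close> the rank is subadditive. With
  \<open>rk B {w}\<close> added on the left, the inequality avoids subtraction and covers infinite
  values.\<close>

lemma rk_submodular:
  assumes "finite E" "finite G" "w \<in> cl (B \<union> E)" "w \<in> cl (B \<union> G)"
  shows "rk B {w} + rk B (E \<union> G) \<le> rk B E + rk B G"
proof -
  let ?B = "B \<union> {w}"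
  have E: "rk B E = rk B {w} + rk ?B E"
    using rk_Un_cl[of "{w}" E B] rk_Un[of E "{w}" B] assms by (simp add: Un_commute)
  have G: "rk B G = rk B {w} + rk ?B G"
    using rk_Un_cl[of "{w}" G B] rk_Un[of G "{w}" B] assms by (simp add: Un_commute)
  have "rk B (E \<union> G) \<le> rk B ((E \<union> G) \<union> {w})" by (rule rk_mono) (use assms in auto)
  also have "\<dots> = rk B {w} + rk ?B (E \<union> G)" by (rule rk_Un) (use assms in auto)
  also have "\<dots> \<le> rk B {w} + (rk ?B E + rk ?B G)" by (intro add_left_mono rk_Un_le assms)
  finally have "rk B {w} + rk B (E \<union> G) \<le> rk B {w} + (rk B {w} + (rk ?B E + rk ?B G))"
    by (rule add_left_mono)
  then show ?thesis unfolding E G by (simp add: ac_simps)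
qed

end

section \<open>Types in saturated structures\<close>

text \<open>Equality of types over \<open>B\<close>. One implication suffices, since complements of
  definable sets are definable.\<close>

definition teq :: "('a, 'f, 'r) struc \<Rightarrow> 'a set \<Rightarrow> 'a list \<Rightarrow> 'a list \<Rightarrow> bool" where
  "teq M B xs ys \<longleftrightarrow> length xs = length ys \<and>
     (\<forall>S. definable M B (length xs) S \<longrightarrow> xs \<in> S \<longrightarrow> ys \<in> S)"

lemma teq_length: "teq M B xs ys \<Longrightarrow> length ys = length xs"
  unfolding teq_def by simp

lemma teqD: "teq M B xs ys \<Longrightarrow> definable M B (length xs) S \<Longrightarrow> xs \<in> S \<Longrightarrow> ys \<in> S"
  unfolding teq_def by blast

lemma teq_refl: "teq M B xs xs"
  unfolding teq_def by simp

lemma teq_sym: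
  assumes "teq M B xs ys"
  shows "teq M B ys xs"
  unfolding teq_def
proof (intro conjI allI impI)
  show "length ys = length xs" using assms by (rule teq_length)
  fix S assume S: "definable M B (length ys) S" "ys \<in> S"
  then have S': "definable M B (length xs) S" using assms by (simp add: teq_length)
  show "xs \<in> S"
  proof (rule ccontr)
    assume "xs \<notin> S"
    then have "ys \<in> {zs. length zs = length xs} - S"
      by (intro teqD[OF assms definable_Diff[OF S']]) simp
    then show False using S(2) by simp
  qed
qed

lemma teq_mono: "teq M C xs ys \<Longrightarrow> B \<subseteq> C \<Longrightarrow> teq M B xs ys"
  unfolding teq_def using definable_mono by blast

lemma teq_coords:
  assumes "teq M B xs ys" "set \<sigma> \<subseteq> {..<length xs}"
  shows "teq M B (map ((!) xs) \<sigma>) (map ((!) ys) \<sigma>)"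
  unfolding teq_def
proof (intro conjI allI impI)
  fix S assume S: "definable M B (length (map ((!) xs) \<sigma>)) S" "map ((!) xs) \<sigma> \<in> S"
  have "definable M B (length xs) {zs. length zs = length xs \<and> map ((!) zs) \<sigma> \<in> S}"
    by (rule definable_vimage_coords) (use S(1) assms(2) in auto)
  from teqD[OF assms(1) this] show "map ((!) ys) \<sigma> \<in> S" using S(2) by simp
qed simp

lemma teq_append_base:
  assumes "teq M (B \<union> set cs) xs ys"
  shows "teq M B (xs @ cs) (ys @ cs)"
  unfolding teq_def
proof (intro conjI allI impI)
  show "length (xs @ cs) = length (ys @ cs)" using assms by (simp add: teq_length)
  fix S assume S: "definable M B (length (xs @ cs)) S" "xs @ cs \<in> S"
  then have "definable M (B \<union> set cs) (length xs) {zs. zs @ cs \<in> S}"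
    by (intro definable_fiber) simp
  from teqD[OF assms this] show "ys @ cs \<in> S" using S(2) by simp
qed

locale saturated_dimension = dimension M \<delta>
  for M :: "('a, 'f, 'r) struc" and \<delta> :: "'a list set \<Rightarrow> ennreal" +
  fixes \<kappa> :: "'k rel"
  assumes sat: "sufficiently_saturated \<kappa> M"
begin

text \<open>The formulas \<open>Eq (Var i) (Var i)\<close> are pairwise distinct, so the language
  alone forces \<kappa> to be infinite; hence adjoining finitely many parameters keeps a set
  small.\<close>

lemma infinite_Field: "infinite (Field \<kappa>)"
proof -
  let ?\<Phi> = "{\<phi> :: ('f, 'r, 'a) fm. params \<phi> = {}}"
  have "inj (\<lambda>i. Eq (Var i) (Var i) :: ('f, 'r, 'a) fm)" by (simp add: inj_def)
  then have "infinite (range (\<lambda>i. Eq (Var i) (Var i) :: ('f, 'r, 'a) fm))" by (rule range_inj_infinite)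
  moreover have "range (\<lambda>i. Eq (Var i) (Var i)) \<subseteq> ?\<Phi>" by auto
  ultimately have inf: "infinite ?\<Phi>" using infinite_super by blast
  have "Card_order \<kappa>" "|?\<Phi>| <o \<kappa>" using sat unfolding sufficiently_saturated_def by auto
  then have "|?\<Phi>| \<le>o |Field \<kappa>|"
    using card_of_Field_ordIso ordIso_symmetric ordLess_ordIso_trans ordLess_imp_ordLeq by blast
  then show ?thesis using inf card_of_ordLeq_infinite by blast
qed

lemma small_Un_finite:
  assumes "|B| <o \<kappa>" "finite E"
  shows "|B \<union> E| <o \<kappa>"
proof -
  have \<kappa>: "Card_order \<kappa>" using sat unfolding sufficiently_saturated_def by simp
  have "|E| <o |Field \<kappa>|" using finite_ordLess_infinite[of "|E|" "|Field \<kappa>|"] assms(2) infinite_Field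
    by (simp add: card_of_well_order_on Field_card_of)
  then have "|E| <o \<kappa>" using card_of_Field_ordIso[OF \<kappa>] ordLess_ordIso_trans by blast
  then show ?thesis using card_of_Un_ordLess_infinite_Field[OF infinite_Field \<kappa> assms(1)] by blast
qed

section \<open>Realizing types: independent copies and homogeneity\<close>

lemma saturation:
  assumes B: "|B| <o \<kappa>" and \<S>: "\<And>S. S \<in> \<S> \<Longrightarrow> definable M B n S"
    and fip: "\<And>\<T>. finite \<T> \<Longrightarrow> \<T> \<subseteq> \<S> \<Longrightarrow> \<exists>xs. length xs = n \<and> xs \<in> \<Inter>\<T>"
  obtains xs where "length xs = n" "\<And>S. S \<in> \<S> \<Longrightarrow> xs \<in> S"
proof -
  let ?\<Gamma> = "{\<phi> \<in> formulas n B. solutions M n \<phi> \<in> \<S>}"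
  have "partial_type M B n ?\<Gamma>"
    unfolding partial_type_def
  proof (intro conjI allI impI)
    fix \<Delta> assume \<Delta>: "\<Delta> \<subseteq> ?\<Gamma>" "finite \<Delta>"
    then obtain xs where xs: "length xs = n" "xs \<in> \<Inter>(solutions M n ` \<Delta>)"
      using fip[of "solutions M n ` \<Delta>"] by blast
    then show "\<exists>xs. length xs = n \<and> (\<forall>\<phi>\<in>\<Delta>. holds M \<phi> xs)"
      by (intro exI[of _ xs]) (auto simp: solutions_def)
  qed simp
  then obtain xs where xs: "xs \<in> realizations M n ?\<Gamma>"
    using sat B unfolding sufficiently_saturated_def by blast
  show ?thesis
  proof (rule that)
    show "length xs = n" using xs by (simp add: realizations_def)
    fix S assume S: "S \<in> \<S>"
    obtain \<phi> where \<phi>: "\<phi> \<in> formulas n B" "S = solutions M n \<phi>" using \<S>[OF S] by (rule definableE)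
    then have "holds M \<phi> xs" using xs S by (simp add: realizations_def)
    then show "xs \<in> S" using \<phi>(2) \<open>length xs = n\<close> by (simp add: solutions_def)
  qed
qed

text \<open>Together with the type of \<open>xs\<close> over \<open>B\<close>, the complements of
  all \<open>C\<close>-definable sets of smaller dimension are finitely satisfiable: no finite union
  of such sets covers a set of dimension at least \<open>dm B xs\<close>. A realization is a copy of
  \<open>xs\<close> independent over \<open>C\<close>.\<close>

lemma teq_extension:
  assumes B: "B \<subseteq> C" and C: "|C| <o \<kappa>"
  obtains ys where "teq M B xs ys" "rk B (set xs) \<le> rk C (set ys)"
proof (cases "dm B xs = 0")
  \<comment> \<open>The ideal argument requires a positive threshold; at dimension zero
    \<open>xs\<close> itself serves.\<close>
  case True
  then show ?thesis using that[of xs] by (simp add: teq_refl rk_set)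
next
  case False
  let ?n = "length xs"
  define \<F> where "\<F> = {S. definable M B ?n S \<and> xs \<in> S}"
  define \<G> where "\<G> = {R. definable M C ?n R \<and> \<delta> R < dm B xs}"
  obtain ys where ys: "length ys = ?n" "\<And>S. S \<in> \<F> \<union> (\<lambda>R. {zs. length zs = ?n} - R) ` \<G> \<Longrightarrow> ys \<in> S"
  proof (rule saturation[OF C, of "\<F> \<union> (\<lambda>R. {zs. length zs = ?n} - R) ` \<G>" ?n])
    show "definable M C ?n S" if "S \<in> \<F> \<union> (\<lambda>R. {zs. length zs = ?n} - R) ` \<G>" for S
      using that B unfolding \<F>_def \<G>_def by (auto intro: definable_Diff definable_mono)
    fix \<T> assume \<T>: "finite \<T>" "\<T> \<subseteq> \<F> \<union> (\<lambda>R. {zs. length zs = ?n} - R) ` \<G>"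
    define S where "S = {zs. length zs = ?n} \<inter> \<Inter>(\<T> \<inter> \<F>)"
    define \<R> where "\<R> = (\<lambda>T. {zs. length zs = ?n} - T) ` (\<T> - \<F>)"
    have S: "definable M B ?n S" "xs \<in> S"
      unfolding S_def using \<T>(1) by (intro definable_Inter) (auto simp: \<F>_def)
    have \<R>: "finite \<R>" "\<And>R. R \<in> \<R> \<Longrightarrow> definable M UNIV ?n R \<and> \<delta> R < dm B xs"
    proof -
      show "finite \<R>" unfolding \<R>_def using \<T>(1) by simp
      fix R assume "R \<in> \<R>"
      then obtain R' where "R' \<in> \<G>" "R = {zs. length zs = ?n} - ({zs. length zs = ?n} - R')"
        using \<T>(2) unfolding \<R>_def by blast
      moreover from this have "R = R'" unfolding \<G>_def by (auto dest: definable_length)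
      ultimately show "definable M UNIV ?n R \<and> \<delta> R < dm B xs"
        unfolding \<G>_def by (auto intro: definable_mono)
    qed
    have "\<delta> (\<Union>\<R>) < dm B xs" using False \<R> by (intro dim_Union_less) (auto simp: zero_less_iff_neq_zero)
    moreover have "dm B xs \<le> \<delta> S" using S by (rule dm_le)
    ultimately have "\<not> S \<subseteq> \<Union>\<R>"
      using dim_mono[of ?n S "\<Union>\<R>"] definable_mono[OF S(1)] definable_Union[of \<R> M UNIV ?n] \<R>
      by (meson leD le_less_trans order_trans subset_UNIV)
    then obtain zs where zs: "zs \<in> S" "zs \<notin> \<Union>\<R>" by blast
    show "\<exists>zs. length zs = ?n \<and> zs \<in> \<Inter>\<T>"
    proof (intro exI conjI InterI)
      show "length zs = ?n" using zs(1) unfolding S_def by simp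
      fix T assume "T \<in> \<T>"
      then show "zs \<in> T" using zs \<open>length zs = ?n\<close> unfolding S_def \<R>_def by (cases "T \<in> \<F>") auto
    qed
  qed blast
  show ?thesis
  proof (rule that)
    show "teq M B xs ys" unfolding teq_def using ys unfolding \<F>_def by simp
    have "dm B xs \<le> dm C ys"
    proof (rule dm_geI, rule ccontr)
      fix R assume R: "definable M C (length ys) R" "ys \<in> R" "\<not> dm B xs \<le> \<delta> R"
      then have "R \<in> \<G>" unfolding \<G>_def using ys(1) by simp
      then show False using ys(2)[of "{zs. length zs = ?n} - R"] R(2) by blast
    qed
    then show "rk B (set xs) \<le> rk C (set ys)" by (simp add: rk_set)
  qed
qed

text \<open>Takes the place of an automorphism carrying \<open>xs\<close> to \<open>xs'\<close>:
  finitely many conditions on \<open>ys\<close> over \<open>xs\<close> project to one condition on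
  \<open>xs\<close>, which \<open>xs'\<close> shares.\<close>

lemma teq_homogeneous:
  assumes B: "|B| <o \<kappa>" and xs: "teq M B xs xs'"
  obtains ys' where "teq M B (ys @ xs) (ys' @ xs')" "length ys' = length ys"
proof -
  let ?k = "length ys" and ?n = "length xs"
  define \<F> where "\<F> = {S. definable M B (?k + ?n) S \<and> ys @ xs \<in> S}"
  have "|B \<union> set xs'| <o \<kappa>" using B by (intro small_Un_finite) auto
  then obtain ys' where ys': "length ys' = ?k" "\<And>S. S \<in> (\<lambda>S. {zs. zs @ xs' \<in> S}) ` \<F> \<Longrightarrow> ys' \<in> S"
  proof (rule saturation[of _ "(\<lambda>S. {zs. zs @ xs' \<in> S}) ` \<F>" ?k])
    show "definable M (B \<union> set xs') ?k S" if "S \<in> (\<lambda>S. {zs. zs @ xs' \<in> S}) ` \<F>" for S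
      using that teq_length[OF xs] unfolding \<F>_def by (auto intro!: definable_fiber)
    fix \<T> assume "finite \<T>" "\<T> \<subseteq> (\<lambda>S. {zs. zs @ xs' \<in> S}) ` \<F>"
    then obtain \<U> where \<U>: "finite \<U>" "\<U> \<subseteq> \<F>" "\<T> = (\<lambda>S. {zs. zs @ xs' \<in> S}) ` \<U>"
      using finite_subset_image by metis
    let ?S = "{zs. length zs = ?k + ?n} \<inter> \<Inter>\<U>"
    have S: "definable M B (?k + ?n) ?S" using \<U> unfolding \<F>_def by (intro definable_Inter) auto
    have "ys @ xs \<in> ?S" using \<U>(2) unfolding \<F>_def by auto
    then have "xs' \<in> {zs. \<exists>ws. length ws = ?k \<and> ws @ zs \<in> ?S}"
      by (intro teqD[OF xs definable_proj_snd[OF S]]) auto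
    then show "\<exists>zs. length zs = ?k \<and> zs \<in> \<Inter>\<T>" unfolding \<U>(3) by blast
  qed blast
  show ?thesis
  proof (rule that)
    show "teq M B (ys @ xs) (ys' @ xs')"
      unfolding teq_def using ys' teq_length[OF xs] by (auto simp: \<F>_def)
  qed (rule ys'(1))
qed

text \<open>By \<open>dm_open\<close> any strict bound on the rank is witnessed by a
  \<open>B\<close>-definable set containing the joint tuple, and equality of types moves the other
  tuple into it.\<close>

lemma rk_teq_le:
  assumes "teq M B (xs @ ys) (xs' @ ys')" "length xs = length xs'"
  shows "rk (B \<union> set ys') (set xs') \<le> rk (B \<union> set ys) (set xs)"
proof -
  have "dm (B \<union> set ys') xs' \<le> t" if lt: "dm (B \<union> set ys) xs < t" for t
  proof -
    obtain S where S: "definable M B (length xs + length ys) S" "xs @ ys \<in> S"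
      "\<And>zs zs'. length zs = length xs \<Longrightarrow> zs @ zs' \<in> S \<Longrightarrow> \<delta> {ws. ws @ zs' \<in> S} < t"
      using lt by (rule dm_open) blast
    have "xs' @ ys' \<in> S" using teqD[OF assms(1) _ S(2)] S(1) by simp
    moreover have "length ys' = length ys" using teq_length[OF assms(1)] assms(2) by simp
    ultimately have "dm (B \<union> set ys') xs' \<le> \<delta> {ws. ws @ ys' \<in> S}"
      using assms(2) S(1) by (intro dm_le definable_fiber) auto
    also have "\<dots> < t" using S(3) \<open>xs' @ ys' \<in> S\<close> assms(2) by simp
    finally show ?thesis by simp
  qed
  then show ?thesis by (simp add: rk_set dense_ge)
qed

lemma rk_teq:
  assumes "teq M B (xs @ ys) (xs' @ ys')" "length xs = length xs'"
  shows "rk (B \<union> set ys') (set xs') = rk (B \<union> set ys) (set xs)"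
  using rk_teq_le[OF assms] rk_teq_le[OF teq_sym[OF assms(1)]] assms(2) by (simp add: antisym)

text \<open>An independent copy over \<open>C\<close> and \<open>xs\<close> cannot be
  \<open>xs\<close>, whose rank over that base is zero.\<close>

lemma teq_extension_neq:
  assumes "|C| <o \<kappa>" "rk C (set xs) \<noteq> 0"
  obtains ys where "teq M C xs ys" "rk C (set xs) \<le> rk (C \<union> set xs) (set ys)" "ys \<noteq> xs"
proof -
  obtain ys where ys: "teq M C xs ys" "rk C (set xs) \<le> rk (C \<union> set xs) (set ys)"
    using teq_extension[of C "C \<union> set xs" xs] small_Un_finite[OF assms(1)] by auto
  have "rk (C \<union> set xs) (set xs) = 0" using cl_base by (intro rk_cl) auto
  then have "ys \<noteq> xs" using ys(2) assms(2) by auto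
  then show ?thesis using that ys by blast
qed

section \<open>Type-definable sets\<close>

text \<open>Closed sets for the topology with the \<open>B\<close>-definable sets as basis, so that
  no set of formulas has to be carried along. Only tuples of length \<open>n\<close> are
  constrained.\<close>

definition type_definable :: "'a set \<Rightarrow> nat \<Rightarrow> 'a list set \<Rightarrow> bool" where
  "type_definable B n U \<longleftrightarrow>
     (\<forall>xs. length xs = n \<longrightarrow> xs \<notin> U \<longrightarrow> (\<exists>S. definable M B n S \<and> xs \<in> S \<and> S \<inter> U = {}))"

lemma type_definableI:
  "(\<And>xs. length xs = n \<Longrightarrow> xs \<notin> U \<Longrightarrow> \<exists>S. definable M B n S \<and> xs \<in> S \<and> S \<inter> U = {}) \<Longrightarrow>
    type_definable B n U"
  unfolding type_definable_def by blast

lemma type_definable_definable: "definable M B n U \<Longrightarrow> type_definable B n U"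
  by (rule type_definableI) (use definable_Diff in blast)

lemma type_definable_Int: "type_definable B n U \<Longrightarrow> type_definable B n V \<Longrightarrow> type_definable B n (U \<inter> V)"
  unfolding type_definable_def by blast

lemma type_definable_vimage_coords:
  assumes "type_definable B (length \<sigma>) U" "set \<sigma> \<subseteq> {..<n}"
  shows "type_definable B n {xs. length xs = n \<and> map ((!) xs) \<sigma> \<in> U}"
proof (rule type_definableI)
  fix xs assume "length xs = n" "xs \<notin> {xs. length xs = n \<and> map ((!) xs) \<sigma> \<in> U}"
  then obtain S where S: "definable M B (length \<sigma>) S" "map ((!) xs) \<sigma> \<in> S" "S \<inter> U = {}"
    using assms(1) unfolding type_definable_def by force
  show "\<exists>S. definable M B n S \<and> xs \<in> S \<and> S \<inter> {xs. length xs = n \<and> map ((!) xs) \<sigma> \<in> U} = {}"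
    by (rule exI[of _ "{xs. length xs = n \<and> map ((!) xs) \<sigma> \<in> S}"])
      (use definable_vimage_coords[OF S(1) assms(2)] S \<open>length xs = n\<close> in auto)
qed

text \<open>Compactness: if no definable set separates \<open>xs\<close> from the projection, then
  the sections over \<open>xs\<close> of the definable supersets of \<open>U\<close> have the finite
  intersection property.\<close>

lemma type_definable_proj:
  assumes B: "|B| <o \<kappa>" and U: "type_definable B (n + m) U"
  shows "type_definable B n {xs. \<exists>ys. length ys = m \<and> xs @ ys \<in> U}"
proof (rule type_definableI, rule ccontr)
  fix xs assume xs: "length xs = n" "xs \<notin> {xs. \<exists>ys. length ys = m \<and> xs @ ys \<in> U}"
    and no: "\<not> (\<exists>S. definable M B n S \<and> xs \<in> S \<and> S \<inter> {xs. \<exists>ys. length ys = m \<and> xs @ ys \<in> U} = {})"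
  define \<F> where "\<F> = {S. definable M B (n + m) S \<and> U \<inter> {zs. length zs = n + m} \<subseteq> S}"
  have "|B \<union> set xs| <o \<kappa>" using B by (intro small_Un_finite) auto
  then obtain ys where ys: "length ys = m" "\<And>S. S \<in> (\<lambda>S. {ys. xs @ ys \<in> S}) ` \<F> \<Longrightarrow> ys \<in> S"
  proof (rule saturation[of _ "(\<lambda>S. {ys. xs @ ys \<in> S}) ` \<F>" m])
    fix T assume "T \<in> (\<lambda>S. {ys. xs @ ys \<in> S}) ` \<F>"
    then obtain S where S: "definable M B (n + m) S" "T = {ys. xs @ ys \<in> S}" unfolding \<F>_def by blast
    \<comment> \<open>Sections are available for trailing coordinates, but here the leading block is
      fixed, so the two blocks are exchanged.\<close>
    let ?\<sigma> = "[m..<m + n] @ [0..<m]"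
    have len: "length ?\<sigma> = n + m" by simp
    have swap: "map ((!) (ys @ xs)) ?\<sigma> = xs @ ys" if "length ys = m" for ys
      using that xs(1) by (intro nth_equalityI) (auto simp: nth_append)
    have "definable M B (m + n) {zs. length zs = m + n \<and> map ((!) zs) ?\<sigma> \<in> S}"
      by (rule definable_vimage_coords) (use S(1) len in auto)
    then have "definable M (B \<union> set xs) m {ys. ys @ xs \<in> {zs. length zs = m + n \<and> map ((!) zs) ?\<sigma> \<in> S}}"
      using xs(1) by (intro definable_fiber) simp
    also have "{ys. ys @ xs \<in> {zs. length zs = m + n \<and> map ((!) zs) ?\<sigma> \<in> S}} = T"
    proof (intro set_eqI iffI)
      fix ys assume "ys \<in> {ys. ys @ xs \<in> {zs. length zs = m + n \<and> map ((!) zs) ?\<sigma> \<in> S}}"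
      then have "length ys = m" "map ((!) (ys @ xs)) ?\<sigma> \<in> S" using xs(1) by auto
      then show "ys \<in> T" unfolding S(2) swap[OF \<open>length ys = m\<close>] by simp
    next
      fix ys assume "ys \<in> T"
      then have "xs @ ys \<in> S" unfolding S(2) by simp
      moreover from this have "length ys = m" using definable_length[OF S(1)] xs(1) by fastforce
      ultimately show "ys \<in> {ys. ys @ xs \<in> {zs. length zs = m + n \<and> map ((!) zs) ?\<sigma> \<in> S}}"
        using xs(1) swap by (simp only: mem_Collect_eq length_append simp_thms)
    qed
    finally show "definable M (B \<union> set xs) m T" .
  next
    fix \<T> assume "finite \<T>" "\<T> \<subseteq> (\<lambda>S. {ys. xs @ ys \<in> S}) ` \<F>"
    then obtain \<U> where \<U>: "finite \<U>" "\<U> \<subseteq> \<F>" "\<T> = (\<lambda>S. {ys. xs @ ys \<in> S}) ` \<U>"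
      using finite_subset_image by metis
    let ?S = "{zs. length zs = n + m} \<inter> \<Inter>\<U>"
    have S: "definable M B (n + m) ?S" using \<U> unfolding \<F>_def by (intro definable_Inter) auto
    \<comment> \<open>Base points without a fibre in the finite intersection form a definable set
      disjoint from the projection, so by \<open>no\<close> it misses \<open>xs\<close>.\<close>
    let ?N = "{zs. length zs = n} - {xs. \<exists>ys. length ys = m \<and> xs @ ys \<in> ?S}"
    have "definable M B n ?N" by (intro definable_Diff definable_proj S)
    moreover have "?N \<inter> {xs. \<exists>ys. length ys = m \<and> xs @ ys \<in> U} = {}"
    proof -
      have "U \<inter> {zs. length zs = n + m} \<subseteq> ?S" using \<U>(2) unfolding \<F>_def by blast
      then have "xs' @ ys \<in> ?S" if "xs' @ ys \<in> U" "length xs' = n" "length ys = m" for xs' ys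
        using that by auto
      then show ?thesis by blast
    qed
    ultimately have "xs \<notin> ?N" using no by blast
    then show "\<exists>ys. length ys = m \<and> ys \<in> \<Inter>\<T>" unfolding \<U>(3) using xs(1) by blast
  qed blast
  have "xs @ ys \<in> U"
  proof (rule ccontr)
    assume "xs @ ys \<notin> U"
    then obtain S where S: "definable M B (n + m) S" "xs @ ys \<in> S" "S \<inter> U = {}"
      using U xs(1) ys(1) unfolding type_definable_def by (metis length_append)
    then have "{zs. length zs = n + m} - S \<in> \<F>" unfolding \<F>_def by (auto intro: definable_Diff)
    then have "xs @ ys \<in> {zs. length zs = n + m} - S" using ys(2) by blast
    then show False using S(2) by blast
  qed
  then show False using xs(2) ys(1) by blast
qed

text \<open>Compactness: no point lies in all definable supersets of \<open>K\<close> and in all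
  those of its complement, so finitely many of these already have empty intersection.\<close>

lemma definable_if_type_definable:
  assumes B: "|B| <o \<kappa>" and K: "K \<subseteq> {xs. length xs = n}" "type_definable B n K"
    "type_definable B n ({xs. length xs = n} - K)"
  shows "definable M B n K"
proof -
  define \<F> where "\<F> = {S. definable M B n S \<and> K \<subseteq> S}"
  define \<G> where "\<G> = {S. definable M B n S \<and> {xs. length xs = n} - K \<subseteq> S}"
  have "\<exists>\<T>. finite \<T> \<and> \<T> \<subseteq> \<F> \<union> \<G> \<and> {xs. length xs = n} \<inter> \<Inter>\<T> = {}"
  proof (rule ccontr)
    assume no: "\<not> ?thesis"
    obtain xs where xs: "length xs = n" "\<And>S. S \<in> \<F> \<union> \<G> \<Longrightarrow> xs \<in> S"
    proof (rule saturation[OF B, of "\<F> \<union> \<G>" n])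
      show "definable M B n S" if "S \<in> \<F> \<union> \<G>" for S using that unfolding \<F>_def \<G>_def by blast
      fix \<T> assume "finite \<T>" "\<T> \<subseteq> \<F> \<union> \<G>"
      then have "{xs. length xs = n} \<inter> \<Inter>\<T> \<noteq> {}" using no by simp
      then show "\<exists>xs. length xs = n \<and> xs \<in> \<Inter>\<T>" by blast
    qed blast
    show False
    proof (cases "xs \<in> K")
      case True
      then obtain S where S: "definable M B n S" "xs \<in> S" "S \<inter> ({xs. length xs = n} - K) = {}"
        using K(3) xs(1) unfolding type_definable_def by blast
      then have "{xs. length xs = n} - S \<in> \<G>" unfolding \<G>_def by (auto intro: definable_Diff)
      then show False using xs(2) S(2) by blast
    next
      case False
      then obtain S where S: "definable M B n S" "xs \<in> S" "S \<inter> K = {}"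
        using K(2) xs(1) unfolding type_definable_def by blast
      then have "{xs. length xs = n} - S \<in> \<F>" unfolding \<F>_def using K(1) by (auto intro: definable_Diff)
      then show False using xs(2) S(2) by blast
    qed
  qed
  then obtain \<T> where \<T>: "finite \<T>" "\<T> \<subseteq> \<F> \<union> \<G>" "{xs. length xs = n} \<inter> \<Inter>\<T> = {}" by blast
  \<comment> \<open>The supersets of \<open>K\<close> among the finitely many sets cut out exactly
    \<open>K\<close>: a further point would lie in all the others as well.\<close>
  let ?S = "{xs. length xs = n} \<inter> \<Inter>(\<T> \<inter> \<F>)"
  have "definable M B n ?S" using \<T>(1) unfolding \<F>_def by (intro definable_Inter) auto
  moreover have "?S = K"
  proof
    show "K \<subseteq> ?S" using K(1) unfolding \<F>_def by blast
    show "?S \<subseteq> K"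
    proof
      fix xs assume xs: "xs \<in> ?S"
      show "xs \<in> K"
      proof (rule ccontr)
        assume "xs \<notin> K"
        then have "xs \<in> S" if "S \<in> \<G>" for S using that xs unfolding \<G>_def by blast
        then have "xs \<in> {xs. length xs = n} \<inter> \<Inter>\<T>" using xs \<T>(2) by blast
        then show False using \<T>(3) by blast
      qed
    qed
  qed
  ultimately show ?thesis by simp
qed

text \<open>Realizes \<open>S\<close> outside all \<open>B\<close>-definable sets of smaller
  dimension, finitely many of which cannot cover \<open>S\<close>.\<close>

lemma rk_attained:
  assumes B: "|B| <o \<kappa>" and S: "definable M B n S" "S \<noteq> {}"
  obtains xs where "xs \<in> S" "rk B (set xs) = \<delta> S"
proof -
  obtain xs where xs: "xs \<in> S" "\<delta> S \<le> dm B xs"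
  proof (cases "\<delta> S = 0")
    case True
    then show ?thesis using that S(2) by auto
  next
    case False
    define \<G> where "\<G> = {R. definable M B n R \<and> \<delta> R < \<delta> S}"
    obtain xs where xs: "length xs = n"
      "\<And>T. T \<in> insert S ((\<lambda>R. {zs. length zs = n} - R) ` \<G>) \<Longrightarrow> xs \<in> T"
    proof (rule saturation[OF B, of "insert S ((\<lambda>R. {zs. length zs = n} - R) ` \<G>)" n])
      show "definable M B n T" if "T \<in> insert S ((\<lambda>R. {zs. length zs = n} - R) ` \<G>)" for T
        using that S(1) unfolding \<G>_def by (auto intro: definable_Diff)
      fix \<T> assume \<T>: "finite \<T>" "\<T> \<subseteq> insert S ((\<lambda>R. {zs. length zs = n} - R) ` \<G>)"
      then have "\<T> - {S} \<subseteq> (\<lambda>R. {zs. length zs = n} - R) ` \<G>" by blast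
      then obtain \<R> where \<R>: "finite \<R>" "\<R> \<subseteq> \<G>" "\<T> - {S} = (\<lambda>R. {zs. length zs = n} - R) ` \<R>"
        using finite_subset_image[OF finite_Diff[OF \<T>(1)]] by metis
      have def: "\<And>R. R \<in> \<R> \<Longrightarrow> definable M UNIV n R \<and> \<delta> R < \<delta> S"
        using \<R>(2) unfolding \<G>_def by (auto intro: definable_mono)
      then have "\<delta> (\<Union>\<R>) < \<delta> S" using \<R>(1) False by (intro dim_Union_less) (auto simp: zero_less_iff_neq_zero)
      moreover have "definable M UNIV n (\<Union>\<R>)" using def \<R>(1) by (intro definable_Union) auto
      ultimately have "\<not> S \<subseteq> \<Union>\<R>"
        using dim_mono[of n S "\<Union>\<R>"] definable_mono[OF S(1), of UNIV] by auto
      then obtain zs where zs: "zs \<in> S" "zs \<notin> \<Union>\<R>" by blast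
      then have "length zs = n" using definable_length[OF S(1)] by blast
      moreover have "zs \<in> T" if "T \<in> \<T>" for T
      proof (cases "T = S")
        case False
        then have "T \<in> (\<lambda>R. {zs. length zs = n} - R) ` \<R>" using that \<R>(3) by blast
        then show ?thesis using zs(2) \<open>length zs = n\<close> by blast
      qed (use zs(1) in simp)
      ultimately show "\<exists>zs. length zs = n \<and> zs \<in> \<Inter>\<T>" by blast
    qed blast
    show ?thesis
    proof (rule that)
      show "xs \<in> S" using xs(2) by blast
      show "\<delta> S \<le> dm B xs"
      proof (rule dm_geI, rule ccontr)
        fix R assume R: "definable M B (length xs) R" "xs \<in> R" "\<not> \<delta> S \<le> \<delta> R"
        then have "R \<in> \<G>" unfolding \<G>_def using xs(1) by simp
        then show False using xs(2)[of "{zs. length zs = n} - R"] R(2) by blast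
      qed
    qed
  qed
  moreover have "dm B xs \<le> \<delta> S" using S(1) xs(1) definable_length[OF S(1) xs(1)] by (intro dm_le) auto
  ultimately show ?thesis using that by (simp add: rk_set antisym)
qed

end

section \<open>Structures expanding a field\<close>

locale field_dimension = saturated_dimension F \<delta> \<kappa>
  for F :: "('a::field, 'f, 'r) struc" and \<delta> :: "'a list set \<Rightarrow> ennreal" and \<kappa> :: "'k rel" +
  assumes expands: "expands_field F"
begin

text \<open>No symbol for division is assumed, so quotients enter later through equations cleared of
  denominators.\<close>

definition term_fun :: "nat \<Rightarrow> 'a set \<Rightarrow> ('a list \<Rightarrow> 'a) \<Rightarrow> bool" where
  "term_fun n B h \<longleftrightarrow> (\<exists>t. fv_tm t \<subseteq> {..<n} \<and> tm_params t \<subseteq> B \<and>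
     (\<forall>xs. length xs = n \<longrightarrow> tm_val F (\<lambda>i. if i < n then xs ! i else undefined) t = h xs))"

lemma term_fun_nth: "i < n \<Longrightarrow> term_fun n B (\<lambda>xs. xs ! i)"
  unfolding term_fun_def by (rule exI[of _ "Var i"]) simp

lemma term_fun_const: "c \<in> B \<Longrightarrow> term_fun n B (\<lambda>xs. c)"
  unfolding term_fun_def by (rule exI[of _ "Par c"]) simp

lemma term_fun_0: "term_fun n B (\<lambda>xs. 0)" and term_fun_1: "term_fun n B (\<lambda>xs. 1)"
proof -
  obtain f0 f1 where f: "funs F f0 [] = 0" "funs F f1 [] = 1"
    using expands unfolding expands_field_def by blast
  show "term_fun n B (\<lambda>xs. 0)"
    unfolding term_fun_def by (rule exI[of _ "Fun f0 []"]) (simp add: f)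
  show "term_fun n B (\<lambda>xs. 1)"
    unfolding term_fun_def by (rule exI[of _ "Fun f1 []"]) (simp add: f)
qed

lemma term_fun_add:
  assumes "term_fun n B h" "term_fun n B k"
  shows "term_fun n B (\<lambda>xs. h xs + k xs)"
proof -
  obtain f where "\<And>x y. funs F f [x, y] = x + y"
    using expands unfolding expands_field_def by blast
  moreover obtain t u where "fv_tm t \<subseteq> {..<n} \<and> tm_params t \<subseteq> B \<and>
     (\<forall>xs. length xs = n \<longrightarrow> tm_val F (\<lambda>i. if i < n then xs ! i else undefined) t = h xs)"
     "fv_tm u \<subseteq> {..<n} \<and> tm_params u \<subseteq> B \<and>
     (\<forall>xs. length xs = n \<longrightarrow> tm_val F (\<lambda>i. if i < n then xs ! i else undefined) u = k xs)"
    using assms unfolding term_fun_def by blast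
  ultimately show ?thesis unfolding term_fun_def by (intro exI[of _ "Fun f [t, u]"]) simp
qed

lemma term_fun_mult:
  assumes "term_fun n B h" "term_fun n B k"
  shows "term_fun n B (\<lambda>xs. h xs * k xs)"
proof -
  obtain f where "\<And>x y. funs F f [x, y] = x * y"
    using expands unfolding expands_field_def by blast
  moreover obtain t u where "fv_tm t \<subseteq> {..<n} \<and> tm_params t \<subseteq> B \<and>
     (\<forall>xs. length xs = n \<longrightarrow> tm_val F (\<lambda>i. if i < n then xs ! i else undefined) t = h xs)"
     "fv_tm u \<subseteq> {..<n} \<and> tm_params u \<subseteq> B \<and>
     (\<forall>xs. length xs = n \<longrightarrow> tm_val F (\<lambda>i. if i < n then xs ! i else undefined) u = k xs)"
    using assms unfolding term_fun_def by blast
  ultimately show ?thesis unfolding term_fun_def by (intro exI[of _ "Fun f [t, u]"]) simp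
qed

lemma term_fun_uminus:
  assumes "term_fun n B h"
  shows "term_fun n B (\<lambda>xs. - h xs)"
proof -
  obtain f where "\<And>x. funs F f [x] = - x"
    using expands unfolding expands_field_def by blast
  moreover obtain t where "fv_tm t \<subseteq> {..<n} \<and> tm_params t \<subseteq> B \<and>
     (\<forall>xs. length xs = n \<longrightarrow> tm_val F (\<lambda>i. if i < n then xs ! i else undefined) t = h xs)"
    using assms unfolding term_fun_def by blast
  ultimately show ?thesis unfolding term_fun_def by (intro exI[of _ "Fun f [t]"]) simp
qed

lemma term_fun_diff: "term_fun n B h \<Longrightarrow> term_fun n B k \<Longrightarrow> term_fun n B (\<lambda>xs. h xs - k xs)"
  using term_fun_add[OF _ term_fun_uminus, of n B h k] by simp

lemmas term_fun_intros = term_fun_nth term_fun_const term_fun_0 term_fun_1 term_fun_add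
  term_fun_mult term_fun_uminus term_fun_diff

lemma definable_eq:
  assumes "term_fun n B h" "term_fun n B k"
  shows "definable F B n {xs. length xs = n \<and> h xs = k xs}"
proof -
  obtain t u where "fv_tm t \<subseteq> {..<n} \<and> tm_params t \<subseteq> B \<and>
     (\<forall>xs. length xs = n \<longrightarrow> tm_val F (\<lambda>i. if i < n then xs ! i else undefined) t = h xs)"
     "fv_tm u \<subseteq> {..<n} \<and> tm_params u \<subseteq> B \<and>
     (\<forall>xs. length xs = n \<longrightarrow> tm_val F (\<lambda>i. if i < n then xs ! i else undefined) u = k xs)"
    using assms unfolding term_fun_def by blast
  then show ?thesis using definable_Eq[of t n B u F] by (simp cong: conj_cong)
qed

text \<open>Lets a copy of a configuration keep the equations that define it.\<close>

lemma teq_eq: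
  assumes "teq F B xs ys" "term_fun (length xs) B h" "term_fun (length xs) B k" "h xs = k xs"
  shows "h ys = k ys"
  using teqD[OF assms(1) definable_eq[OF assms(2,3)]] assms(4) by simp

lemma cl_eq:
  assumes "term_fun 1 B h" "term_fun 1 B k" "\<And>x. h [x] = k [x] \<longleftrightarrow> x = c"
  shows "c \<in> cl B"
proof (rule cl_definable)
  have "{xs. length xs = 1 \<and> h xs = k xs} = {[c]}" using assms(3) by (auto simp: length_Suc_conv)
  then show "definable F B 1 {[c]}" using definable_eq[OF assms(1,2)] by simp
qed

lemma cl_0: "0 \<in> cl B"
  by (rule cl_eq[of B "\<lambda>xs. xs ! 0" "\<lambda>xs. 0"]) (auto intro!: term_fun_intros)

lemma cl_1: "1 \<in> cl B"
  by (rule cl_eq[of B "\<lambda>xs. xs ! 0" "\<lambda>xs. 1"]) (auto intro!: term_fun_intros)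

lemma cl_add: "x \<in> cl B \<Longrightarrow> y \<in> cl B \<Longrightarrow> x + y \<in> cl B"
  by (rule cl_trans[of "{x, y}"], simp, simp, rule cl_eq[of _ "\<lambda>xs. xs ! 0" "\<lambda>xs. x + y"])
    (auto intro!: term_fun_nth term_fun_add[OF term_fun_const term_fun_const])

lemma cl_mult: "x \<in> cl B \<Longrightarrow> y \<in> cl B \<Longrightarrow> x * y \<in> cl B"
  by (rule cl_trans[of "{x, y}"], simp, simp, rule cl_eq[of _ "\<lambda>xs. xs ! 0" "\<lambda>xs. x * y"])
    (auto intro!: term_fun_nth term_fun_mult[OF term_fun_const term_fun_const])

lemma cl_diff: "x \<in> cl B \<Longrightarrow> y \<in> cl B \<Longrightarrow> x - y \<in> cl B"
  by (rule cl_trans[of "{x, y}"], simp, simp, rule cl_eq[of _ "\<lambda>xs. xs ! 0" "\<lambda>xs. x - y"])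
    (auto intro!: term_fun_nth term_fun_diff[OF term_fun_const term_fun_const])

lemma cl_uminus: "x \<in> cl B \<Longrightarrow> - x \<in> cl B"
  using cl_diff[OF cl_0] by simp

text \<open>A nonzero element has its inverse as the unique solution of an equation; at zero the
  convention \<open>inverse 0 = 0\<close> applies.\<close>

lemma cl_inverse:
  assumes "x \<in> cl B"
  shows "inverse x \<in> cl B"
proof (cases "x = 0")
  case False
  have "inverse x \<in> cl (B \<union> {x})"
    by (rule cl_eq[of _ "\<lambda>xs. xs ! 0 * x" "\<lambda>xs. 1"])
      (use False in \<open>auto intro!: term_fun_intros simp: field_simps\<close>)
  then show ?thesis using assms cl_trans[of "{x}"] by simp
qed (simp add: cl_0)

lemma cl_divide: "x \<in> cl B \<Longrightarrow> y \<in> cl B \<Longrightarrow> x / y \<in> cl B"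
  unfolding divide_inverse by (intro cl_mult cl_inverse)

lemmas cl_intros = cl_0 cl_1 cl_add cl_mult cl_diff cl_uminus cl_inverse cl_divide cl_base

end

section \<open>Realizations of a generic type\<close>

text \<open>That every point of \<open>P\<close> has rank exactly \<open>d\<close> over
  \<open>A\<close> reflects completeness of the generic type; the sum and product hypotheses enter
  as upper bounds at points of \<open>P\<close>.\<close>

locale generic_realizations = field_dimension F \<delta> \<kappa>
  for F :: "('a::field, 'f, 'r) struc" and \<delta> :: "'a list set \<Rightarrow> ennreal" and \<kappa> :: "'k rel" +
  fixes A P :: "'a set" and d :: ennreal
  assumes small: "|A| <o \<kappa>"
    and P_nonempty: "P \<noteq> {}"
    and P_type_definable: "type_definable A 1 (tuples1 P)"
    and P_rk: "\<And>x. x \<in> P \<Longrightarrow> rk A {x} = d"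
    and d_pos: "0 < d" and d_finite: "d < top"
    and P_add: "\<And>x y. x \<in> P \<Longrightarrow> y \<in> P \<Longrightarrow> rk A {x + y} \<le> d"
    and P_mult: "\<And>x y. x \<in> P \<Longrightarrow> y \<in> P \<Longrightarrow> rk A {x * y} \<le> d"
begin

section \<open>Generic points over small extensions of the base\<close>

definition ext :: "'a set \<Rightarrow> bool" where
  "ext C \<longleftrightarrow> A \<subseteq> C \<and> |C| <o \<kappa>"

lemma ext_A: "ext A"
  unfolding ext_def using small by simp

lemma ext_insert: "ext C \<Longrightarrow> ext (insert x C)"
  unfolding ext_def using small_Un_finite[of C "{x}"] by auto

lemma ext_Un: "ext C \<Longrightarrow> finite E \<Longrightarrow> ext (C \<union> E)"
  unfolding ext_def using small_Un_finite[of C E] by auto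

lemma ext_small: "ext C \<Longrightarrow> |C| <o \<kappa>" and ext_subset: "ext C \<Longrightarrow> A \<subseteq> C"
  unfolding ext_def by auto

lemma d_cancel: "a + d \<le> b + d \<longleftrightarrow> a \<le> b"
  using d_finite ennreal_add_left_cancel_le[of d a b] by (auto simp: add.commute)

lemma d_cancel_left: "d + a \<le> d + b \<longleftrightarrow> a \<le> b"
  using d_cancel[of a b] by (simp only: add.commute)

lemma P_cong:
  assumes "teq F B xs ys" "A \<subseteq> B" "i < length xs" "xs ! i \<in> P"
  shows "ys ! i \<in> P"
proof (rule ccontr)
  assume "ys ! i \<notin> P"
  then have "[ys ! i] \<notin> tuples1 P" by (auto simp: tuples1_def)
  then obtain S where S: "definable F A 1 S" "[ys ! i] \<in> S" "S \<inter> tuples1 P = {}"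
    using P_type_definable unfolding type_definable_def by (metis length_Cons list.size(3) One_nat_def)
  have "teq F B (map ((!) xs) [i]) (map ((!) ys) [i])"
    by (rule teq_coords[OF assms(1)]) (use assms(3) in auto)
  then have "teq F A [ys ! i] [xs ! i]" using assms(2) by (auto intro: teq_mono teq_sym)
  then have "[xs ! i] \<in> S" using S(1,2) by (auto dest: teqD)
  then show False using S(3) assms(4) by (auto simp: tuples1_def)
qed

lemma rk_insert: "finite E \<Longrightarrow> rk C (insert x E) = rk C E + rk (C \<union> E) {x}"
  using rk_Un[of "{x}" E C] by simp

lemma rk_insert_le: "finite E \<Longrightarrow> rk C {x} \<le> d \<Longrightarrow> rk C (insert x E) \<le> rk C E + d"
  using rk_insert[of E C x] rk_antimono[of C "C \<union> E" "{x}"] by (simp add: add_left_mono)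

lemma rk_pair_le: "rk C {x} \<le> d \<Longrightarrow> rk C {y} \<le> d \<Longrightarrow> rk C {x, y} \<le> d + d"
  using rk_insert_le[of "{y}" C x] by (auto intro: order_trans add_right_mono)

lemma rk_point_le: "A \<subseteq> C \<Longrightarrow> x \<in> P \<Longrightarrow> rk C {x} \<le> d"
  using rk_antimono[of A C "{x}"] P_rk by simp

lemma zero_notin_P: "0 \<notin> P"
  using P_rk[of 0] cl_0[of A] d_pos by (auto simp: cl_def)

text \<open>A copy of a point of \<open>P\<close> that is independent over \<open>C\<close> has the
  same type over \<open>A\<close>, hence stays in \<open>P\<close>.\<close>

lemma generic_point:
  assumes "ext C"
  obtains x where "x \<in> P" "d \<le> rk C {x}"
proof -
  obtain x where x: "x \<in> P" using P_nonempty by blast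
  obtain ys where ys: "teq F A [x] ys" "rk A (set [x]) \<le> rk C (set ys)"
    using teq_extension[OF ext_subset[OF assms] ext_small[OF assms]] .
  then obtain y where y: "ys = [y]" using teq_length[OF ys(1)] by (auto simp: length_Suc_conv)
  then have "y \<in> P" using P_cong[OF ys(1), of 0] x by simp
  moreover have "d \<le> rk C {y}" using ys(2) y P_rk[OF x] by simp
  ultimately show ?thesis using that by blast
qed

lemma generic_pairI: "d \<le> rk C {x} \<Longrightarrow> d \<le> rk (insert x C) {y} \<Longrightarrow> d + d \<le> rk C {x, y}"
  using rk_insert[of "{x}" C y] by (simp add: insert_commute add_mono)

lemma generic_pair:
  assumes "ext C"
  obtains x y where "x \<in> P" "y \<in> P" "d + d \<le> rk C {x, y}"
proof -
  obtain x where x: "x \<in> P" "d \<le> rk C {x}" using generic_point[OF assms] .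
  obtain y where y: "y \<in> P" "d \<le> rk (insert x C) {y}"
    using generic_point[OF ext_insert[OF assms]] .
  show ?thesis using that x y generic_pairI by blast
qed

lemma generic_tripleI:
  "d + d \<le> rk C {x, y} \<Longrightarrow> d \<le> rk (C \<union> {x, y}) {z} \<Longrightarrow> d + d + d \<le> rk C {x, y, z}"
  using rk_insert[of "{x, y}" C z] by (simp add: insert_commute add_mono)

text \<open>Discarding \<open>z\<close> loses at most \<open>d\<close>.\<close>

lemma generic_triple_pair:
  assumes "d + d + d \<le> rk C {x, y, z}" "rk C {z} \<le> d"
  shows "d + d \<le> rk C {x, y}"
proof -
  have "rk C {x, y, z} = rk C (insert z {x, y})" by (simp add: insert_commute)
  also have "\<dots> \<le> rk C {x, y} + d" by (rule rk_insert_le[OF _ assms(2)]) simp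
  finally have "d + d + d \<le> rk C {x, y} + d" using assms(1) by (rule order_trans[rotated])
  then show ?thesis by (simp only: d_cancel)
qed

text \<open>Two sets of rank at most \<open>2 d\<close> each determine \<open>w\<close> and together
  carry rank at least \<open>3 d\<close>, so submodularity leaves \<open>4 d - 3 d\<close> for
  \<open>w\<close>. Closure of \<open>K\<close> under negation, product and sum comes from
  configurations of this shape.\<close>

lemma submodular_bound:
  assumes "finite E" "finite G" "w \<in> cl (C \<union> E)" "w \<in> cl (C \<union> G)"
    "rk C E \<le> d + d" "rk C G \<le> d + d" "finite H" "d + d + d \<le> rk C H" "H \<subseteq> cl (C \<union> (E \<union> G))"
  shows "rk C {w} \<le> d"
proof -
  have "rk C H \<le> rk C (E \<union> G)" using assms by (intro rk_le_cl) auto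
  then have "rk C {w} + (d + d + d) \<le> rk C {w} + rk C (E \<union> G)"
    using assms(8) by (intro add_left_mono) simp
  also have "\<dots> \<le> rk C E + rk C G" by (rule rk_submodular[OF assms(1-4)])
  also have "\<dots> \<le> (d + d) + (d + d)" by (intro add_mono assms)
  finally have "rk C {w} + d + d + d \<le> d + d + d + d" by (simp add: ac_simps)
  then show ?thesis by (simp only: d_cancel)
qed

text \<open>
  For \<open>\<xi>\<close> outside the quotient set the map \<open>(x, y) \<mapsto> x + \<xi> y\<close> is injective on \<open>P\<close>, so its
  values at generic pairs have dimension \<open>2 d\<close>. The following set collects the \<open>\<xi>\<close> at the
  other extreme; it will turn out to be the quotient set.
\<close>

definition K :: "'a set" where
  "K = {\<xi>. \<forall>x\<in>P. \<forall>y\<in>P. d + d \<le> rk (insert \<xi> A) {x, y} \<longrightarrow> rk (insert \<xi> A) {x + \<xi> * y} \<le> d}"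

section \<open>Dependence of \<open>K\<close> on the base\<close>

text \<open>Enlarging the base strengthens the independence hypothesis and weakens the bound, and a
  base whose closure contains \<xi> may be taken to contain \<xi>.\<close>

lemma K_bound:
  assumes "\<xi> \<in> K" "A \<subseteq> C" "\<xi> \<in> cl C" "x \<in> P" "y \<in> P" "d + d \<le> rk C {x, y}"
  shows "rk C {x + \<xi> * y} \<le> d"
proof -
  have eq: "rk (C \<union> {\<xi>}) E = rk C E" if "finite E" for E
    using assms(3) that by (intro rk_base_cl) auto
  have "insert \<xi> A \<subseteq> C \<union> {\<xi>}" using assms(2) by blast
  note anti = rk_antimono[OF this]
  have "rk C {x, y} \<le> rk (insert \<xi> A) {x, y}" using anti[of "{x, y}"] by (simp only: eq finite.intros)
  then have "d + d \<le> rk (insert \<xi> A) {x, y}" using assms(6) by simp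
  then have "rk (insert \<xi> A) {x + \<xi> * y} \<le> d" using assms(1,4,5) unfolding K_def by blast
  moreover have "rk C {x + \<xi> * y} \<le> rk (insert \<xi> A) {x + \<xi> * y}"
    using anti[of "{x + \<xi> * y}"] by (simp only: eq finite.intros)
  ultimately show ?thesis by simp
qed

text \<open>A pair independent over \<zeta> has a copy independent over \<open>C\<close>. The bound
  on its value \<open>w'\<close> holds over \<open>C\<close> and does not descend to the smaller
  base, but it leaves a fibre of rank at least \<open>d\<close>. Fibre ranks are type invariant and
  only grow over smaller bases, and a large fibre makes the value of the original pair
  small.\<close>

lemma KI:
  assumes C: "ext C" "\<zeta> \<in> cl C"
    and bound: "\<And>x y. x \<in> P \<Longrightarrow> y \<in> P \<Longrightarrow> d + d \<le> rk C {x, y} \<Longrightarrow> rk C {x + \<zeta> * y} \<le> d"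
  shows "\<zeta> \<in> K"
  unfolding K_def
proof (intro CollectI ballI impI)
  fix x y assume xy: "x \<in> P" "y \<in> P" "d + d \<le> rk (insert \<zeta> A) {x, y}"
  let ?B = "insert \<zeta> A" and ?C = "C \<union> {\<zeta>}" and ?w = "x + \<zeta> * y"
  have eq: "rk ?C E = rk C E" if "finite E" for E
    using C(2) that by (intro rk_base_cl) auto
  have BC: "?B \<subseteq> ?C" using ext_subset[OF C(1)] by blast
  have C': "|?C| <o \<kappa>" using ext_small[OF ext_Un[OF C(1), of "{\<zeta>}"]] by simp
  obtain zs where zs: "teq F ?B [x, y, ?w] zs" "rk ?B (set [x, y, ?w]) \<le> rk ?C (set zs)"
    using teq_extension[OF BC C'] .
  then obtain x' y' w' where zs': "zs = [x', y', w']"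
    using teq_length[OF zs(1)] by (auto simp: length_Suc_conv)
  have P: "x' \<in> P" "y' \<in> P" using P_cong[OF zs(1), of 0] P_cong[OF zs(1), of 1] xy zs' by auto
  have w': "w' = x' + \<zeta> * y'"
    using teq_eq[OF zs(1), of "\<lambda>xs. xs ! 2" "\<lambda>xs. xs ! 0 + \<zeta> * xs ! 1"] zs'
    by (simp add: term_fun_intros)
  have "rk ?C {w', x', y'} = rk ?C {x', y'}"
    using rk_Un_cl[of "{w'}" "{x', y'}" ?C] w' by (simp add: cl_intros insert_commute)
  then have "rk ?B {x, y, ?w} \<le> rk ?C {x', y'}" using zs(2) zs' by (simp add: insert_commute)
  moreover have "rk ?B {x, y} \<le> rk ?B {x, y, ?w}" by (rule rk_mono) auto
  ultimately have gen: "d + d \<le> rk ?C {x', y'}" using xy(3) by (meson order_trans)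
  then have w'_le: "rk ?C {w'} \<le> d" using bound[OF P] gen w' eq[of "{x', y'}"] eq[of "{w'}"] by simp
  have "teq F ?B ([x, y] @ [?w]) ([x', y'] @ [w'])" using zs(1) zs' by simp
  from rk_teq[OF this] have fiber: "rk (?B \<union> {w'}) {x', y'} = rk (?B \<union> {?w}) {x, y}" by simp
  let ?r = "rk (?B \<union> {?w}) {x, y}"
  have "rk ?C {x', y'} \<le> rk ?C ({x', y'} \<union> {w'})" by (rule rk_mono) auto
  also have "\<dots> = rk ?C {w'} + rk (?C \<union> {w'}) {x', y'}" by (rule rk_Un) auto
  also have "\<dots> \<le> d + ?r"
    unfolding fiber[symmetric] using w'_le BC by (intro add_mono rk_antimono) auto
  finally have "d + d \<le> d + ?r" using gen by (rule order_trans[rotated])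
  then have r: "d \<le> ?r" by (simp only: d_cancel_left)
  have w: "?w \<in> cl (?B \<union> {x, y})" by (intro cl_add cl_mult cl_base) auto
  have "rk ?B {?w} + ?r = rk ?B ({x, y} \<union> {?w})" by (rule rk_Un[symmetric]) auto
  also have "\<dots> = rk ?B ({?w} \<union> {x, y})" by (simp only: Un_commute)
  also have "\<dots> = rk ?B {x, y}" by (rule rk_Un_cl) (use w in auto)
  also have "\<dots> \<le> d + d" using rk_point_le[of ?B] xy by (intro rk_pair_le) auto
  finally have "rk ?B {?w} + d \<le> d + d" using r by (meson add_left_mono order_trans)
  then show "rk ?B {?w} \<le> d" by (simp only: d_cancel)
qed

text \<open>Homogeneity turns a test pair for \<open>\<xi>'\<close> into one for \<xi>; both ranks
  in the definition depend only on the joint type over \<open>A\<close>.\<close>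

lemma K_cong:
  assumes \<xi>: "teq F A [\<xi>] [\<xi>']" "\<xi> \<in> K"
  shows "\<xi>' \<in> K"
  unfolding K_def
proof (intro CollectI ballI impI)
  fix x y assume xy: "x \<in> P" "y \<in> P" "d + d \<le> rk (insert \<xi>' A) {x, y}"
  let ?w = "x + \<xi>' * y"
  obtain ys where ys: "teq F A ([x, y, ?w] @ [\<xi>']) (ys @ [\<xi>])" "length ys = length [x, y, ?w]"
    using teq_homogeneous[OF small teq_sym[OF \<xi>(1)]] .
  then obtain x' y' w' where ys': "ys = [x', y', w']" by (auto simp: length_Suc_conv)
  note t = ys(1)[unfolded ys', simplified]
  have P: "x' \<in> P" "y' \<in> P" using P_cong[OF t, of 0] P_cong[OF t, of 1] xy by auto
  have w': "w' = x' + \<xi> * y'"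
    using teq_eq[OF t, of "\<lambda>xs. xs ! 2" "\<lambda>xs. xs ! 0 + xs ! 3 * xs ! 1"]
    by (simp add: term_fun_intros)
  have "teq F A ([x, y] @ [\<xi>']) ([x', y'] @ [\<xi>])" using teq_coords[OF t, of "[0, 1, 3]"] by simp
  from rk_teq[OF this] have "rk (insert \<xi> A) {x', y'} = rk (insert \<xi>' A) {x, y}" by simp
  moreover have "teq F A ([?w] @ [\<xi>']) ([w'] @ [\<xi>])" using teq_coords[OF t, of "[2, 3]"] by simp
  from rk_teq[OF this] have "rk (insert \<xi> A) {w'} = rk (insert \<xi>' A) {?w}" by simp
  ultimately show "rk (insert \<xi>' A) {?w} \<le> d"
    using K_bound[OF \<xi>(2) _ cl_base P, of "insert \<xi> A"] xy(3) w' by auto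
qed

section \<open>Closure of \<open>K\<close> under the field operations\<close>

lemma K_zero: "0 \<in> K"
  by (rule KI[OF ext_A cl_0]) (use P_rk in simp)

lemma K_one: "1 \<in> K"
  by (rule KI[OF ext_A cl_1]) (use P_add in simp)

text \<open>For a third independent \<open>z\<close>,
  \<open>x - \<eta> * y = (x + z) - (z + \<eta> * y)\<close>, so the two values on the right form a
  second pair determining the left-hand side.\<close>

lemma K_uminus:
  assumes "\<eta> \<in> K"
  shows "- \<eta> \<in> K"
proof (rule KI[OF ext_insert[OF ext_A, of \<eta>]])
  let ?C = "insert \<eta> A"
  show "- \<eta> \<in> cl ?C" by (intro cl_intros) simp
  fix x y assume xy: "x \<in> P" "y \<in> P" "d + d \<le> rk ?C {x, y}"
  obtain z where z: "z \<in> P" "d \<le> rk (?C \<union> {x, y}) {z}"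
    using generic_point[OF ext_Un[OF ext_insert[OF ext_A]]] by (metis finite.emptyI finite_insert)
  have gen: "d + d + d \<le> rk ?C {x, y, z}" using xy(3) z(2) by (rule generic_tripleI)
  have le: "rk ?C {u} \<le> d" if "u \<in> P" for u using that by (intro rk_point_le) auto
  have xz: "d + d \<le> rk ?C {x, z}"
    using generic_triple_pair[of ?C x z y] gen le[OF xy(2)] by (simp add: insert_commute)
  have zy: "d + d \<le> rk ?C {z, y}"
    using generic_triple_pair[of ?C z y x] gen le[OF xy(1)] by (simp add: insert_commute)
  \<comment> \<open>The factor \<open>1\<close> presents \<open>x + z\<close> as a value with
    coefficient \<open>1\<close>, to which \<open>K_one\<close> applies.\<close>
  let ?p = "x + 1 * z" and ?q = "z + \<eta> * y"
  have p: "rk ?C {?p} \<le> d" by (rule K_bound[OF K_one _ cl_1 xy(1) z(1) xz]) auto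
  have q: "rk ?C {?q} \<le> d" by (rule K_bound[OF assms _ _ z(1) xy(2) zy]) (auto intro: cl_base)
  have "?p - ?q \<in> cl (?C \<union> {?p, ?q})" by (intro cl_diff cl_base) auto
  then have "x + - \<eta> * y \<in> cl (?C \<union> {?p, ?q})" by (simp add: algebra_simps)
  moreover have "x + - \<eta> * y \<in> cl (?C \<union> {x, y})"
    by (intro cl_add cl_mult cl_uminus cl_base) auto
  moreover have "?p - x \<in> cl (?C \<union> ({?p, ?q} \<union> {x, y}))" by (intro cl_diff cl_base) auto
  then have "{x, y, z} \<subseteq> cl (?C \<union> ({?p, ?q} \<union> {x, y}))" by (auto intro: cl_base)
  ultimately show "rk ?C {x + - \<eta> * y} \<le> d"
    using rk_pair_le[OF p q] rk_pair_le[OF le[OF xy(1)] le[OF xy(2)]] gen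
    by (intro submodular_bound[of "{?p, ?q}" "{x, y}" _ ?C "{x, y, z}"]) auto
qed

text \<open>With \<open>z\<close> independent, \<open>x + \<xi> * \<eta> * y = (x - \<xi> * z) +
  \<xi> * (z + \<eta> * y)\<close>.\<close>

lemma K_mult:
  assumes "\<xi> \<in> K" "\<eta> \<in> K"
  shows "\<xi> * \<eta> \<in> K"
proof (rule KI[OF ext_insert[OF ext_insert[OF ext_A]], of _ \<xi> \<eta>])
  let ?C = "insert \<xi> (insert \<eta> A)"
  show "\<xi> * \<eta> \<in> cl ?C" by (intro cl_intros) auto
  fix x y assume xy: "x \<in> P" "y \<in> P" "d + d \<le> rk ?C {x, y}"
  obtain z where z: "z \<in> P" "d \<le> rk (?C \<union> {x, y}) {z}"
    using generic_point[OF ext_Un[OF ext_insert[OF ext_insert[OF ext_A]]]]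
    by (metis finite.emptyI finite_insert)
  have gen: "d + d + d \<le> rk ?C {x, y, z}" using xy(3) z(2) by (rule generic_tripleI)
  have le: "rk ?C {u} \<le> d" if "u \<in> P" for u using that by (intro rk_point_le) auto
  have xz: "d + d \<le> rk ?C {x, z}"
    using generic_triple_pair[of ?C x z y] gen le[OF xy(2)] by (simp add: insert_commute)
  have zy: "d + d \<le> rk ?C {z, y}"
    using generic_triple_pair[of ?C z y x] gen le[OF xy(1)] by (simp add: insert_commute)
  let ?p = "x + - \<xi> * z" and ?q = "z + \<eta> * y"
  have "- \<xi> \<in> cl ?C" by (intro cl_uminus cl_base) simp
  then have p: "rk ?C {?p} \<le> d"
    by (intro K_bound[OF K_uminus[OF assms(1)] _ _ xy(1) z(1) xz]) auto
  have q: "rk ?C {?q} \<le> d" by (rule K_bound[OF assms(2) _ _ z(1) xy(2) zy]) (auto intro: cl_base)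
  have "?p + \<xi> * ?q \<in> cl (?C \<union> {?p, ?q})" by (intro cl_add cl_mult cl_base) auto
  then have "x + \<xi> * \<eta> * y \<in> cl (?C \<union> {?p, ?q})" by (simp add: algebra_simps)
  moreover have "x + \<xi> * \<eta> * y \<in> cl (?C \<union> {x, y})" by (intro cl_add cl_mult cl_base) auto
  moreover have "?q - \<eta> * y \<in> cl (?C \<union> ({?p, ?q} \<union> {x, y}))" by (intro cl_diff cl_mult cl_base) auto
  then have "{x, y, z} \<subseteq> cl (?C \<union> ({?p, ?q} \<union> {x, y}))" by (auto intro: cl_base)
  ultimately show "rk ?C {x + \<xi> * \<eta> * y} \<le> d"
    using rk_pair_le[OF p q] rk_pair_le[OF le[OF xy(1)] le[OF xy(2)]] gen
    by (intro submodular_bound[of "{?p, ?q}" "{x, y}" _ ?C "{x, y, z}"]) auto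
qed

text \<open>Up to the factor \<open>inverse \<xi>\<close>, which lies in the closure of the base,
  \<open>x + inverse \<xi> * y\<close> is the value \<open>y + \<xi> * x\<close> of the exchanged
  pair.\<close>

lemma K_inverse:
  assumes "\<xi> \<in> K"
  shows "inverse \<xi> \<in> K"
proof (cases "\<xi> = 0")
  case False
  show ?thesis
  proof (rule KI[OF ext_insert[OF ext_A, of \<xi>]])
    let ?C = "insert \<xi> A"
    show "inverse \<xi> \<in> cl ?C" by (intro cl_intros) simp
    fix x y assume xy: "x \<in> P" "y \<in> P" "d + d \<le> rk ?C {x, y}"
    then have "rk ?C {y + \<xi> * x} \<le> d"
      by (intro K_bound[OF assms]) (auto intro: cl_base simp: insert_commute)
    moreover have "inverse \<xi> * (y + \<xi> * x) \<in> cl (?C \<union> {y + \<xi> * x})" by (intro cl_mult cl_inverse cl_base) auto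
    then have "x + inverse \<xi> * y \<in> cl (?C \<union> {y + \<xi> * x})" using False by (simp add: field_simps)
    then have "rk ?C {x + inverse \<xi> * y} \<le> rk ?C {y + \<xi> * x}" by (intro rk_le_cl) auto
    ultimately show "rk ?C {x + inverse \<xi> * y} \<le> d" by simp
  qed
qed (simp add: K_zero)

text \<open>
  Two independent presentations \<open>x + \<xi> y = x' + \<xi> y'\<close> of the same element make \<open>x', y', y\<close>
  independent, which separates the two occurrences of \<open>y\<close> in \<open>x + \<xi> y + \<eta> y\<close>.
\<close>

lemma K_add:
  assumes "\<xi> \<in> K" "\<eta> \<in> K"
  shows "\<xi> + \<eta> \<in> K"
proof (rule KI[OF ext_insert[OF ext_insert[OF ext_A]], of _ \<xi> \<eta>])
  let ?C = "insert \<xi> (insert \<eta> A)"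
  show "\<xi> + \<eta> \<in> cl ?C" by (intro cl_intros) auto
  fix x y assume xy: "x \<in> P" "y \<in> P" "d + d \<le> rk ?C {x, y}"
  let ?s = "x + \<xi> * y"
  have C: "ext ?C" by (intro ext_insert ext_A)
  have le: "rk ?C {u} \<le> d" if "u \<in> P" for u using that by (intro rk_point_le) auto
  have s: "rk ?C {?s} \<le> d" by (rule K_bound[OF assms(1) _ _ xy]) (auto intro: cl_base)
  \<comment> \<open>The value \<open>?s\<close> has rank at most \<open>d\<close>, so its fibre has
    rank at least \<open>d\<close>, and a copy in that fibre independent of \<open>x, y\<close>
    contributes at least \<open>d\<close> more.\<close>
  obtain zs where zs: "teq F (?C \<union> {?s}) [x, y] zs"
    "rk (?C \<union> {?s}) (set [x, y]) \<le> rk (?C \<union> {?s} \<union> {x, y}) (set zs)"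
    using teq_extension[of "?C \<union> {?s}" "?C \<union> {?s} \<union> {x, y}" "[x, y]"]
      ext_small[OF ext_Un[OF ext_Un[OF C]], of "{?s}" "{x, y}"] by auto
  then obtain x' y' where zs': "zs = [x', y']" using teq_length[OF zs(1)] by (auto simp: length_Suc_conv)
  have P: "x' \<in> P" "y' \<in> P" using P_cong[OF zs(1), of 0] P_cong[OF zs(1), of 1] xy zs' by auto
  have s': "x' + \<xi> * y' = ?s"
    using teq_eq[OF zs(1), of "\<lambda>xs. xs ! 0 + \<xi> * xs ! 1" "\<lambda>xs. ?s"] zs'
    by (simp add: term_fun_intros)
  have "d + d \<le> rk ?C ({x, y} \<union> {?s})" using xy(3) rk_mono[of "{x, y}" "{x, y} \<union> {?s}" ?C] by simp
  also have "\<dots> = rk ?C {?s} + rk (?C \<union> {?s}) {x, y}" by (rule rk_Un) auto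
  also have "\<dots> \<le> d + rk (?C \<union> {?s}) {x, y}" using s by (rule add_right_mono)
  finally have "d \<le> rk (?C \<union> {?s}) {x, y}" by (simp only: d_cancel_left)
  also have "\<dots> \<le> rk (?C \<union> {?s} \<union> {x, y}) {x', y'}" using zs(2) zs' by simp
  also have "\<dots> \<le> rk (?C \<union> {x, y}) {x', y'}" by (rule rk_antimono) auto
  finally have "d + d + d \<le> rk ?C {x, y} + rk (?C \<union> {x, y}) {x', y'}" using xy(3) by (intro add_mono)
  also have "\<dots> = rk ?C ({x', y'} \<union> {x, y})" by (rule rk_Un[symmetric]) auto
  also have "\<dots> \<le> rk ?C {x', y', y}"
  proof (rule rk_le_cl)
    have "x' + \<xi> * y' - \<xi> * y \<in> cl (?C \<union> {x', y', y})" by (intro cl_intros) auto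
    then show "{x', y'} \<union> {x, y} \<subseteq> cl (?C \<union> {x', y', y})" unfolding s' by (auto intro: cl_base)
  qed auto
  finally have gen: "d + d + d \<le> rk ?C {x', y', y}" .
  have x'y: "d + d \<le> rk ?C {x', y}"
    using generic_triple_pair[of ?C x' y y'] gen le[OF P(2)] by (simp add: insert_commute)
  let ?q = "x' + \<eta> * y"
  have q: "rk ?C {?q} \<le> d" by (rule K_bound[OF assms(2) _ _ P(1) xy(2) x'y]) (auto intro: cl_base)
  \<comment> \<open>The target equals \<open>?s + \<eta> * y\<close> and also
    \<open>(x' + \<eta> * y) + \<xi> * y'\<close>, so it is determined by the pair
    \<open>y, ?s\<close> and by the pair \<open>y', ?q\<close>.\<close>
  have "?s + \<eta> * y \<in> cl (?C \<union> {y, ?s})" by (intro cl_add cl_mult cl_base) auto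
  then have w1: "x + (\<xi> + \<eta>) * y \<in> cl (?C \<union> {y, ?s})" by (simp add: algebra_simps)
  have "?q + \<xi> * y' \<in> cl (?C \<union> {y', ?q})" by (intro cl_add cl_mult cl_base) auto
  moreover have "?q + \<xi> * y' = x' + \<xi> * y' + \<eta> * y" by simp
  then have "?q + \<xi> * y' = x + (\<xi> + \<eta>) * y" unfolding s' by (simp add: algebra_simps)
  ultimately have w2: "x + (\<xi> + \<eta>) * y \<in> cl (?C \<union> {y', ?q})" by (simp only:)
  have "?q - \<eta> * y \<in> cl (?C \<union> ({y, ?s} \<union> {y', ?q}))" by (intro cl_diff cl_mult cl_base) auto
  then have "{x', y', y} \<subseteq> cl (?C \<union> ({y, ?s} \<union> {y', ?q}))" by (auto intro: cl_base)
  then show "rk ?C {x + (\<xi> + \<eta>) * y} \<le> d"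
    using w1 w2 rk_pair_le[OF le[OF xy(2)] s] rk_pair_le[OF le[OF P(2)] q] gen
    by (intro submodular_bound[of "{y, ?s}" "{y', ?q}" _ ?C "{x', y', y}"]) auto
qed

lemma K_diff: "\<xi> \<in> K \<Longrightarrow> \<eta> \<in> K \<Longrightarrow> \<xi> - \<eta> \<in> K"
  using K_add[OF _ K_uminus, of \<xi> \<eta>] by simp

lemma K_divide: "\<xi> \<in> K \<Longrightarrow> \<eta> \<in> K \<Longrightarrow> \<xi> / \<eta> \<in> K"
  unfolding divide_inverse by (intro K_mult K_inverse)

end

section \<open>Ratios of points of \<open>P\<close>\<close>

context generic_realizations
begin

text \<open>
  Two independent factorizations \<open>a b = a' b'\<close> give \<open>\<xi> = a' / a = b / b'\<close> such that \<open>P\<close> contains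
  \<open>u\<close> and \<open>v = \<xi> u\<close> with \<open>u\<close> generic; then \<open>x + \<xi> y = (x - v) + \<xi> (u + y)\<close>.
\<close>

lemma generic_ratio_in_K:
  assumes a: "a \<in> P"
  obtains x where "x \<in> P" "d \<le> rk (insert a A) {x}" "x / a \<in> K"
proof -
  obtain b where b: "b \<in> P" "d \<le> rk (insert a A) {b}"
    using generic_point[OF ext_insert[OF ext_A]] .
  let ?c = "a * b"
  let ?B = "insert ?c A"
  have leA: "rk A {u} \<le> d" if "u \<in> P" for u using that by (intro rk_point_le) auto
  have ab: "d + d \<le> rk A {a, b}" using P_rk[OF a] b(2) by (intro generic_pairI) auto
  \<comment> \<open>By the product hypothesis \<open>?c\<close> has rank at most \<open>d\<close>,
    so its factorization into \<open>a, b\<close> has rank at least \<open>d\<close> over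
    \<open>?c\<close>.\<close>
  have "d + d \<le> rk A ({a, b} \<union> {?c})" using ab rk_mono[of "{a, b}" "{a, b} \<union> {?c}" A] by simp
  also have "\<dots> = rk A {?c} + rk ?B {a, b}" using rk_Un[of "{a, b}" "{?c}" A] by simp
  also have "\<dots> \<le> d + rk ?B {a, b}" using P_mult[OF a b(1)] by (rule add_right_mono)
  finally have d_le: "d \<le> rk ?B {a, b}" by (simp only: d_cancel_left)
  obtain zs where zs: "teq F ?B [a, b] zs" "rk ?B (set [a, b]) \<le> rk (?B \<union> {a, b}) (set zs)"
    using teq_extension[of ?B "?B \<union> {a, b}" "[a, b]"]
      ext_small[OF ext_Un[OF ext_insert[OF ext_A]], of "{a, b}" ?c] by auto
  then obtain a' b' where zs': "zs = [a', b']" using teq_length[OF zs(1)] by (auto simp: length_Suc_conv)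
  have P: "a' \<in> P" "b' \<in> P" using P_cong[OF zs(1), of 0] P_cong[OF zs(1), of 1] a b zs' by auto
  have c': "a' * b' = a * b"
    using teq_eq[OF zs(1), of "\<lambda>xs. xs ! 0 * xs ! 1" "\<lambda>xs. ?c"] zs'
    by (simp add: term_fun_intros)
  have nz: "a \<noteq> 0" "b \<noteq> 0" "a' \<noteq> 0" "b' \<noteq> 0" using zero_notin_P a b(1) P by auto
  have "d \<le> rk (?B \<union> {a, b}) {a', b'}" using d_le zs(2) zs' by simp
  also have "\<dots> \<le> rk (A \<union> {a, b}) {a', b'}" by (rule rk_antimono) auto
  finally have "d + d + d \<le> rk A {a, b} + rk (A \<union> {a, b}) {a', b'}" using ab by (intro add_mono)
  also have "\<dots> = rk A ({a', b'} \<union> {a, b})" by (rule rk_Un[symmetric]) auto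
  \<comment> \<open>The relation \<open>a' * b' = a * b\<close> makes \<open>b\<close>
    redundant.\<close>
  also have "\<dots> \<le> rk A {a, a', b'}"
  proof (rule rk_le_cl)
    have "a' * b' / a \<in> cl (A \<union> {a, a', b'})" by (intro cl_divide cl_mult cl_base) auto
    then have "b \<in> cl (A \<union> {a, a', b'})" using c' nz(1) by simp
    then show "{a', b'} \<union> {a, b} \<subseteq> cl (A \<union> {a, a', b'})" by (auto intro: cl_base)
  qed auto
  finally have gen: "d + d + d \<le> rk A {a, a', b'}" .
  have "d + d \<le> rk A {a', a}"
    using generic_triple_pair[of A a' a b'] gen leA[OF P(2)] by (simp add: insert_commute)
  then have "d + d \<le> rk A {a} + rk (insert a A) {a'}" using rk_insert[of "{a}" A a'] by simp
  then have a'_gen: "d \<le> rk (insert a A) {a'}" unfolding P_rk[OF a] by (simp only: d_cancel_left)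
  let ?C = "A \<union> {a, a'}"
  have C: "ext ?C" by (intro ext_Un ext_A) auto
  have "d + d + d \<le> rk A {a, a'} + rk ?C {b'}"
    using gen rk_insert[of "{a, a'}" A b'] by (simp add: insert_commute)
  also have "\<dots> \<le> (d + d) + rk ?C {b'}" using leA a P(1) by (intro add_right_mono rk_pair_le) auto
  finally have b'_gen: "d \<le> rk ?C {b'}" by (simp only: add.assoc d_cancel_left)
  have "a' / a \<in> K"
  proof (rule KI[OF C])
    show "a' / a \<in> cl ?C" by (intro cl_divide cl_base) auto
    fix x y assume xy: "x \<in> P" "y \<in> P" "d + d \<le> rk ?C {x, y}"
    have le: "rk ?C {u} \<le> d" if "u \<in> P" for u using that by (intro rk_point_le) auto
    \<comment> \<open>Copying the pair \<open>b', b\<close> rather than a single point preserves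
      \<open>b * a = b' * a'\<close>, so the copy \<open>u, v\<close> satisfies
      \<open>v = a' / a * u\<close>, with \<open>u\<close> independent of
      \<open>x, y\<close>.\<close>
    obtain ws where ws: "teq F ?C [b', b] ws" "rk ?C (set [b', b]) \<le> rk (?C \<union> {x, y}) (set ws)"
      using teq_extension[of ?C "?C \<union> {x, y}" "[b', b]"] ext_small[OF ext_Un[OF C], of "{x, y}"] by auto
    then obtain u v where ws': "ws = [u, v]" using teq_length[OF ws(1)] by (auto simp: length_Suc_conv)
    have uv: "u \<in> P" "v \<in> P" using P_cong[OF ws(1), of 0] P_cong[OF ws(1), of 1] P b ws' by auto
    have va: "v * a = u * a'"
      using teq_eq[OF ws(1), of "\<lambda>xs. xs ! 1 * a" "\<lambda>xs. xs ! 0 * a'"] ws' c'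
      by (simp add: term_fun_intros mult.commute)
    then have v: "v = a' / a * u" and u: "u = v * a / a'" using nz by (auto simp: field_simps)
    have "rk ?C {b'} \<le> rk ?C {b', b}" by (rule rk_mono) auto
    also have "\<dots> \<le> rk (?C \<union> {x, y}) {u, v}" using ws(2) ws' by simp
    also have "\<dots> \<le> rk (?C \<union> {x, y}) {u}"
    proof (rule rk_le_cl)
      have "a' / a * u \<in> cl (?C \<union> {x, y} \<union> {u})" by (intro cl_divide cl_mult cl_base) auto
      then show "{u, v} \<subseteq> cl (?C \<union> {x, y} \<union> {u})" unfolding v[symmetric] by (auto intro: cl_base)
    qed auto
    finally have "d + d + d \<le> rk ?C {x, y, u}" using b'_gen xy(3) by (intro generic_tripleI) auto
    note gen' = this
    have "d + d \<le> rk ?C {x, u}"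
      using generic_triple_pair[of ?C x u y] gen' le[OF xy(2)] by (simp add: insert_commute)
    also have "\<dots> \<le> rk ?C {x, v}"
    proof (rule rk_le_cl)
      have "v * a / a' \<in> cl (?C \<union> {x, v})" by (intro cl_divide cl_mult cl_base) auto
      then show "{x, u} \<subseteq> cl (?C \<union> {x, v})" unfolding u[symmetric] by (auto intro: cl_base)
    qed auto
    finally have xv: "d + d \<le> rk ?C {x, v}" .
    have uy: "d + d \<le> rk ?C {u, y}"
      using generic_triple_pair[of ?C u y x] gen' le[OF xy(1)] by (simp add: insert_commute)
    let ?p = "x + - 1 * v" and ?q = "u + 1 * y"
    have p: "rk ?C {?p} \<le> d"
      by (rule K_bound[OF K_uminus[OF K_one] _ cl_uminus[OF cl_1] xy(1) uv(2) xv]) auto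
    have q: "rk ?C {?q} \<le> d" by (rule K_bound[OF K_one _ cl_1 uv(1) xy(2) uy]) auto
    have "?p + a' / a * ?q \<in> cl (?C \<union> {?p, ?q})" by (intro cl_add cl_mult cl_divide cl_base) auto
    moreover have "?p + a' / a * ?q = x + a' / a * y" unfolding v by (simp add: ring_distribs)
    ultimately have w: "x + a' / a * y \<in> cl (?C \<union> {?p, ?q})" by (simp only:)
    moreover have "x + a' / a * y \<in> cl (?C \<union> {x, y})" by (intro cl_add cl_mult cl_divide cl_base) auto
    moreover have "?q - y \<in> cl (?C \<union> ({?p, ?q} \<union> {x, y}))" by (intro cl_diff cl_base) auto
    then have "{x, y, u} \<subseteq> cl (?C \<union> ({?p, ?q} \<union> {x, y}))" by (auto intro: cl_base)
    ultimately show "rk ?C {x + a' / a * y} \<le> d"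
      using rk_pair_le[OF p q] rk_pair_le[OF le[OF xy(1)] le[OF xy(2)]] gen'
      by (intro submodular_bound[of "{?p, ?q}" "{x, y}" _ ?C "{x, y, u}"]) auto
  qed
  then show ?thesis using that P(1) a'_gen by blast
qed

text \<open>The quotient is adjoined as a further coordinate; homogeneity moves it along, and
  \<open>q * a = x'\<close> identifies its image.\<close>

lemma K_ratio_cong:
  assumes "teq F B [x] [x']" "insert a A \<subseteq> B" "a \<noteq> 0" "x / a \<in> K"
  shows "x' / a \<in> K"
proof -
  have "teq F (A \<union> set [a]) [x] [x']" using assms(1,2) by (auto intro: teq_mono)
  then have "teq F A [x, a] [x', a]" using teq_append_base by fastforce
  then obtain qs where qs: "teq F A ([x / a] @ [x, a]) (qs @ [x', a])" "length qs = length [x / a]"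
    by (rule teq_homogeneous[OF small])
  then obtain q where q: "qs = [q]" by (auto simp: length_Suc_conv)
  note t = qs(1)[unfolded q, simplified]
  have "q * a = x'"
    using teq_eq[OF t, of "\<lambda>xs. xs ! 0 * xs ! 2" "\<lambda>xs. xs ! 1"] assms(3) by (simp add: term_fun_intros)
  then have "q = x' / a" using assms(3) by (simp add: field_simps)
  moreover have "teq F A [x / a] [q]" using teq_coords[OF t, of "[0]"] by simp
  ultimately show ?thesis using K_cong assms(4) by blast
qed

text \<open>The point from \<open>generic_ratio_in_K\<close> is replaced by a copy independent over
  \<open>C\<close> with the same type over \<open>a\<close> and \<open>A\<close>.\<close>

lemma independent_ratio_in_K:
  assumes "a \<in> P" "ext C" "a \<in> C"
  obtains x where "x \<in> P" "d \<le> rk C {x}" "x / a \<in> K"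
proof -
  obtain x where x: "x \<in> P" "d \<le> rk (insert a A) {x}" "x / a \<in> K"
    using generic_ratio_in_K[OF assms(1)] .
  have "insert a A \<subseteq> C" using assms ext_subset by blast
  then obtain xs where xs: "teq F (insert a A) [x] xs" "rk (insert a A) (set [x]) \<le> rk C (set xs)"
    using teq_extension[OF _ ext_small[OF assms(2)]] by blast
  then obtain x' where x': "xs = [x']" using teq_length[OF xs(1)] by (auto simp: length_Suc_conv)
  have "a \<noteq> 0" using assms(1) zero_notin_P by blast
  then have "x' / a \<in> K" using K_ratio_cong[of "insert a A" x x' a] xs(1) x' x(3) by auto
  moreover have "x' \<in> P" using P_cong[OF xs(1), of 0] x' x(1) by auto
  moreover have "d \<le> rk C {x'}" using xs(2) x' x(2) by (auto intro: order_trans)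
  ultimately show ?thesis using that by blast
qed

text \<open>
  If \<open>a K\<close> and \<open>b K\<close> met only in \<open>0\<close>, then \<open>x \<in> a K\<close> and \<open>y \<in> b K\<close> would be determined by \<open>x + y\<close>.
\<close>

lemma ratio_in_K:
  assumes ab: "a \<in> P" "b \<in> P"
  shows "a / b \<in> K"
proof -
  let ?C = "A \<union> {a, b}"
  have C: "ext ?C" by (intro ext_Un ext_A) auto
  obtain x where x: "x \<in> P" "d \<le> rk ?C {x}" "x / a \<in> K"
    using independent_ratio_in_K[OF ab(1) C] by auto
  obtain y where y: "y \<in> P" "d \<le> rk (insert x ?C) {y}" "y / b \<in> K"
    using independent_ratio_in_K[OF ab(2) ext_insert[OF C, of x]] by auto
  let ?s = "x + y"
  have nz: "a \<noteq> 0" "b \<noteq> 0" using ab zero_notin_P by auto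
  have "d + d \<le> rk ?C {x, y}" using x(2) y(2) by (rule generic_pairI)
  also have "\<dots> \<le> rk ?C ({x, y} \<union> {?s})" by (rule rk_mono) auto
  also have "\<dots> = rk ?C {?s} + rk (?C \<union> {?s}) {x, y}" by (rule rk_Un) auto
  also have "\<dots> \<le> d + rk (?C \<union> {?s}) {x, y}"
    by (intro add_right_mono order_trans[OF rk_antimono P_add[OF x(1) y(1)]]) auto
  finally have "d \<le> rk (?C \<union> {?s}) {x, y}" by (simp only: d_cancel_left)
  then have "rk (?C \<union> {?s}) (set [x, y]) \<noteq> 0" using d_pos by auto
  then obtain zs where zs: "teq F (?C \<union> {?s}) [x, y] zs" "zs \<noteq> [x, y]"
    using teq_extension_neq[OF ext_small[OF ext_Un[OF C]]] by blast
  then obtain x' y' where zs': "zs = [x', y']" using teq_length[OF zs(1)] by (auto simp: length_Suc_conv)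
  have s': "x' + y' = ?s"
    using teq_eq[OF zs(1), of "\<lambda>xs. xs ! 0 + xs ! 1" "\<lambda>xs. ?s"] zs'
    by (simp add: term_fun_intros)
  have "teq F (?C \<union> {?s}) [x] [x']" "teq F (?C \<union> {?s}) [y] [y']"
    using teq_coords[OF zs(1), of "[0]"] teq_coords[OF zs(1), of "[1]"] zs' by auto
  then have K: "x' / a \<in> K" "y' / b \<in> K"
    using K_ratio_cong[of "?C \<union> {?s}"] nz x(3) y(3) by auto
  \<comment> \<open>Subtracting the two presentations of \<open>?s\<close> yields a common element
    of \<open>a K\<close> and \<open>b K\<close>, nonzero because the presentations differ.\<close>
  let ?t = "x' - x"
  have t: "?t = y - y'" using s' by (metis add_diff_cancel_left' add_diff_eq diff_add_cancel diff_diff_eq2)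
  have "?t \<noteq> 0" using zs(2) zs' t by auto
  have "?t / a \<in> K" using K_diff[OF K(1) x(3)] by (simp add: diff_divide_distrib)
  moreover have "?t / b \<in> K" using K_diff[OF y(3) K(2)] unfolding t by (simp add: diff_divide_distrib)
  ultimately have "(?t / b) / (?t / a) \<in> K" by (rule K_divide[rotated])
  then show ?thesis using \<open>?t \<noteq> 0\<close> nz by simp
qed

section \<open>Collisions and the quotient set\<close>

text \<open>The pair has rank at least \<open>2 d\<close> and its value at most \<open>d\<close>;
  the difference is left for the fibre.\<close>

lemma K_fiber:
  assumes "\<xi> \<in> K" "x \<in> P" "y \<in> P" "d + d \<le> rk (insert \<xi> A) {x, y}"
  shows "d \<le> rk (insert \<xi> A \<union> {x + \<xi> * y}) {x, y}"
proof -
  let ?C = "insert \<xi> A" and ?w = "x + \<xi> * y"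
  have "d + d \<le> rk ?C ({x, y} \<union> {?w})" using assms(4) rk_mono[of "{x, y}" "{x, y} \<union> {?w}" ?C] by simp
  also have "\<dots> = rk ?C {?w} + rk (?C \<union> {?w}) {x, y}" by (rule rk_Un) auto
  also have "\<dots> \<le> d + rk (?C \<union> {?w}) {x, y}"
    by (rule add_right_mono) (use assms in \<open>simp add: K_def\<close>)
  finally show ?thesis by (simp only: d_cancel_left)
qed

text \<open>A fibre of positive rank contains a second pair with the same value, and equality of the
  two values determines \<xi>; here \<open>y' = y\<close> would force \<open>x' = x\<close>. The
  rank estimate is kept for the incidence count in \<open>dim_K\<close>.\<close>

lemma collision:
  assumes xy: "x \<in> P" "y \<in> P" and nz: "rk (insert \<xi> A \<union> {x + \<xi> * y}) {x, y} \<noteq> 0"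
  obtains x' y' where "x' \<in> P" "y' \<in> P" "y' - y \<noteq> 0" "\<xi> = (x - x') / (y' - y)"
    "rk (insert \<xi> A \<union> {x + \<xi> * y}) {x, y} \<le> rk (insert \<xi> A \<union> {x, y}) {x', y'}"
proof -
  let ?C = "insert \<xi> A" and ?w = "x + \<xi> * y"
  have C: "ext ?C" by (intro ext_insert ext_A)
  have "rk (?C \<union> {?w}) (set [x, y]) \<noteq> 0" using nz by simp
  then obtain zs where zs: "teq F (?C \<union> {?w}) [x, y] zs"
    "rk (?C \<union> {?w}) (set [x, y]) \<le> rk (?C \<union> {?w} \<union> set [x, y]) (set zs)" "zs \<noteq> [x, y]"
    using teq_extension_neq[OF ext_small[OF ext_Un[OF C]]] by blast
  then obtain x' y' where zs': "zs = [x', y']" using teq_length[OF zs(1)] by (auto simp: length_Suc_conv)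
  have P: "x' \<in> P" "y' \<in> P" using P_cong[OF zs(1), of 0] P_cong[OF zs(1), of 1] xy zs' by auto
  have w': "x' + \<xi> * y' = ?w"
    using teq_eq[OF zs(1), of "\<lambda>xs. xs ! 0 + \<xi> * xs ! 1" "\<lambda>xs. ?w"] zs'
    by (simp add: term_fun_intros)
  then have "y' \<noteq> y" using zs(3) zs' by auto
  moreover have "\<xi> * (y' - y) = x - x'" using w' by (simp add: algebra_simps)
  ultimately have \<xi>: "\<xi> = (x - x') / (y' - y)" by (simp add: field_simps)
  have "rk (?C \<union> {?w}) {x, y} \<le> rk (?C \<union> {?w} \<union> {x, y}) {x', y'}" using zs(2) zs' by simp
  also have "\<dots> \<le> rk (?C \<union> {x, y}) {x', y'}" by (rule rk_antimono) auto
  finally show ?thesis by (rule that[OF P _ \<xi>, rotated]) (use \<open>y' \<noteq> y\<close> in simp)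
qed

lemma collision_quot_set:
  assumes "x \<in> P" "y \<in> P" "rk (insert \<xi> A \<union> {x + \<xi> * y}) {x, y} \<noteq> 0"
  shows "\<xi> \<in> quot_set (diff_set P P) (diff_set P P)"
proof -
  obtain x' y' where "x' \<in> P" "y' \<in> P" "y' - y \<noteq> 0" "\<xi> = (x - x') / (y' - y)"
    using collision[OF assms] .
  then show ?thesis using assms(1,2) unfolding quot_set_def diff_set_def by blast
qed

lemma K_eq: "K = quot_set (diff_set P P) (diff_set P P)"
proof
  show "quot_set (diff_set P P) (diff_set P P) \<subseteq> K"
  proof
    fix \<xi> assume "\<xi> \<in> quot_set (diff_set P P) (diff_set P P)"
    then obtain a b c e where P: "a \<in> P" "b \<in> P" "c \<in> P" "e \<in> P" and \<xi>: "\<xi> = (a - b) / (c - e)"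
      unfolding quot_set_def diff_set_def by blast
    have "e \<noteq> 0" using P zero_notin_P by blast
    \<comment> \<open>Dividing by \<open>e\<close> turns each of the four points into a ratio of
      points of \<open>P\<close>.\<close>
    then have "\<xi> = (a / e - b / e) / (c / e - e / e)"
      unfolding \<xi> diff_divide_distrib[symmetric] by simp
    also have "\<dots> \<in> K"
      by (rule K_divide[OF K_diff[OF ratio_in_K ratio_in_K] K_diff[OF ratio_in_K ratio_in_K]]) fact+
    finally show "\<xi> \<in> K" .
  qed
  show "K \<subseteq> quot_set (diff_set P P) (diff_set P P)"
  proof
    fix \<xi> assume \<xi>: "\<xi> \<in> K"
    obtain x y where xy: "x \<in> P" "y \<in> P" "d + d \<le> rk (insert \<xi> A) {x, y}"
      using generic_pair[OF ext_insert[OF ext_A]] .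
    have "rk (insert \<xi> A \<union> {x + \<xi> * y}) {x, y} \<noteq> 0" using K_fiber[OF \<xi> xy] d_pos by auto
    then show "\<xi> \<in> quot_set (diff_set P P) (diff_set P P)" by (rule collision_quot_set[OF xy(1,2)])
  qed
qed

lemma is_subfield_K: "is_subfield K"
  unfolding is_subfield_def by (simp add: K_zero K_one K_add K_mult K_uminus K_inverse)

section \<open>Definability and dimension of \<open>K\<close>\<close>

text \<open>By \<open>dm_open\<close> the complementary condition, rank below \<open>t\<close>, is
  open.\<close>

lemma type_definable_rk_ge:
  "type_definable B (n + m) {zs. \<exists>xs ys. zs = xs @ ys \<and> length xs = n \<and> length ys = m \<and>
     t \<le> rk (B \<union> set ys) (set xs)}" (is "type_definable B _ ?U")
proof (rule type_definableI)
  fix zs assume zs: "length zs = n + m" "zs \<notin> ?U"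
  let ?xs = "take n zs" and ?ys = "drop n zs"
  have len: "length ?xs = n" "length ?ys = m" using zs(1) by auto
  have "zs = ?xs @ ?ys" by simp
  then have "dm (B \<union> set ?ys) ?xs < t" using zs(2) len by (auto simp: rk_set not_le)
  then obtain S where S: "definable F B (length ?xs + length ?ys) S" "?xs @ ?ys \<in> S"
    "\<And>xs' ys'. length xs' = length ?xs \<Longrightarrow> xs' @ ys' \<in> S \<Longrightarrow> \<delta> {zs. zs @ ys' \<in> S} < t"
    by (rule dm_open) blast
  have "S \<inter> ?U = {}"
  proof (rule ccontr)
    assume "S \<inter> ?U \<noteq> {}"
    then obtain xs ys where *: "xs @ ys \<in> S" "length xs = n" "length ys = m"
      "t \<le> rk (B \<union> set ys) (set xs)" by blast
    have "dm (B \<union> set ys) xs \<le> \<delta> {zs. zs @ ys \<in> S}"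
      using S(1) * len by (intro dm_le definable_fiber) auto
    also have "\<dots> < t" using S(3) * len by simp
    finally show False using *(4) by (simp add: rk_set)
  qed
  then show "\<exists>S. definable F B (n + m) S \<and> zs \<in> S \<and> S \<inter> ?U = {}" using S(1,2) len by auto
qed

lemma type_definable_P_coord:
  assumes "i < n"
  shows "type_definable A n {xs. length xs = n \<and> xs ! i \<in> P}"
proof -
  have "type_definable A n {xs. length xs = n \<and> map ((!) xs) [i] \<in> tuples1 P}"
    by (rule type_definable_vimage_coords) (use P_type_definable assms in auto)
  moreover have "map ((!) xs) [i] \<in> tuples1 P \<longleftrightarrow> xs ! i \<in> P" for xs by (auto simp: tuples1_def)
  ultimately show ?thesis by simp
qed

text \<open>The coordinates are \<xi> followed by \<open>a, b, c, e\<close>, and the equation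
  \<open>\<xi> = (a - b) / (c - e)\<close> is cleared of its denominator before projecting.\<close>

lemma type_definable_K: "type_definable A 1 (tuples1 K)"
proof -
  let ?V = "\<lambda>i. {zs. length zs = (5::nat) \<and> zs ! i \<in> P}"
  let ?E = "{zs. length zs = 5 \<and> zs ! 0 * (zs ! 3 - zs ! 4) = zs ! 1 - zs ! 2}"
  let ?D = "{zs. length zs = 5} - {zs. length zs = 5 \<and> zs ! 3 = zs ! 4}"
  let ?U = "?V 1 \<inter> ?V 2 \<inter> ?V 3 \<inter> ?V 4 \<inter> ?E \<inter> ?D"
  have "type_definable A 5 ?U"
    by (intro type_definable_Int type_definable_P_coord type_definable_definable definable_Diff
        definable_eq term_fun_intros) auto
  then have "type_definable A 1 {xs. \<exists>ys. length ys = 4 \<and> xs @ ys \<in> ?U}"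
    using type_definable_proj[OF small, of 1 4 ?U] by simp
  also have "{xs. \<exists>ys. length ys = 4 \<and> xs @ ys \<in> ?U} = tuples1 K"
  proof (intro set_eqI iffI)
    fix xs assume "xs \<in> {xs. \<exists>ys. length ys = 4 \<and> xs @ ys \<in> ?U}"
    then obtain ys where ys: "length ys = 4" "xs @ ys \<in> ?U" by blast
    then have "length xs = 1" by auto
    then obtain \<xi> where \<xi>: "xs = [\<xi>]" by (auto simp: length_Suc_conv)
    obtain a b c e where abce: "ys = [a, b, c, e]" using ys(1) by (auto simp: numeral_eq_Suc length_Suc_conv)
    have *: "a \<in> P" "b \<in> P" "c \<in> P" "e \<in> P" "\<xi> * (c - e) = a - b" "c \<noteq> e"
      using ys(2) unfolding \<xi> abce by auto
    then have "\<xi> = (a - b) / (c - e)" by (simp add: field_simps)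
    then have "\<xi> \<in> K" using * unfolding K_eq quot_set_def diff_set_def by force
    then show "xs \<in> tuples1 K" unfolding \<xi> tuples1_def by simp
  next
    fix xs assume "xs \<in> tuples1 K"
    then obtain \<xi> where \<xi>: "xs = [\<xi>]" "\<xi> \<in> K" unfolding tuples1_def by blast
    then obtain a b c e where *: "a \<in> P" "b \<in> P" "c \<in> P" "e \<in> P" "c - e \<noteq> 0" "\<xi> = (a - b) / (c - e)"
      unfolding K_eq quot_set_def diff_set_def by blast
    then have "xs @ [a, b, c, e] \<in> ?U" unfolding \<xi>(1) by auto
    then show "xs \<in> {xs. \<exists>ys. length ys = 4 \<and> xs @ ys \<in> ?U}"
      by (intro CollectI exI[of _ "[a, b, c, e]"]) simp
  qed
  finally show ?thesis .
qed

text \<open>A value of rank at least \<open>2 d\<close> forces its pair to be independent, so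
  independence is not stated separately. In this existential form the complement of \<open>K\<close>
  is the projection of a closed condition.\<close>

lemma notin_K_iff:
  "\<xi> \<notin> K \<longleftrightarrow> (\<exists>x\<in>P. \<exists>y\<in>P. d + d \<le> rk (insert \<xi> A) {x + \<xi> * y})"
proof
  let ?C = "insert \<xi> A"
  have C: "ext ?C" by (intro ext_insert ext_A)
  have dd: "\<not> d + d \<le> d" using d_cancel[of d 0] d_pos by simp
  {
    assume \<xi>: "\<xi> \<notin> K"
    obtain x y where xy: "x \<in> P" "y \<in> P" "d + d \<le> rk ?C {x, y}" using generic_pair[OF C] .
    let ?w = "x + \<xi> * y"
    have "rk (?C \<union> {?w}) {x, y} = 0" using collision_quot_set[OF xy(1,2)] \<xi> K_eq by blast
    then have "rk ?C ({x, y} \<union> {?w}) = rk ?C {?w}" using rk_Un[of "{x, y}" "{?w}" ?C] by simp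
    then have "d + d \<le> rk ?C {?w}" using xy(3) rk_mono[of "{x, y}" "{x, y} \<union> {?w}" ?C] by simp
    then show "\<exists>x\<in>P. \<exists>y\<in>P. d + d \<le> rk ?C {x + \<xi> * y}" using xy by blast
  }
  assume "\<exists>x\<in>P. \<exists>y\<in>P. d + d \<le> rk ?C {x + \<xi> * y}"
  then obtain x y where xy: "x \<in> P" "y \<in> P" "d + d \<le> rk ?C {x + \<xi> * y}" by blast
  have "x + \<xi> * y \<in> cl (?C \<union> {x, y})" by (intro cl_add cl_mult cl_base) auto
  then have "rk ?C {x + \<xi> * y} \<le> rk ?C {x, y}" by (intro rk_le_cl) auto
  then have "d + d \<le> rk ?C {x, y}" using xy(3) by (rule order_trans[rotated])
  then have "rk ?C {x + \<xi> * y} \<le> d" if "\<xi> \<in> K" using that xy(1,2) unfolding K_def by blast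
  then show "\<xi> \<notin> K" using dd order_trans[OF xy(3)] by blast
qed

lemma type_definable_compl_K: "type_definable A 1 ({xs. length xs = 1} - tuples1 K)"
proof -
  let ?V = "\<lambda>i. {zs. length zs = (4::nat) \<and> zs ! i \<in> P}"
  let ?E = "{zs. length zs = 4 \<and> zs ! 3 = zs ! 1 + zs ! 0 * zs ! 2}"
  define R where "R = {zs. \<exists>xs ys. zs = xs @ ys \<and> length xs = 1 \<and> length ys = 1 \<and>
     d + d \<le> rk (A \<union> set ys) (set xs)}"
  have R_iff: "[w, \<xi>] \<in> R \<longleftrightarrow> d + d \<le> rk (insert \<xi> A) {w}" for w \<xi>
  proof
    assume "[w, \<xi>] \<in> R"
    then show "d + d \<le> rk (insert \<xi> A) {w}" unfolding R_def by (auto simp: length_Suc_conv)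
  next
    assume "d + d \<le> rk (insert \<xi> A) {w}"
    then show "[w, \<xi>] \<in> R" unfolding R_def by (intro CollectI exI[of _ "[w]"] exI[of _ "[\<xi>]"]) simp
  qed
  \<comment> \<open>The coordinates are \<xi>, \<open>x\<close>, \<open>y\<close>, \<open>w\<close>,
    while \<open>R\<close> expects the value before the parameter; hence the selection
    \<open>[3, 0]\<close>.\<close>
  let ?U = "?V 1 \<inter> ?V 2 \<inter> ?E \<inter> {zs. length zs = 4 \<and> map ((!) zs) [3, 0] \<in> R}"
  have "type_definable A (length [3::nat, 0]) R" using type_definable_rk_ge[of A 1 1 "d + d"] unfolding R_def by simp
  then have "type_definable A 4 {zs. length zs = 4 \<and> map ((!) zs) [3, 0] \<in> R}"
    by (rule type_definable_vimage_coords) simp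
  moreover have "type_definable A 4 (?V 1 \<inter> ?V 2 \<inter> ?E)"
    by (intro type_definable_Int type_definable_P_coord type_definable_definable
        definable_eq term_fun_intros) auto
  ultimately have "type_definable A 4 ?U" by (intro type_definable_Int[of A 4 "?V 1 \<inter> ?V 2 \<inter> ?E"])
  then have "type_definable A 1 {xs. \<exists>ys. length ys = 3 \<and> xs @ ys \<in> ?U}"
    using type_definable_proj[OF small, of 1 3 ?U] by simp
  also have "{xs. \<exists>ys. length ys = 3 \<and> xs @ ys \<in> ?U} = {xs. length xs = 1} - tuples1 K"
  proof (intro set_eqI iffI)
    fix xs assume "xs \<in> {xs. \<exists>ys. length ys = 3 \<and> xs @ ys \<in> ?U}"
    then obtain ys where ys: "length ys = 3" "xs @ ys \<in> ?U" by blast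
    then have "length xs = 1" by auto
    then obtain \<xi> where \<xi>: "xs = [\<xi>]" by (auto simp: length_Suc_conv)
    obtain x y w where xyw: "ys = [x, y, w]" using ys(1) by (auto simp: numeral_eq_Suc length_Suc_conv)
    have U: "[\<xi>, x, y, w] \<in> ?U" using ys(2) unfolding \<xi> xyw by (simp only: append.simps)
    then have "x \<in> P" "y \<in> P" "w = x + \<xi> * y" by auto
    moreover have "[w, \<xi>] \<in> R" using U by auto
    then have "d + d \<le> rk (insert \<xi> A) {w}" unfolding R_iff .
    ultimately have "\<xi> \<notin> K" unfolding notin_K_iff by blast
    then show "xs \<in> {xs. length xs = 1} - tuples1 K" unfolding \<xi> tuples1_def by auto
  next
    fix xs assume xs: "xs \<in> {xs. length xs = 1} - tuples1 K"
    then obtain \<xi> where \<xi>: "xs = [\<xi>]" by (auto simp: length_Suc_conv)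
    then have "\<xi> \<notin> K" using xs unfolding tuples1_def by blast
    then obtain x y where xy: "x \<in> P" "y \<in> P" "d + d \<le> rk (insert \<xi> A) {x + \<xi> * y}"
      unfolding notin_K_iff by blast
    have "[x + \<xi> * y, \<xi>] \<in> R" using xy(3) unfolding R_iff .
    then have "xs @ [x, y, x + \<xi> * y] \<in> ?U" using xy unfolding \<xi> by simp
    then show "xs \<in> {xs. \<exists>ys. length ys = 3 \<and> xs @ ys \<in> ?U}"
      by (intro CollectI exI[of _ "[x, y, x + \<xi> * y]"] conjI, simp)
  qed
  finally show ?thesis .
qed

lemma definable_K: "definable F A 1 (tuples1 K)"
  by (rule definable_if_type_definable[OF small _ type_definable_K type_definable_compl_K])
    (auto simp: tuples1_def)

text \<open>
  Upper bound by counting incidences: two generic points on a line of slope \<open>\<xi>\<close> have dimension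
  \<open>3 d\<close> over \<open>\<xi>\<close>, and they determine \<open>\<xi>\<close>.
\<close>

lemma dim_K: "\<delta> (tuples1 K) = d"
proof (rule antisym)
  have "tuples1 K \<noteq> {}" using K_zero by (auto simp: tuples1_def)
  then obtain xs where xs: "xs \<in> tuples1 K" "rk A (set xs) = \<delta> (tuples1 K)"
    using rk_attained[OF small definable_K] by blast
  then obtain \<xi> where \<xi>: "\<xi> \<in> K" "rk A {\<xi>} = \<delta> (tuples1 K)" by (auto simp: tuples1_def)
  let ?C = "insert \<xi> A"
  have C: "ext ?C" by (intro ext_insert ext_A)
  obtain x y where xy: "x \<in> P" "y \<in> P" "d + d \<le> rk ?C {x, y}" using generic_pair[OF C] .
  let ?w = "x + \<xi> * y"
  have d_le: "d \<le> rk (?C \<union> {?w}) {x, y}" by (rule K_fiber[OF \<xi>(1) xy])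
  then have "rk (?C \<union> {?w}) {x, y} \<noteq> 0" using d_pos by auto
  then obtain x' y' where P: "x' \<in> P" "y' \<in> P" and \<xi>_eq: "\<xi> = (x - x') / (y' - y)"
    and le: "rk (?C \<union> {?w}) {x, y} \<le> rk (?C \<union> {x, y}) {x', y'}"
    by (rule collision[OF xy(1,2)])
  note d_le
  also note le
  finally have "d + d + d \<le> rk ?C {x, y} + rk (?C \<union> {x, y}) {x', y'}" using xy(3) by (intro add_mono)
  also have "\<dots> = rk ?C ({x', y'} \<union> {x, y})" by (rule rk_Un[symmetric]) auto
  finally have "rk A {\<xi>} + (d + d + d) \<le> rk A {\<xi>} + rk ?C ({x', y'} \<union> {x, y})" by (rule add_left_mono)
  also have "\<dots> = rk A (({x', y'} \<union> {x, y}) \<union> {\<xi>})"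
    using rk_Un[of "{x', y'} \<union> {x, y}" "{\<xi>}" A] by simp
  also have "\<dots> \<le> rk A ({x', y'} \<union> {x, y})"
  proof (rule rk_le_cl)
    have "(x - x') / (y' - y) \<in> cl (A \<union> ({x', y'} \<union> {x, y}))"
      by (intro cl_divide cl_diff cl_base) auto
    then show "({x', y'} \<union> {x, y}) \<union> {\<xi>} \<subseteq> cl (A \<union> ({x', y'} \<union> {x, y}))"
      unfolding \<xi>_eq by (auto intro: cl_base)
  qed auto
  also have "\<dots> \<le> rk A {x', y'} + rk A {x, y}" by (rule rk_Un_le) auto
  also have "\<dots> \<le> (d + d) + (d + d)" using rk_point_le[of A] P xy by (intro add_mono rk_pair_le) auto
  finally have "rk A {\<xi>} + d + d + d \<le> d + d + d + d" by (simp only: ac_simps)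
  then have "rk A {\<xi>} \<le> d" by (simp only: d_cancel)
  then show "\<delta> (tuples1 K) \<le> d" using \<xi>(2) by simp
next
  \<comment> \<open>For fixed independent \<open>a\<close> and \<open>b\<close>, the map sending
    \<open>x\<close> to \<open>(x - a) / (b - a)\<close> embeds \<open>P\<close> into
    \<open>K\<close>, which gives the lower bound.\<close>
  obtain a where a: "a \<in> P" using P_nonempty by blast
  obtain b where b: "b \<in> P" "d \<le> rk (insert a A) {b}" using generic_point[OF ext_insert[OF ext_A]] .
  let ?C = "A \<union> {a, b}"
  have "a \<noteq> b"
  proof
    assume "a = b"
    then have "b \<in> cl (insert a A)" by (simp add: cl_base)
    then show False using b(2) d_pos by (simp add: cl_def)
  qed
  have "ext ?C" by (intro ext_Un ext_A) auto
  then obtain x where x: "x \<in> P" "d \<le> rk ?C {x}" by (rule generic_point)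
  let ?q = "(x - a) / (b - a)"
  have "?q \<in> K" using a b x \<open>a \<noteq> b\<close> unfolding K_eq quot_set_def diff_set_def by force
  have "?q * (b - a) + a \<in> cl (?C \<union> {?q})" by (intro cl_add cl_mult cl_diff cl_base) auto
  then have "x \<in> cl (?C \<union> {?q})" using \<open>a \<noteq> b\<close> by simp
  then have "rk ?C {x} \<le> rk ?C {?q}" by (intro rk_le_cl) auto
  then have "d \<le> dm ?C [?q]" using x(2) rk_set[of ?C "[?q]"] by simp
  also have "\<dots> \<le> \<delta> (tuples1 K)"
    using \<open>?q \<in> K\<close> definable_mono[OF definable_K, of ?C] by (intro dm_le) (auto simp: tuples1_def)
  finally show "d \<le> \<delta> (tuples1 K)" .
qed

end

section \<open>From the generic type to its set of realizations\<close>

theorem theorem6p6: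
  fixes F :: "('a::field, 'f, 'r) struc"
    and \<delta> :: "'a list set \<Rightarrow> ennreal"
    and \<kappa> :: "'k rel"
    and A X :: "'a set"
    and \<Gamma> p :: "('f, 'r, 'a) fm set"
  assumes "expands_field F"
    and "sufficiently_saturated \<kappa> F"
    and "is_dimension F \<delta>"
    and "|A| <o \<kappa>"
    and "partial_type F A 1 \<Gamma>"
    and "X = points F \<Gamma>"
    and "0 < type_dim F \<delta> 1 (tuples1 (X + X))"
    and "type_dim F \<delta> 1 (tuples1 (X + X)) = type_dim F \<delta> 1 (tuples1 (X * X))"
    and "type_dim F \<delta> 1 (tuples1 (X * X)) = type_dim F \<delta> 1 (tuples1 X)"
    and "type_dim F \<delta> 1 (tuples1 X) < \<infinity>"
    and "generic_type F \<delta> A 1 \<Gamma> p"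
  shows "let P = points F p; K = quot_set (diff_set P P) (diff_set P P)
         in definable F UNIV 1 (tuples1 K) \<and> is_subfield K \<and>
            \<delta> (tuples1 K) = type_dim F \<delta> 1 (tuples1 X)"
proof -
  interpret field_dimension F \<delta> \<kappa>
    using assms(1-3) by unfold_locales
  define P where "P = points F p"
  define d where "d = type_dim F \<delta> 1 (tuples1 X)"
  have ct: "complete_type F A 1 p" and \<Gamma>p: "\<Gamma> \<subseteq> p"
    and dim_p: "type_dim F \<delta> 1 (realizations F 1 p) = type_dim F \<delta> 1 (realizations F 1 \<Gamma>)"
    using assms(11) unfolding generic_type_def by auto
  have pt: "partial_type F A 1 p" and p_formulas: "p \<subseteq> formulas 1 A"
    using ct unfolding complete_type_def partial_type_def by auto
  have tuples_points: "tuples1 (points F \<Delta>) = realizations F 1 \<Delta>" for \<Delta> :: "('f, 'r, 'a) fm set"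
    by (auto simp: tuples1_def points_def realizations_def length_Suc_conv)
  have dim_P: "type_dim F \<delta> 1 (tuples1 P) = d"
    unfolding P_def d_def assms(6) tuples_points by (rule dim_p)
  \<comment> \<open>Formulas in \<open>type_dim\<close> may have parameters outside
    \<open>A\<close>. A copy of \<open>xs\<close> independent over these parameters still lies in
    \<open>U\<close> and shows that they cannot lower the infimum below
    \<open>dm A xs\<close>.\<close>
  have type_le: "dm A xs \<le> type_dim F \<delta> 1 U"
    if "length xs = 1" and U: "\<And>ys. teq F A xs ys \<Longrightarrow> ys \<in> U" for xs U
    unfolding type_dim_def
  proof (rule INF_greatest)
    fix \<phi> :: "('f, 'r, 'a) fm" assume \<phi>: "\<phi> \<in> {\<phi> \<in> formulas 1 UNIV. U \<subseteq> solutions F 1 \<phi>}"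
    let ?C = "A \<union> params \<phi>"
    have "|?C| <o \<kappa>" by (rule small_Un_finite[OF assms(4) finite_params])
    then obtain ys where ys: "teq F A xs ys" "rk A (set xs) \<le> rk ?C (set ys)"
      using teq_extension[of A ?C xs] by auto
    have "definable F ?C 1 (solutions F 1 \<phi>)"
      using \<phi> unfolding definable_def formulas_def by auto
    moreover have "ys \<in> solutions F 1 \<phi>" using \<phi> U[OF ys(1)] by blast
    moreover have "length ys = 1" using teq_length[OF ys(1)] that(1) by simp
    ultimately have "dm ?C ys \<le> \<delta> (solutions F 1 \<phi>)" by (intro dm_le) auto
    then show "dm A xs \<le> \<delta> (solutions F 1 \<phi>)" using ys(2) by (simp add: rk_set)
  qed
  have realizations_teq: "ys \<in> realizations F 1 \<Delta>"
    if "\<Delta> \<subseteq> formulas 1 A" "xs \<in> realizations F 1 \<Delta>" "teq F A xs ys" for \<Delta> :: "('f, 'r, 'a) fm set" and xs ys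
  proof -
    have "length ys = 1" using that(2) teq_length[OF that(3)] by (simp add: realizations_def)
    moreover have "holds F \<phi> ys" if \<phi>: "\<phi> \<in> \<Delta>" for \<phi>
    proof -
      have "definable F A (length xs) (solutions F 1 \<phi>)"
        using \<phi> \<open>\<Delta> \<subseteq> formulas 1 A\<close> \<open>xs \<in> realizations F 1 \<Delta>\<close> unfolding definable_def
        by (auto simp: realizations_def)
      from teqD[OF \<open>teq F A xs ys\<close> this] show ?thesis
        using \<phi> \<open>xs \<in> realizations F 1 \<Delta>\<close> by (auto simp: realizations_def solutions_def)
    qed
    ultimately show ?thesis by (simp add: realizations_def)
  qed
  have \<Gamma>_formulas: "\<Gamma> \<subseteq> formulas 1 A" using assms(5) unfolding partial_type_def by blast
  have X_cong: "y \<in> X" if "x \<in> X" "teq F A [x] [y]" for x y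
    using realizations_teq[OF \<Gamma>_formulas _ that(2)] that(1) unfolding assms(6) points_def by simp
  \<comment> \<open>A conjugate of \<open>f x y\<close> over \<open>A\<close> is again a value of
    \<open>f\<close> on \<open>X\<close>, because homogeneity supplies conjugates of
    \<open>x\<close> and \<open>y\<close>. The arity \<open>3\<close> belongs to the tuple of both
    arguments and the value.\<close>
  have binary_le: "rk A {f x y} \<le> type_dim F \<delta> 1 (tuples1 {f x y | x y. x \<in> X \<and> y \<in> X})"
    if xy: "x \<in> X" "y \<in> X" and f: "term_fun 3 A (\<lambda>xs. f (xs ! 0) (xs ! 1))" for f x y
  proof -
    have "dm A [f x y] \<le> type_dim F \<delta> 1 (tuples1 {f x y | x y. x \<in> X \<and> y \<in> X})"
    proof (rule type_le)
      fix ws assume ws: "teq F A [f x y] ws"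
      then obtain w where w: "ws = [w]" using teq_length[OF ws] by (auto simp: length_Suc_conv)
      obtain zs where zs: "teq F A ([x, y] @ [f x y]) (zs @ [w])" "length zs = length [x, y]"
        using teq_homogeneous[OF assms(4) ws[unfolded w]] .
      then obtain x' y' where "zs = [x', y']" by (auto simp: length_Suc_conv)
      note t = zs(1)[unfolded this, simplified]
      have "w = f x' y'"
        using teq_eq[OF t, of "\<lambda>xs. xs ! 2" "\<lambda>xs. f (xs ! 0) (xs ! 1)"] f by (simp add: term_fun_nth numeral_3_eq_3)
      moreover have "teq F A [x] [x']" "teq F A [y] [y']"
        using teq_coords[OF t, of "[0]"] teq_coords[OF t, of "[1]"] by auto
      then have "x' \<in> X" "y' \<in> X" using X_cong xy by blast+
      ultimately show "ws \<in> tuples1 {f x y | x y. x \<in> X \<and> y \<in> X}" unfolding w tuples1_def by blast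
    qed simp
    then show ?thesis using rk_set[of A "[f x y]"] by simp
  qed
  have P_X: "P \<subseteq> X" using \<Gamma>p unfolding P_def assms(6) points_def realizations_def by auto
  \<comment> \<open>By completeness no \<open>A\<close>-definable set splits \<open>P\<close>, so
    every competitor for the rank of one point contains all of \<open>P\<close>; this yields the
    lower bound \<open>d\<close>.\<close>
  have P_complete: "tuples1 P \<subseteq> S" if S: "definable F A 1 S" "[x] \<in> S" "x \<in> P" for S x
  proof -
    obtain \<phi> where \<phi>: "\<phi> \<in> formulas 1 A" "S = solutions F 1 \<phi>" using S(1) by (rule definableE)
    have x: "[x] \<in> realizations F 1 p" using S(3) unfolding P_def points_def by simp
    have "Neg \<phi> \<notin> p"
      using x S(2) \<phi>(2) by (auto simp: realizations_def solutions_def holds_def)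
    then have "\<phi> \<in> p" using ct \<phi>(1) unfolding complete_type_def by blast
    then show ?thesis unfolding P_def tuples_points \<phi>(2) by (auto simp: realizations_def solutions_def)
  qed
  interpret generic_realizations F \<delta> \<kappa> A P d
  proof unfold_locales
    show "|A| <o \<kappa>" by (rule assms(4))
    have "realizations F 1 p \<noteq> {}"
      using assms(2,4) pt unfolding sufficiently_saturated_def by blast
    then show "P \<noteq> {}" unfolding P_def tuples_points[symmetric] by (auto simp: tuples1_def)
    show "type_definable A 1 (tuples1 P)"
    proof (rule type_definableI)
      fix xs assume xs: "length xs = 1" "xs \<notin> tuples1 P"
      then obtain \<phi> where \<phi>: "\<phi> \<in> p" "\<not> holds F \<phi> xs"
        unfolding P_def tuples_points realizations_def by blast
      have "definable F A 1 (solutions F 1 \<phi>)" using \<phi>(1) p_formulas unfolding definable_def by blast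
      then have "definable F A 1 ({xs. length xs = 1} - solutions F 1 \<phi>)" by (rule definable_Diff)
      then show "\<exists>S. definable F A 1 S \<and> xs \<in> S \<and> S \<inter> tuples1 P = {}"
        using \<phi> xs(1) unfolding P_def tuples_points
        by (intro exI[of _ "{xs. length xs = 1} - solutions F 1 \<phi>"])
          (auto simp: solutions_def realizations_def)
    qed
    show "rk A {x} = d" if x: "x \<in> P" for x
    proof -
      have "dm A [x] \<le> d"
        unfolding dim_P[symmetric]
      proof (rule type_le)
        fix ys assume "teq F A [x] ys"
        moreover have "[x] \<in> realizations F 1 p" using x unfolding P_def points_def by simp
        ultimately show "ys \<in> tuples1 P"
          unfolding P_def tuples_points by (rule realizations_teq[OF p_formulas, rotated])
      qed simp
      moreover have "d \<le> dm A [x]"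
      proof (rule dm_geI)
        fix S assume S: "definable F A (length [x]) S" "[x] \<in> S"
        then have "tuples1 P \<subseteq> S" using P_complete x by simp
        moreover obtain \<phi> where "\<phi> \<in> formulas 1 A" "S = solutions F 1 \<phi>"
          using S(1) by (auto elim: definableE)
        ultimately show "d \<le> \<delta> S"
          unfolding dim_P[symmetric] type_dim_def by (intro INF_lower2[of \<phi>]) (auto simp: formulas_def)
      qed
      ultimately show ?thesis using rk_set[of A "[x]"] by simp
    qed
    show "0 < d" "d < top" using assms(7-10) unfolding d_def by auto
    show "rk A {x + y} \<le> d" if "x \<in> P" "y \<in> P" for x y
    proof -
      have "{x + y | x y. x \<in> X \<and> y \<in> X} = X + X" by (auto simp: set_plus_def)
      then show ?thesis
        using binary_le[of x y "(+)"] that P_X assms(8,9) unfolding d_def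
        by (auto simp: term_fun_nth term_fun_add)
    qed
    show "rk A {x * y} \<le> d" if "x \<in> P" "y \<in> P" for x y
    proof -
      have "{x * y | x y. x \<in> X \<and> y \<in> X} = X * X" by (auto simp: set_times_def)
      then show ?thesis
        using binary_le[of x y "(*)"] that P_X assms(9) unfolding d_def
        by (auto simp: term_fun_nth term_fun_mult)
    qed
  qed
  have "definable F UNIV 1 (tuples1 K)" using definable_K by (rule definable_mono) simp
  then show ?thesis
    using is_subfield_K dim_K unfolding Let_def K_eq P_def[symmetric] d_def[symmetric] by simp
qed

end
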